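(* In the regression setting described in the context, assume that the set of assumptions (SA) holds. Let $r\in(2,+\infty)$ and let $V\in\{2,\dots,n-1\}$ satisfy $1<V\le r$. Let $\widehat{m}_{\mathrm{VFCV}}$ be the model selected by $V$-fold cross-validation, $$\widehat{m}_{\mathrm{VFCV}}\in\arg\min_{m\in\mathcal{M}_n}\left\{\frac1V\sum_{j=1}^VP_n^{(j)}\gamma\big(\widehat{s}_m^{(-j)}\big)\right\}.$$ Then there exist a constant $L>0$ and an integer $n_0$, both depending only on the constants in (SA) and on $r$, such that for all $n\ge n_0$, with probability at least $1-Ln^{-2}$, $$\ell\left(s_*,\widehat{s}_{\widehat{m}_{\mathrm{VFCV}}}\right)\le\left(1+\frac{L}{\sqrt{\ln n}}\right)\inf_{m\in\mathcal{M}_n}\left\{\ell\left(s_*,\widehat{s}_m^{(-1)}\right)\right\}+L\frac{(\ln n)^3}{n}.$$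
   Context: Setting. $(X_i,Y_i)$, $i=1,\dots,n$, are i.i.d. with law $P$ on $\mathcal{X}\times\mathbb{R}$, $\mathcal{X}\subset\mathbb{R}^d$, with the same law as $(X,Y)$, and $Y=s_*(X)+\sigma(X)\varepsilon$, where $s_*\in L_2(P^X)$ ($P^X$ the law of $X$), $\mathbb{E}[\varepsilon|X]=0$, $\mathbb{E}[\varepsilon^2|X]=1$ and $\sigma:\mathcal{X}\to\mathbb{R}_+$. $\|\cdot\|_2$ is the norm of $L_2(P^X)$ and $\|\cdot\|_\infty$ the sup-norm. $\gamma(s)(x,y)=(y-s(x))^2$, $Pf=\mathbb{E}[f(X,Y)]$, $P_n=n^{-1}\sum_{i=1}^n\delta_{(X_i,Y_i)}$. $\mathcal{M}_n$ is a finite collection of models; each model $m\in\mathcal{M}_n$ is a linear subspace of $L_2(P^X)$ of finite dimension $D_m$. $s_m$ is the orthogonal projection of $s_*$ onto $m$ in $L_2(P^X)$, and $\widehat{s}_m\in\arg\min_{s\in m}P_n(\gamma(s))$. $\ell(s_*,s)=P(\gamma(s)-\gamma(s_* ))=\|s-s_*\|_2^2$. $V$-fold notation. $(B_j)_{1\le j\le V}$ is a (deterministic) partition of $\{1,\dots,n\}$, assumed regular: $\mathrm{Card}(B_j)=n/V$ for all $j$. $P_n^{(j)}=\frac{1}{\mathrm{Card}(B_j)}\sum_{i\in B_j}\delta_{(X_i,Y_i)}$, $P_n^{(-j)}=\frac1{n-\mathrm{Card}(B_j)}\sum_{i\notin B_j}\delta_{(X_i,Y_i)}$, and $\widehat{s}_m^{(-j)}\in\arg\min_{s\in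 m}P_n^{(-j)}(\gamma(s))$. Assumptions (SA): (P1) $\mathrm{Card}(\mathcal{M}_n)\le c_{\mathcal{M}}n^{\alpha_{\mathcal{M}}}$ for constants $c_{\mathcal{M}},\alpha_{\mathcal{M}}>0$. (Auslb) There exist $r_{\mathcal{M}},A_c>0$ such that for every $m\in\mathcal{M}_n$ there exist $b_m\in\mathbb{N}\setminus\{0\}$, a partition $(\Pi_i)_{i=1}^{b_m}$ of $\{1,\dots,D_m\}$, constants $0<A_1\le\dots\le A_{b_m}<\infty$ and an orthonormal basis $(\varphi_k)_{k=1}^{D_m}$ of $(m,\|\cdot\|_2)$ with $\sum_{i=1}^{b_m}\sqrt{A_i}\le r_{\mathcal{M}}\sqrt{D_m}$; $\|\varphi_k\|_\infty\le r_{\mathcal{M}}\sqrt{A_i}$ for all $i$ and $k\in\Pi_i$; and, for all $i,j$, $\max_{k\in\Pi_i}\mathrm{Card}(\Pi_{j|k})\le A_c\max\{A_jA_i^{-1},1\}$, where $\Pi_{j|k}=\{l\in\Pi_j:\mathrm{supp}(\varphi_k)\cap\mathrm{supp}(\varphi_l)\neq\emptyset\}$. (P2) There is $A_{\mathcal{M},+}>0$ such that for every $m\in\mathcal{M}_n$, $1\le D_m\le\max\{D_m,b_m^2A_{b_m}\}\le A_{\mathcal{M},+}n(\ln n)^{-2}$. (P3) There exist $m_0,m_1\in\mathcal{M}_n$ and constants $c_{\mathrm{rich}},A_{\mathrm{rich}}>0$ such that $D_{m_0}\in[\sqrt n,c_{\mathrm{rich}}\sqrt n]$ and $D_{m_1}\ge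 A_{\mathrm{rich}}n(\ln n)^{-2}$. (Ab) There is $A<\infty$ with $|Y_i|\le A$ (a.s.) and $\|s_m\|_\infty\le A$ for all $m\in\mathcal{M}_n$. (An) $\sigma(X_i)\ge\sigma_{\min}>0$ a.s. (Ap$_u$) There exist $\beta_+,C_+>0$ such that $\ell(s_*,s_m)\le C_+D_m^{-\beta_+}$ for all $m\in\mathcal{M}_n$. The "constants in (SA)" are $c_{\mathcal{M}},\alpha_{\mathcal{M}},r_{\mathcal{M}},A_c,A_{\mathcal{M},+},c_{\mathrm{rich}},A_{\mathrm{rich}},A,\sigma_{\min},\beta_+,C_+$; they do not depend on $n$. *)

theory Defs
  imports "HOL-Probability.Probability" "HOL-Library.Function_Algebras"
begin

text \<open>
  Pointwise scalar multiplication: it makes the library notions \<^const>\<open>subspace\<close>,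
  \<^const>\<open>span\<close> and \<^const>\<open>dim\<close> available for spaces of real functions.
\<close>

instantiation "fun" :: (type, real_vector) real_vector
begin

definition scaleR_fun :: "real \<Rightarrow> ('a \<Rightarrow> 'b) \<Rightarrow> 'a \<Rightarrow> 'b" where
  "scaleR_fun c f = (\<lambda>x. c *\<^sub>R f x)"

instance
  by standard (simp_all add: scaleR_fun_def fun_eq_iff algebra_simps)

end

text \<open>
  A point of \<open>\<real>\<^sup>d\<close> is a function in \<open>{1..d} \<rightarrow>\<^sub>E UNIV\<close>, so that the dimension \<open>d\<close>, on which the
  constants of the theorem must not depend, can be quantified inside a formula. For the same reason
  there is no type parameter for an abstract sample space: a sample of size \<open>n\<close> is a point
  \<open>\<omega>\<close> of the \<open>n\<close>-fold product of the law \<open>P\<close>, and \<open>\<omega> i = (X\<^sub>i, Y\<^sub>i)\<close>.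
\<close>

type_synonym point = "nat \<Rightarrow> real"
type_synonym observation = "point \<times> real"
type_synonym sample = "nat \<Rightarrow> observation"

definition euclid :: "nat \<Rightarrow> point measure" where
  "euclid d = PiM {1..d} (\<lambda>_. borel)"

definition law_on :: "nat \<Rightarrow> point set \<Rightarrow> observation measure \<Rightarrow> bool" where
  "law_on d \<X> P \<longleftrightarrow>
     \<X> \<subseteq> space (euclid d) \<and> prob_space P \<and>
     sets P = sets (restrict_space (euclid d) \<X> \<Otimes>\<^sub>M borel)"

definition lawX :: "nat \<Rightarrow> point set \<Rightarrow> observation measure \<Rightarrow> point measure" where
  "lawX d \<X> P = distr P (restrict_space (euclid d) \<X>) fst"

definition sample_measure :: "nat \<Rightarrow> observation measure \<Rightarrow> sample measure" where
  "sample_measure n P = PiM {1..n} (\<lambda>_. P)"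


text \<open>
  Functions on \<open>\<X>\<close>, which is the space of \<open>Q\<close> in what follows, are extended by 0 outside \<open>\<X>\<close>.
  They are genuine functions and not classes modulo null sets, since least squares evaluates
  them at the observations.
\<close>

definition L2 :: "point measure \<Rightarrow> (point \<Rightarrow> real) set" where
  "L2 Q = {f \<in> borel_measurable Q. integrable Q (\<lambda>x. (f x)\<^sup>2) \<and> (\<forall>x. x \<notin> space Q \<longrightarrow> f x = 0)}"

definition L2_inner :: "point measure \<Rightarrow> (point \<Rightarrow> real) \<Rightarrow> (point \<Rightarrow> real) \<Rightarrow> real" where
  "L2_inner Q f g = (\<integral>x. f x * g x \<partial>Q)"

definition sup_norm :: "'a set \<Rightarrow> ('a \<Rightarrow> real) \<Rightarrow> ereal" where
  "sup_norm S f = (SUP x\<in>S. ereal \<bar>f x\<bar>)"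

text \<open>
  The third condition says that distinct elements of the model represent distinct classes, so that
  the model embeds in the Hilbert space \<open>L\<^sub>2(Q)\<close> and \<^term>\<open>dim m\<close> is its dimension there.
  Every finite-dimensional subspace of classes arises in this way, by choosing
  representatives of a basis.
\<close>

definition is_model :: "point measure \<Rightarrow> (point \<Rightarrow> real) set \<Rightarrow> bool" where
  "is_model Q m \<longleftrightarrow>
     m \<subseteq> L2 Q \<and> subspace m \<and>
     (\<forall>f\<in>m. (AE x in Q. f x = 0) \<longrightarrow> f = 0) \<and>
     (\<exists>F. finite F \<and> m = span F)"

definition orthonormal_basis ::
  "point measure \<Rightarrow> (point \<Rightarrow> real) set \<Rightarrow> (nat \<Rightarrow> point \<Rightarrow> real) \<Rightarrow> bool" where
  "orthonormal_basis Q m \<phi> \<longleftrightarrow>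
     (\<forall>k\<in>{1..dim m}. \<phi> k \<in> m) \<and>
     (\<forall>k\<in>{1..dim m}. \<forall>l\<in>{1..dim m}. L2_inner Q (\<phi> k) (\<phi> l) = (if k = l then 1 else 0)) \<and>
     span (\<phi> ` {1..dim m}) = m"

definition orth_proj ::
  "point measure \<Rightarrow> (point \<Rightarrow> real) set \<Rightarrow> (point \<Rightarrow> real) \<Rightarrow> point \<Rightarrow> real" where
  "orth_proj Q m s = (THE p. p \<in> m \<and> (\<forall>f\<in>m. L2_inner Q (\<lambda>x. s x - p x) f = 0))"


definition contrast :: "(point \<Rightarrow> real) \<Rightarrow> observation \<Rightarrow> real" where
  "contrast s = (\<lambda>(x, y). (y - s x)\<^sup>2)"

definition excess_risk ::
  "observation measure \<Rightarrow> (point \<Rightarrow> real) \<Rightarrow> (point \<Rightarrow> real) \<Rightarrow> real" where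
  "excess_risk P s_star s = (\<integral>z. contrast s z - contrast s_star z \<partial>P)"

definition empirical :: "nat set \<Rightarrow> sample \<Rightarrow> (observation \<Rightarrow> real) \<Rightarrow> real" where
  "empirical I \<omega> f = (\<Sum>i\<in>I. f (\<omega> i)) / real (card I)"

definition least_squares ::
  "nat set \<Rightarrow> sample \<Rightarrow> (point \<Rightarrow> real) set \<Rightarrow> (point \<Rightarrow> real) \<Rightarrow> bool" where
  "least_squares I \<omega> m s \<longleftrightarrow> is_arg_min (\<lambda>t. empirical I \<omega> (contrast t)) (\<lambda>t. t \<in> m) s"


text \<open>
  On the probability space \<open>P\<close> the variables \<open>X\<close> and \<open>Y\<close> are \<^const>\<open>fst\<close> and \<^const>\<open>snd\<close>. Taking
  the noise \<open>\<epsilon>\<close> to be defined on this space is no restriction here: \<open>\<sigma>(X) > 0\<close> almost surely by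
  assumption \<open>An\<close> below, hence \<open>\<epsilon> = (Y - s_star(X)) / \<sigma>(X)\<close> almost surely.
\<close>

definition regression_model ::
  "nat \<Rightarrow> point set \<Rightarrow> observation measure \<Rightarrow> (point \<Rightarrow> real) \<Rightarrow> (point \<Rightarrow> real) \<Rightarrow> bool" where
  "regression_model d \<X> P s_star \<sigma> \<longleftrightarrow>
     law_on d \<X> P \<and>
     s_star \<in> L2 (lawX d \<X> P) \<and>
     \<sigma> \<in> borel_measurable (lawX d \<X> P) \<and> (\<forall>x\<in>\<X>. 0 \<le> \<sigma> x) \<and>
     (\<exists>\<epsilon>. \<epsilon> \<in> borel_measurable P \<and> integrable P \<epsilon> \<and> integrable P (\<lambda>z. (\<epsilon> z)\<^sup>2) \<and>
        (AE z in P. snd z = s_star (fst z) + \<sigma> (fst z) * \<epsilon> z) \<and>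
        (let \<F> = vimage_algebra (space P) fst (restrict_space (euclid d) \<X>) in
           (AE z in P. real_cond_exp P \<F> \<epsilon> z = 0) \<and>
           (AE z in P. real_cond_exp P \<F> (\<lambda>z. (\<epsilon> z)\<^sup>2) z = 1)))"

definition indexed_partition :: "(nat \<Rightarrow> nat set) \<Rightarrow> nat set \<Rightarrow> nat set \<Rightarrow> bool" where
  "indexed_partition F I S \<longleftrightarrow>
     (\<forall>i\<in>I. F i \<noteq> {}) \<and> disjoint_family_on F I \<and> (\<Union>i\<in>I. F i) = S"

definition regular_folds :: "nat \<Rightarrow> nat \<Rightarrow> (nat \<Rightarrow> nat set) \<Rightarrow> bool" where
  "regular_folds n V B \<longleftrightarrow>
     indexed_partition B {1..V} {1..n} \<and> (\<forall>j\<in>{1..V}. real (card (B j)) = real n / real V)"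

text \<open>The argument \<open>t j m\<close> stands for an estimator on \<open>m\<close> trained without the fold \<open>B j\<close>.\<close>

definition cv_criterion ::
  "nat \<Rightarrow> (nat \<Rightarrow> nat set) \<Rightarrow> sample \<Rightarrow> (nat \<Rightarrow> (point \<Rightarrow> real) set \<Rightarrow> point \<Rightarrow> real) \<Rightarrow>
     (point \<Rightarrow> real) set \<Rightarrow> real" where
  "cv_criterion V B \<omega> t m = (\<Sum>j = 1..V. empirical (B j) \<omega> (contrast (t j m))) / real V"


definition P1 :: "real \<Rightarrow> real \<Rightarrow> nat \<Rightarrow> (point \<Rightarrow> real) set set \<Rightarrow> bool" where
  "P1 c\<^sub>M \<alpha>\<^sub>M n \<M> \<longleftrightarrow> real (card \<M>) \<le> c\<^sub>M * real n powr \<alpha>\<^sub>M"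

text \<open>
  Condition \<open>Auslb\<close> for one model with fixed \<open>b\<close>, \<open>J\<close>, \<open>A\<close> and \<open>\<phi>\<close>. The support is the set
  where the function does not vanish; taking closures instead would only make the last
  requirement more restrictive.
\<close>

definition localized_basis ::
  "real \<Rightarrow> real \<Rightarrow> point measure \<Rightarrow> (point \<Rightarrow> real) set \<Rightarrow>
     nat \<Rightarrow> (nat \<Rightarrow> nat set) \<Rightarrow> (nat \<Rightarrow> real) \<Rightarrow> (nat \<Rightarrow> point \<Rightarrow> real) \<Rightarrow> bool" where
  "localized_basis r\<^sub>M A\<^sub>c Q m b J A \<phi> \<longleftrightarrow>
     b \<noteq> 0 \<and>
     indexed_partition J {1..b} {1..dim m} \<and>
     (\<forall>i\<in>{1..b}. 0 < A i) \<and> mono_on {1..b} A \<and>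
     orthonormal_basis Q m \<phi> \<and>
     (\<Sum>i = 1..b. sqrt (A i)) \<le> r\<^sub>M * sqrt (real (dim m)) \<and>
     (\<forall>i\<in>{1..b}. \<forall>k\<in>J i. sup_norm (space Q) (\<phi> k) \<le> ereal (r\<^sub>M * sqrt (A i))) \<and>
     (let supp = (\<lambda>f. {x \<in> space Q. f x \<noteq> 0}) in
        \<forall>i\<in>{1..b}. \<forall>j\<in>{1..b}. \<forall>k\<in>J i.
          real (card {l \<in> J j. supp (\<phi> k) \<inter> supp (\<phi> l) \<noteq> {}}) \<le> A\<^sub>c * max (A j / A i) 1)"

definition P2 ::
  "real \<Rightarrow> nat \<Rightarrow> (point \<Rightarrow> real) set \<Rightarrow> nat \<Rightarrow> (nat \<Rightarrow> real) \<Rightarrow> bool" where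
  "P2 A\<^sub>p n m b A \<longleftrightarrow>
     1 \<le> dim m \<and>
     max (real (dim m)) ((real b)\<^sup>2 * A b) \<le> A\<^sub>p * real n / (ln (real n))\<^sup>2"

text \<open>
  \<open>Auslb\<close> and \<open>P2\<close> are stated together, since \<open>P2\<close> refers to the \<open>b\<close> and \<open>A\<close> provided by \<open>Auslb\<close>.
\<close>

definition Auslb_P2 ::
  "real \<Rightarrow> real \<Rightarrow> real \<Rightarrow> nat \<Rightarrow> point measure \<Rightarrow> (point \<Rightarrow> real) set set \<Rightarrow> bool" where
  "Auslb_P2 r\<^sub>M A\<^sub>c A\<^sub>p n Q \<M> \<longleftrightarrow>
     (\<forall>m\<in>\<M>. \<exists>b J A \<phi>. localized_basis r\<^sub>M A\<^sub>c Q m b J A \<phi> \<and> P2 A\<^sub>p n m b A)"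

definition P3 :: "real \<Rightarrow> real \<Rightarrow> nat \<Rightarrow> (point \<Rightarrow> real) set set \<Rightarrow> bool" where
  "P3 c\<^sub>r A\<^sub>r n \<M> \<longleftrightarrow>
     (\<exists>m\<^sub>0\<in>\<M>. \<exists>m\<^sub>1\<in>\<M>. real (dim m\<^sub>0) \<in> {sqrt (real n)..c\<^sub>r * sqrt (real n)} \<and>
        A\<^sub>r * real n / (ln (real n))\<^sup>2 \<le> real (dim m\<^sub>1))"

definition Ab ::
  "real \<Rightarrow> observation measure \<Rightarrow> point measure \<Rightarrow> (point \<Rightarrow> real) \<Rightarrow>
     (point \<Rightarrow> real) set set \<Rightarrow> bool" where
  "Ab A P Q s_star \<M> \<longleftrightarrow>
     (AE z in P. \<bar>snd z\<bar> \<le> A) \<and>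
     (\<forall>m\<in>\<M>. sup_norm (space Q) (orth_proj Q m s_star) \<le> ereal A)"

definition An :: "real \<Rightarrow> point measure \<Rightarrow> (point \<Rightarrow> real) \<Rightarrow> bool" where
  "An \<sigma>\<^sub>m Q \<sigma> \<longleftrightarrow> (AE x in Q. \<sigma>\<^sub>m \<le> \<sigma> x)"

definition Apu ::
  "real \<Rightarrow> real \<Rightarrow> observation measure \<Rightarrow> point measure \<Rightarrow> (point \<Rightarrow> real) \<Rightarrow>
     (point \<Rightarrow> real) set set \<Rightarrow> bool" where
  "Apu \<beta>\<^sub>p C\<^sub>p P Q s_star \<M> \<longleftrightarrow>
     (\<forall>m\<in>\<M>. excess_risk P s_star (orth_proj Q m s_star) \<le> C\<^sub>p * real (dim m) powr (- \<beta>\<^sub>p))"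

end

theory Submission
  imports Defs
begin

text \<open>
  In an orthonormal basis of a model \<open>m\<close> of dimension \<open>D\<close>, the least-squares estimator on a subsample
  \<open>I\<close> is \<open>s\<^sub>m + \<Sum> \<beta>\<^sub>k \<phi>\<^sub>k\<close>, where \<open>\<beta>\<close> solves \<open>G \<beta> = v\<close> with \<open>G\<close> the empirical Gram matrix and
  \<open>v\<close> the empirical mean of \<open>\<phi>\<^sub>k(X) (Y - s\<^sub>m(X))\<close>. By Bernstein's inequality for the entries and a
  weighted Schur test adapted to the overlaps of the basis, \<open>G\<close> is within \<open>O(1 / sqrt (ln n))\<close> of the
  identity in operator norm. The squared norm of \<open>v\<close> is a sum of independent terms plus a martingale, and
  concentrates around \<open>C\<^sub>m / card I\<close>, where \<open>C\<^sub>m\<close> is the sum of the variances of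
  \<open>\<phi>\<^sub>k(X) (Y - s\<^sub>m(X))\<close>; the noise level gives \<open>C\<^sub>m \<ge> \<sigma>\<^sub>m\<^sup>2 D\<close>, so that errors
  proportional to \<open>D\<close> are relative errors. Hence the risks of the estimators trained without a fold, and
  the cross-validation criterion up to a term that does not depend on \<open>m\<close>, are all equal to
  \<open>\<parallel>s\<^sub>m - s\<^sub>*\<parallel>\<^sup>2 + C\<^sub>m / (n - n / V)\<close> up to a relative error
  \<open>O(1 / sqrt (ln n))\<close> and an absolute error \<open>O((ln n)\<^sup>3 / n)\<close>, while the risk on the full sample is
  at most this quantity up to the same errors.
\<close>

section \<open>Martingale deviation inequality\<close>

text \<open>The estimators and the selected model are arbitrary minimizers, without measurability in
  the sample. Random events therefore concern explicit sums only: Gram entries, noise sums, loss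
  gaps. The estimators enter afterwards, through normal equations and inequalities that are uniform
  over all coefficient vectors. With L = ln n, the rate 1 / sqrt L stems from the bounds of order n
  / L^2 on the dimension and on the amplitudes: deviations of probability n^(-K) are paid by a
  factor L or sqrt L, and one power of sqrt L remains. Two fluctuations are not small relative to
  the target when a model is small or nearly unbiased, namely the cross terms of the squared noise
  norm, of order sqrt D * L / n, and the loss gap of the projection, of order sqrt (bias * L / n).
  Each is split into a part with factor 1 / sqrt L and a remainder, rounded up to L^3 / n; this is
  the additive term. Models are then compared through a single number t per model, which is close to
  both the centred criterion and the risk off the first fold, and bounds the final risk from
  above.\<close>

lemma exp_le_one_plus_square:
  fixes t :: real
  assumes "\<bar>t\<bar> \<le> 1"
  shows "exp t \<le> 1 + t + t\<^sup>2"
proof (cases "t \<ge> 0")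
  case True
  then show ?thesis using exp_bound[of t] assms by simp
next
  case False
  define s where "s = - t"
  have s: "0 < s" "s \<le> 1" using False assms by (auto simp: s_def)
  \<comment> \<open>For negative arguments \<open>1 - s + s\<^sup>2\<close> is at least
    \<open>1 / (1 + s)\<close>, which dominates \<open>exp (- s)\<close>.\<close>
  have "(1 - s + s\<^sup>2) * (1 + s) = 1 + s ^ 3" by algebra
  moreover have "1 + s ^ 3 \<ge> 1" using s by simp
  moreover have "exp s \<ge> 1 + s" by simp
  moreover have "1 - s + s\<^sup>2 > 0" using s by (smt (verit) zero_less_power)
  ultimately have "1 \<le> (1 - s + s\<^sup>2) * exp s"
    by (smt (verit) mult_left_mono)
  then have "exp (- s) \<le> 1 - s + s\<^sup>2"
    by (simp add: exp_minus field_simps)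
  then show ?thesis by (simp add: s_def)
qed

text \<open>In the quadratic bound on the exponential the linear term integrates to zero by
  centring, and the rest is absorbed into an exponential. The nonnegative integral makes the later
  recursion over coordinates an instance of Tonelli.\<close>

lemma (in prob_space) nn_integral_exp_le:
  assumes [measurable]: "f \<in> borel_measurable M"
    and bound: "AE z in M. \<bar>f z\<bar> \<le> b" and mean: "(\<integral>z. f z \<partial>M) = 0"
    and var: "(\<integral>z. (f z)\<^sup>2 \<partial>M) \<le> v" and c: "\<bar>c\<bar> * b \<le> 1"
  shows "(\<integral>\<^sup>+z. ennreal (exp (c * f z)) \<partial>M) \<le> ennreal (exp (c\<^sup>2 * v))"
proof -
  have int: "integrable M f"
    by (rule integrable_const_bound[of _ b]) (use bound in auto)
  have int2: "integrable M (\<lambda>z. (f z)\<^sup>2)"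
    by (rule integrable_const_bound[of _ "b\<^sup>2"]) (use bound in \<open>auto elim!: eventually_mono simp: abs_le_square_iff[symmetric]\<close>)
  have "AE z in M. ennreal (exp (c * f z)) \<le> ennreal (1 + c * f z + c\<^sup>2 * (f z)\<^sup>2)"
    using bound
  proof (eventually_elim)
    fix z assume z: "\<bar>f z\<bar> \<le> b"
    have "\<bar>c * f z\<bar> \<le> \<bar>c\<bar> * b" using z by (simp add: abs_mult mult_left_mono)
    then have "exp (c * f z) \<le> 1 + c * f z + (c * f z)\<^sup>2"
      using c by (intro exp_le_one_plus_square) linarith
    then show "ennreal (exp (c * f z)) \<le> ennreal (1 + c * f z + c\<^sup>2 * (f z)\<^sup>2)"
      by (simp add: power_mult_distrib ennreal_leI)
  qed
  then have "(\<integral>\<^sup>+z. ennreal (exp (c * f z)) \<partial>M) \<le> (\<integral>\<^sup>+z. ennreal (1 + c * f z + c\<^sup>2 * (f z)\<^sup>2) \<partial>M)"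
    by (rule nn_integral_mono_AE)
  also have "\<dots> = ennreal (\<integral>z. 1 + c * f z + c\<^sup>2 * (f z)\<^sup>2 \<partial>M)"
  proof (rule nn_integral_eq_integral)
    show "integrable M (\<lambda>z. 1 + c * f z + c\<^sup>2 * (f z)\<^sup>2)"
      using int int2 by auto
    have "0 \<le> 1 + u + u\<^sup>2" for u :: real
      using zero_le_power2[of "u + 1/2"] by (simp add: power2_eq_square algebra_simps)
    from this[of "c * f _"] show "AE z in M. 0 \<le> 1 + c * f z + c\<^sup>2 * (f z)\<^sup>2"
      by (auto simp: power_mult_distrib)
  qed
  also have "(\<integral>z. 1 + c * f z + c\<^sup>2 * (f z)\<^sup>2 \<partial>M) = 1 + c\<^sup>2 * (\<integral>z. (f z)\<^sup>2 \<partial>M)"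
    using int int2 mean by (simp add: prob_space)
  also have "\<dots> \<le> 1 + c\<^sup>2 * v" using var by (simp add: mult_left_mono)
  also have "\<dots> \<le> exp (c\<^sup>2 * v)" by simp
  finally show ?thesis by (simp add: ennreal_leI)
qed

text \<open>The last coordinate is integrated out: its factor contributes at most
  \<open>exp K\<close> whatever the past, and the earlier factors do not see it. The condition
  \<open>adapted\<close> encodes predictability: \<open>g i u\<close> does not change when
  coordinate \<open>i\<close> or a later one is altered. Since \<open>bound\<close> holds for every
  past \<open>u\<close>, no conditional expectation appears.\<close>

lemma (in prob_space) nn_integral_exp_adapted_sum:
  fixes g :: "nat \<Rightarrow> (nat \<Rightarrow> 'a) \<Rightarrow> 'a \<Rightarrow> real"
  assumes meas: "\<And>m i. i \<in> {1..m} \<Longrightarrow> (\<lambda>u. g i u (u i)) \<in> borel_measurable (PiM {1..m} (\<lambda>_. M))"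
    and adapted: "\<And>i j u y z. i \<le> j \<Longrightarrow> g i (u(j := y)) z = g i u z"
    and bound: "\<And>i u. i \<ge> 1 \<Longrightarrow> (\<integral>\<^sup>+z. ennreal (exp (g i u z)) \<partial>M) \<le> ennreal (exp K)"
  shows "(\<integral>\<^sup>+u. ennreal (exp (\<Sum>i=1..n. g i u (u i))) \<partial>(PiM {1..n} (\<lambda>_. M))) \<le> ennreal (exp (real n * K))"
proof (induction n)
  case 0
  interpret P0: prob_space "PiM {} (\<lambda>_::nat. M)" by (rule prob_space_PiM) (rule prob_space_axioms)
  show ?case by (simp add: P0.emeasure_space_1)
next
  case (Suc n)
  interpret product_sigma_finite "\<lambda>_::nat. M"
    by standard
  have ins: "{1..Suc n} = insert (Suc n) {1..n}" by auto
  note [measurable] = meas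
  have meas1: "(\<lambda>u. ennreal (exp (\<Sum>i=1..m. g i u (u i)))) \<in> borel_measurable (PiM {1..m} (\<lambda>_. M))" for m
    by measurable
  have "(\<integral>\<^sup>+u. ennreal (exp (\<Sum>i=1..Suc n. g i u (u i))) \<partial>(PiM {1..Suc n} (\<lambda>_. M)))
      = (\<integral>\<^sup>+u. \<integral>\<^sup>+y. ennreal (exp (\<Sum>i=1..Suc n. g i (u(Suc n := y)) ((u(Suc n := y)) i))) \<partial>M \<partial>(PiM {1..n} (\<lambda>_. M)))"
    using meas1[of "Suc n"] unfolding ins by (subst product_nn_integral_insert) auto
  also have "\<dots> = (\<integral>\<^sup>+u. \<integral>\<^sup>+y. ennreal (exp (\<Sum>i=1..n. g i u (u i))) * ennreal (exp (g (Suc n) u y)) \<partial>M \<partial>(PiM {1..n} (\<lambda>_. M)))"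
    by (intro nn_integral_cong) (simp add: adapted exp_add ennreal_mult)
  also have "\<dots> \<le> (\<integral>\<^sup>+u. ennreal (exp (\<Sum>i=1..n. g i u (u i))) * ennreal (exp K) \<partial>(PiM {1..n} (\<lambda>_. M)))"
  proof (intro nn_integral_mono)
    fix u assume u: "u \<in> space (PiM {1..n} (\<lambda>_. M))"
    have "(\<integral>\<^sup>+y. ennreal (exp (\<Sum>i=1..n. g i u (u i))) * ennreal (exp (g (Suc n) u y)) \<partial>M)
        = ennreal (exp (\<Sum>i=1..n. g i u (u i))) * (\<integral>\<^sup>+y. ennreal (exp (g (Suc n) u y)) \<partial>M)"
    proof (rule nn_integral_cmult)
      have "(\<lambda>y. u(Suc n := y)) \<in> measurable M (PiM {1..Suc n} (\<lambda>_. M))"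
        using u unfolding ins by (intro measurable_fun_upd[where J="{1..n}"]) auto
      then have "(\<lambda>y. g (Suc n) (u(Suc n := y)) ((u(Suc n := y)) (Suc n))) \<in> borel_measurable M"
        by (rule measurable_compose) (use meas[of "Suc n" "Suc n"] in simp)
      then show "(\<lambda>y. ennreal (exp (g (Suc n) u y))) \<in> borel_measurable M"
        by (simp add: adapted)
    qed
    also have "\<dots> \<le> ennreal (exp (\<Sum>i=1..n. g i u (u i))) * ennreal (exp K)"
      by (intro mult_left_mono bound) auto
    finally show "(\<integral>\<^sup>+y. ennreal (exp (\<Sum>i=1..n. g i u (u i))) * ennreal (exp (g (Suc n) u y)) \<partial>M) \<le> ennreal (exp (\<Sum>i=1..n. g i u (u i))) * ennreal (exp K)" .
  qed
  also have "\<dots> = (\<integral>\<^sup>+u. ennreal (exp (\<Sum>i=1..n. g i u (u i))) \<partial>(PiM {1..n} (\<lambda>_. M))) * ennreal (exp K)"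
    by (rule nn_integral_multc) (rule meas1)
  also have "\<dots> \<le> ennreal (exp (real n * K)) * ennreal (exp K)"
    by (rule mult_right_mono[OF Suc.IH]) simp
  also have "\<dots> = ennreal (exp (real (Suc n) * K))"
    by (simp add: ennreal_mult[symmetric] exp_add[symmetric] algebra_simps)
  finally show ?case .
qed

text \<open>Chernoff's method: at the threshold \<open>2 * x / c\<close> Markov's inequality brings
  the factor \<open>exp (- 2 * x)\<close>, and the Laplace transform costs at most
  \<open>exp x\<close>.\<close>

lemma (in prob_space) adapted_sum_upper_tail:
  fixes g :: "nat \<Rightarrow> (nat \<Rightarrow> 'a) \<Rightarrow> 'a \<Rightarrow> real"
  defines "N \<equiv> \<lambda>n::nat. PiM {1..n} (\<lambda>_. M)"
  assumes meas: "\<And>m i. i \<in> {1..m} \<Longrightarrow> (\<lambda>u. g i u (u i)) \<in> borel_measurable (N m)"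
    and meas1: "\<And>i u. g i u \<in> borel_measurable M"
    and adapted: "\<And>i j u y z. i \<le> j \<Longrightarrow> g i (u(j := y)) z = g i u z"
    and bound: "\<And>i u. AE z in M. \<bar>g i u z\<bar> \<le> b" and mean: "\<And>i u. (\<integral>z. g i u z \<partial>M) = 0"
    and var: "\<And>i u. (\<integral>z. (g i u z)\<^sup>2 \<partial>M) \<le> v"
    and c: "0 < c" "c * b \<le> 1" "real n * (c\<^sup>2 * v) \<le> x"
  shows "measure (N n) {u \<in> space (N n). (\<Sum>i=1..n. g i u (u i)) > 2 * x / c} \<le> exp (- x)"
proof -
  interpret N: prob_space "N n" unfolding N_def by (rule prob_space_PiM) (rule prob_space_axioms)
  note [measurable] = meas
  let ?S = "\<lambda>u. \<Sum>i=1..n. g i u (u i)"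
  have S[measurable]: "?S \<in> borel_measurable (N n)" by measurable
  have "emeasure (N n) {u \<in> space (N n). ?S u > 2 * x / c} \<le> emeasure (N n) {u \<in> space (N n). 1 \<le> ennreal (exp (- 2 * x)) * ennreal (exp (\<Sum>i=1..n. c * g i u (u i)))}"
  proof (rule emeasure_mono)
    show "{u \<in> space (N n). ?S u > 2 * x / c} \<subseteq> {u \<in> space (N n). 1 \<le> ennreal (exp (- 2 * x)) * ennreal (exp (\<Sum>i=1..n. c * g i u (u i)))}"
    proof safe
      fix u assume "?S u > 2 * x / c"
      then have "0 \<le> - 2 * x + c * ?S u" using c by (simp add: field_simps)
      then have "1 \<le> exp (- 2 * x + c * ?S u)" by simp
      then show "1 \<le> ennreal (exp (- 2 * x)) * ennreal (exp (\<Sum>i=1..n. c * g i u (u i)))"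
        by (simp add: ennreal_mult[symmetric] exp_add[symmetric] sum_distrib_left)
    qed
  qed measurable
  also have "\<dots> \<le> ennreal (exp (- 2 * x)) * (\<integral>\<^sup>+u. ennreal (exp (\<Sum>i=1..n. c * g i u (u i))) * indicator (space (N n)) u \<partial>(N n))"
    by (rule order_trans[OF _ nn_integral_Markov_inequality]) (auto intro!: emeasure_mono)
  also have "(\<integral>\<^sup>+u. ennreal (exp (\<Sum>i=1..n. c * g i u (u i))) * indicator (space (N n)) u \<partial>(N n))
     = (\<integral>\<^sup>+u. ennreal (exp (\<Sum>i=1..n. c * g i u (u i))) \<partial>(N n))"
    by (intro nn_integral_cong) auto
  also have "\<dots> \<le> ennreal (exp (real n * (c\<^sup>2 * v)))"
    unfolding N_def
  proof (rule nn_integral_exp_adapted_sum)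
    show "(\<integral>\<^sup>+z. ennreal (exp (c * g i u z)) \<partial>M) \<le> ennreal (exp (c\<^sup>2 * v))" for i u
      by (rule nn_integral_exp_le[OF meas1 bound mean var]) (use c in auto)
    show "(\<lambda>u. c * g i u (u i)) \<in> borel_measurable (Pi\<^sub>M {1..m} (\<lambda>_. M))" if "i \<in> {1..m}" for m i
      using meas[OF that] by (simp add: N_def)
    show "c * g i (u(j := y)) z = c * g i u z" if "i \<le> j" for i j u y z
      by (simp only: adapted[OF that])
  qed
  also have "\<dots> \<le> ennreal (exp x)" using c by (intro ennreal_leI) simp
  also have "ennreal (exp (- 2 * x)) * ennreal (exp x) = ennreal (exp (- x))"
    by (simp add: ennreal_mult[symmetric] exp_add[symmetric])
  finally show ?thesis
    by (simp add: N.emeasure_eq_measure mult_left_mono)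
qed

text \<open>With uniform bounds on the increments and on their conditional variances, a martingale
  obeys the same Bernstein inequality as an independent sum. The factor 2 on the right accounts for
  the two signs.\<close>

lemma (in prob_space) adapted_sum_bernstein:
  fixes g :: "nat \<Rightarrow> (nat \<Rightarrow> 'a) \<Rightarrow> 'a \<Rightarrow> real"
  defines "N \<equiv> \<lambda>n::nat. PiM {1..n} (\<lambda>_. M)"
  assumes meas: "\<And>m i. i \<in> {1..m} \<Longrightarrow> (\<lambda>u. g i u (u i)) \<in> borel_measurable (N m)"
    and meas1: "\<And>i u. g i u \<in> borel_measurable M"
    and adapted: "\<And>i j u y z. i \<le> j \<Longrightarrow> g i (u(j := y)) z = g i u z"
    and bound: "\<And>i u. AE z in M. \<bar>g i u z\<bar> \<le> b" and mean: "\<And>i u. (\<integral>z. g i u z \<partial>M) = 0"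
    and var: "\<And>i u. (\<integral>z. (g i u z)\<^sup>2 \<partial>M) \<le> v"
    and pos: "0 < b" "0 \<le> v" "0 < x"
  shows "measure (N n) {u \<in> space (N n). \<bar>\<Sum>i=1..n. g i u (u i)\<bar> > 2 * (sqrt (real n * v * x) + b * x)} \<le> 2 * exp (- x)"
proof -
  interpret N: prob_space "N n" unfolding N_def by (rule prob_space_PiM) (rule prob_space_axioms)
  note [measurable] = meas
  \<comment> \<open>The choice \<open>c = 1 / (s + b)\<close> meets \<open>c * b \<le> 1\<close> and
    the variance condition at once, also when \<open>v = 0\<close>, and turns
    \<open>2 * x / c\<close> into exactly the announced threshold.\<close>
  define s where "s = sqrt (real n * v / x)"
  define c where "c = 1 / (s + b)"
  have s0: "s \<ge> 0" using pos by (simp add: s_def)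
  have c0: "0 < c" using s0 pos by (simp add: c_def)
  have c1: "c * b \<le> 1" using s0 pos by (simp add: c_def field_simps)
  have "c * s \<le> 1" "0 \<le> c * s" using s0 pos by (auto simp: c_def field_simps)
  then have "(c * s)\<^sup>2 \<le> 1" by (simp add: power_le_one)
  moreover have "s\<^sup>2 = real n * v / x" using pos by (simp add: s_def)
  ultimately have c2: "real n * (c\<^sup>2 * v) \<le> x"
    using pos by (simp add: power_mult_distrib field_simps)
  have sx: "s * x = sqrt (real n * v * x)"
  proof -
    have "s * x = sqrt (real n * v / x) * sqrt (x\<^sup>2)" using pos by (simp add: s_def)
    also have "\<dots> = sqrt (real n * v / x * x\<^sup>2)" by (simp only: real_sqrt_mult)
    also have "real n * v / x * x\<^sup>2 = real n * v * x" using pos by (simp add: power2_eq_square)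
    finally show ?thesis .
  qed
  then have eq: "2 * x / c = 2 * (sqrt (real n * v * x) + b * x)"
    using s0 pos by (simp add: c_def algebra_simps)
  have "measure (N n) {u \<in> space (N n). (\<Sum>i=1..n. g i u (u i)) > 2 * x / c} \<le> exp (- x)"
    unfolding N_def by (rule adapted_sum_upper_tail[OF _ meas1 adapted bound mean var c0 c1 c2])
       (use meas in \<open>auto simp: N_def\<close>)
  moreover have "measure (N n) {u \<in> space (N n). (\<Sum>i=1..n. - g i u (u i)) > 2 * x / c} \<le> exp (- x)"
    unfolding N_def
  proof (rule adapted_sum_upper_tail[OF _ _ _ _ _ _ c0 c1 c2])
    show "(\<lambda>u. - g i u (u i)) \<in> borel_measurable (Pi\<^sub>M {1..m} (\<lambda>_. M))" if "i \<in> {1..m}" for m i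
      using meas[OF that] by (simp add: N_def)
    show "- g i (u(j := y)) z = - g i u z" if "i \<le> j" for i j u y z
      by (simp only: adapted[OF that])
  qed (use meas1 bound mean var in auto)
  moreover have "{u \<in> space (N n). \<bar>\<Sum>i=1..n. g i u (u i)\<bar> > 2 * x / c} =
     {u \<in> space (N n). (\<Sum>i=1..n. g i u (u i)) > 2 * x / c} \<union> {u \<in> space (N n). (\<Sum>i=1..n. - g i u (u i)) > 2 * x / c}"
    by (auto simp: sum_negf abs_if)
  ultimately have "measure (N n) {u \<in> space (N n). \<bar>\<Sum>i=1..n. g i u (u i)\<bar> > 2 * x / c} \<le> exp (- x) + exp (- x)"
    using measure_Un_le[of "{u \<in> space (N n). (\<Sum>i=1..n. g i u (u i)) > 2 * x / c}" "N n"
       "{u \<in> space (N n). (\<Sum>i=1..n. - g i u (u i)) > 2 * x / c}"] by simp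
  then show ?thesis by (simp add: eq)
qed

section \<open>Localized bases\<close>

text \<open>\<open>Q\<close> itself may fail to be measurable: it holds off a measurable set of
  probability at most \<open>p\<close>. The predicates used later quantify over all coefficient
  vectors or over all least-squares estimators.\<close>

definition holds_except :: "'a measure \<Rightarrow> real \<Rightarrow> ('a \<Rightarrow> bool) \<Rightarrow> bool" where
  "holds_except N p Q \<longleftrightarrow> (\<exists>F\<in>sets N. measure N F \<le> p \<and> (\<forall>u\<in>space N - F. Q u))"

lemma holds_except_mono:
  assumes "holds_except N p Q" "p \<le> q" "\<And>u. u \<in> space N \<Longrightarrow> Q u \<Longrightarrow> R u"
  shows "holds_except N q R"
  using assms unfolding holds_except_def by (meson DiffD1 order_trans)

lemma holds_exceptI:
  assumes "{u \<in> space N. \<not> Q u} \<in> sets N" "measure N {u \<in> space N. \<not> Q u} \<le> p"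
  shows "holds_except N p Q"
  using assms unfolding holds_except_def by (intro bexI[of _ "{u \<in> space N. \<not> Q u}"]) auto

lemma (in prob_space) holds_except_conj:
  assumes "holds_except M p Q" "holds_except M q R"
  shows "holds_except M (p + q) (\<lambda>u. Q u \<and> R u)"
proof -
  obtain F G where F: "F \<in> sets M" "measure M F \<le> p" "\<forall>u\<in>space M - F. Q u"
    and G: "G \<in> sets M" "measure M G \<le> q" "\<forall>u\<in>space M - G. R u"
    using assms unfolding holds_except_def by auto
  have "measure M (F \<union> G) \<le> p + q"
    using measure_Un_le[OF F(1) G(1)] F(2) G(2) by linarith
  then show ?thesis
    unfolding holds_except_def using F G by (intro bexI[of _ "F \<union> G"]) auto
qed

lemma (in prob_space) holds_except_ball:
  assumes "finite S" "\<And>s. s \<in> S \<Longrightarrow> holds_except M p (Q s)"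
  shows "holds_except M (real (card S) * p) (\<lambda>u. \<forall>s\<in>S. Q s u)"
  using assms
proof (induction S rule: finite_induct)
  case empty
  show ?case unfolding holds_except_def by (intro bexI[of _ "{}"]) auto
next
  case (insert s S)
  have "holds_except M (p + real (card S) * p) (\<lambda>u. Q s u \<and> (\<forall>s\<in>S. Q s u))"
    by (rule holds_except_conj) (use insert in auto)
  then show ?case
    by (rule holds_except_mono) (use insert in \<open>auto simp: algebra_simps\<close>)
qed

section \<open>Elementary inequalities for sums and symmetric kernels\<close>

lemma AE_abs_square_le:
  fixes f :: "'a \<Rightarrow> real"
  assumes "AE z in M. \<bar>f z\<bar> \<le> c"
  shows "AE z in M. \<bar>(f z)\<^sup>2\<bar> \<le> c\<^sup>2"
  using assms
proof eventually_elim
  case (elim z)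
  from power_mono[OF elim, of 2] show ?case by simp
qed

text \<open>Cauchy-Schwarz over pairs \<open>(k, l)\<close>, after writing each absolute entry as
  the product of the square roots of its multiples by \<open>w l / w k\<close> and by
  \<open>w k / w l\<close>. Symmetry turns the column sums required by the second factor into row
  sums.\<close>

lemma schur_test:
  fixes \<Delta> :: "'a \<Rightarrow> 'a \<Rightarrow> real"
  assumes "finite I" and sym: "\<And>k l. \<Delta> k l = \<Delta> l k"
    and w: "\<And>k. k \<in> I \<Longrightarrow> 0 < w k" and c: "0 \<le> c"
    and row: "\<And>k. k \<in> I \<Longrightarrow> (\<Sum>l\<in>I. \<bar>\<Delta> k l\<bar> * w l) \<le> c * w k"
  shows "\<bar>\<Sum>k\<in>I. \<Sum>l\<in>I. x k * y l * \<Delta> k l\<bar> \<le> c * sqrt (\<Sum>k\<in>I. (x k)\<^sup>2) * sqrt (\<Sum>k\<in>I. (y k)\<^sup>2)"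
proof -
  define f where "f = (\<lambda>(k, l). sqrt (\<bar>\<Delta> k l\<bar> * (w l / w k)) * \<bar>x k\<bar>)"
  define g where "g = (\<lambda>(k, l). sqrt (\<bar>\<Delta> k l\<bar> * (w k / w l)) * \<bar>y l\<bar>)"
  have fg: "\<bar>x k * y l * \<Delta> k l\<bar> = \<bar>f (k, l)\<bar> * \<bar>g (k, l)\<bar>" if "k \<in> I" "l \<in> I" for k l
  proof -
    have "sqrt (\<bar>\<Delta> k l\<bar> * (w l / w k)) * sqrt (\<bar>\<Delta> k l\<bar> * (w k / w l)) = \<bar>\<Delta> k l\<bar>"
      using w[of k] w[of l] that by (simp add: real_sqrt_mult[symmetric] field_simps)
    then show ?thesis
      using w[of k] w[of l] that unfolding f_def g_def by (simp add: abs_mult mult_ac)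
  qed
  have bd: "(\<Sum>k\<in>I. \<Sum>l\<in>I. \<bar>\<Delta> k l\<bar> * (w l / w k) * (z k)\<^sup>2) \<le> c * (\<Sum>k\<in>I. (z k)\<^sup>2)" for z
  proof -
    have "(\<Sum>l\<in>I. \<bar>\<Delta> k l\<bar> * (w l / w k) * (z k)\<^sup>2) \<le> c * (z k)\<^sup>2" if k: "k \<in> I" for k
    proof -
      have "(\<Sum>l\<in>I. \<bar>\<Delta> k l\<bar> * (w l / w k) * (z k)\<^sup>2) = (\<Sum>l\<in>I. \<bar>\<Delta> k l\<bar> * w l) * ((z k)\<^sup>2 / w k)"
        by (simp add: sum_distrib_right sum_divide_distrib mult.assoc)
      also have "\<dots> \<le> c * w k * ((z k)\<^sup>2 / w k)"
        using row[OF k] w[OF k] by (intro mult_right_mono) auto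
      finally show ?thesis using w[OF k] by simp
    qed
    then show ?thesis by (simp add: sum_distrib_left sum_mono)
  qed
  have f: "L2_set f (I \<times> I) \<le> sqrt (c * (\<Sum>k\<in>I. (x k)\<^sup>2))"
  proof -
    have "(\<Sum>p\<in>I \<times> I. (f p)\<^sup>2) = (\<Sum>k\<in>I. \<Sum>l\<in>I. \<bar>\<Delta> k l\<bar> * (w l / w k) * (x k)\<^sup>2)"
      unfolding sum.cartesian_product
      using w by (intro sum.cong) (auto simp: f_def power_mult_distrib less_imp_le)
    then show ?thesis unfolding L2_set_def using bd[of x] by simp
  qed
  have g: "L2_set g (I \<times> I) \<le> sqrt (c * (\<Sum>k\<in>I. (y k)\<^sup>2))"
  proof -
    have "(\<Sum>p\<in>I \<times> I. (g p)\<^sup>2) = (\<Sum>k\<in>I. \<Sum>l\<in>I. (g (k, l))\<^sup>2)"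
      by (simp add: sum.cartesian_product)
    also have "\<dots> = (\<Sum>l\<in>I. \<Sum>k\<in>I. (g (k, l))\<^sup>2)" by (rule sum.swap)
    also have "\<dots> = (\<Sum>k\<in>I. \<Sum>l\<in>I. \<bar>\<Delta> k l\<bar> * (w l / w k) * (y k)\<^sup>2)"
      using w by (intro sum.cong) (auto simp: g_def power_mult_distrib less_imp_le sym)
    finally show ?thesis unfolding L2_set_def using bd[of y] by simp
  qed
  have "\<bar>\<Sum>k\<in>I. \<Sum>l\<in>I. x k * y l * \<Delta> k l\<bar> \<le> (\<Sum>k\<in>I. \<Sum>l\<in>I. \<bar>x k * y l * \<Delta> k l\<bar>)"
    by (rule order_trans[OF sum_abs]) (intro sum_mono sum_abs)
  also have "\<dots> = (\<Sum>p\<in>I \<times> I. \<bar>f p\<bar> * \<bar>g p\<bar>)"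
    unfolding sum.cartesian_product by (intro sum.cong) (auto simp: fg)
  also have "\<dots> \<le> L2_set f (I \<times> I) * L2_set g (I \<times> I)" by (rule L2_set_mult_ineq)
  also have "\<dots> \<le> sqrt (c * (\<Sum>k\<in>I. (x k)\<^sup>2)) * sqrt (c * (\<Sum>k\<in>I. (y k)\<^sup>2))"
    using f g c by (intro mult_mono) (auto intro!: mult_nonneg_nonneg sum_nonneg L2_set_nonneg)
  also have "\<dots> = c * sqrt (\<Sum>k\<in>I. (x k)\<^sup>2) * sqrt (\<Sum>k\<in>I. (y k)\<^sup>2)"
    using c by (simp add: real_sqrt_mult)
  finally show ?thesis .
qed

lemma sum_square_expand:
  fixes c :: "nat \<Rightarrow> real"
  shows "(\<Sum>i=1..n. c i)\<^sup>2 = (\<Sum>i=1..n. (c i)\<^sup>2) + 2 * (\<Sum>i=1..n. (\<Sum>j=1..<i. c j) * c i)"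
proof (induction n)
  case (Suc n)
  have "{1..<Suc n} = {1..n}" by auto
  then show ?case using Suc by (simp add: power2_eq_square algebra_simps)
qed simp

lemma sum_mult_le_sqrt:
  fixes x y :: "'a \<Rightarrow> real"
  shows "\<bar>\<Sum>k\<in>I. x k * y k\<bar> \<le> sqrt (\<Sum>k\<in>I. (x k)\<^sup>2) * sqrt (\<Sum>k\<in>I. (y k)\<^sup>2)"
proof -
  have "\<bar>\<Sum>k\<in>I. x k * y k\<bar> \<le> (\<Sum>k\<in>I. \<bar>x k\<bar> * \<bar>y k\<bar>)"
    by (rule order_trans[OF sum_abs]) (simp add: abs_mult)
  also have "\<dots> \<le> L2_set x I * L2_set y I" by (rule L2_set_mult_ineq)
  finally show ?thesis by (simp add: L2_set_def)
qed

lemma sum_le_square_sum_sqrt: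
  fixes a :: "'a \<Rightarrow> real"
  assumes "\<And>i. i \<in> I \<Longrightarrow> 0 \<le> a i"
  shows "(\<Sum>i\<in>I. a i) \<le> (\<Sum>i\<in>I. sqrt (a i))\<^sup>2"
proof -
  have "L2_set (\<lambda>i. sqrt (a i)) I \<le> (\<Sum>i\<in>I. sqrt (a i))"
    by (rule L2_set_le_sum) (use assms in auto)
  moreover have "L2_set (\<lambda>i. sqrt (a i)) I = sqrt (\<Sum>i\<in>I. a i)"
    unfolding L2_set_def using assms by simp
  ultimately have "sqrt (\<Sum>i\<in>I. a i) \<le> (\<Sum>i\<in>I. sqrt (a i))" by simp
  then show ?thesis by (rule sqrt_le_D)
qed

text \<open>One model, described on the law \<open>M\<close> of a single observation:
  \<open>\<phi> k\<close> is a basis function of the covariate read as a function of the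
  observation, and \<open>w\<close> stands for the response minus the projection. The condition
  \<open>noise_centered\<close> combines the orthogonality of the projection with the centring of
  the noise, and \<open>s\<close> is the lower bound on the variances.\<close>

locale localized_model = prob_space M for M :: "'z measure" +
  fixes D b n :: nat and J :: "nat \<Rightarrow> nat set" and a :: "nat \<Rightarrow> real"
    and \<phi> :: "nat \<Rightarrow> 'z \<Rightarrow> real" and w :: "'z \<Rightarrow> real" and r Ac Ap B s :: real
  assumes constants_pos: "0 < r" "0 < Ac" "0 < Ap" "0 < B" "0 < s"
    and blocks: "indexed_partition J {1..b} {1..D}"
    and b_pos: "b \<noteq> 0"
    and amplitude_pos: "\<And>i. i \<in> {1..b} \<Longrightarrow> 0 < a i"
    and amplitude_le: "\<And>i. i \<in> {1..b} \<Longrightarrow> a i \<le> a b"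
    and amplitude_sum: "(\<Sum>i=1..b. sqrt (a i)) \<le> r * sqrt (real D)"
    and basis_measurable: "\<And>k. \<phi> k \<in> borel_measurable M"
    and basis_bound: "\<And>i k z. i \<in> {1..b} \<Longrightarrow> k \<in> J i \<Longrightarrow> z \<in> space M \<Longrightarrow> \<bar>\<phi> k z\<bar> \<le> r * sqrt (a i)"
    and overlap: "\<And>i j k. i \<in> {1..b} \<Longrightarrow> j \<in> {1..b} \<Longrightarrow> k \<in> J i \<Longrightarrow>
      real (card {l \<in> J j. \<exists>z\<in>space M. \<phi> k z \<noteq> 0 \<and> \<phi> l z \<noteq> 0}) \<le> Ac * max (a j / a i) 1"
    and orthonormal: "\<And>k l. k \<in> {1..D} \<Longrightarrow> l \<in> {1..D} \<Longrightarrow>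
      (\<integral>z. \<phi> k z * \<phi> l z \<partial>M) = (if k = l then 1 else 0)"
    and dim_pos: "1 \<le> D"
    and dim_le: "real D \<le> Ap * real n / (ln (real n))\<^sup>2"
    and blocks_le: "(real b)\<^sup>2 * a b \<le> Ap * real n / (ln (real n))\<^sup>2"
    and noise_measurable: "w \<in> borel_measurable M"
    and noise_bound: "AE z in M. \<bar>w z\<bar> \<le> B"
    and noise_centered: "\<And>k. k \<in> {1..D} \<Longrightarrow> (\<integral>z. \<phi> k z * w z \<partial>M) = 0"
    and noise_lower: "\<And>k. k \<in> {1..D} \<Longrightarrow> s \<le> (\<integral>z. (\<phi> k z * w z)\<^sup>2 \<partial>M)"
    and ln_ge: "1 \<le> ln (real n)" and ln_square_le: "(ln (real n))\<^sup>2 \<le> real n"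
begin

declare basis_measurable [measurable] noise_measurable [measurable]

abbreviation N :: "(nat \<Rightarrow> 'z) measure" where
  "N \<equiv> PiM {1..n} (\<lambda>_. M)"

sublocale N: prob_space N
  by (rule prob_space_PiM) (rule prob_space_axioms)

definition block_of :: "nat \<Rightarrow> nat" where
  "block_of k = (SOME i. i \<in> {1..b} \<and> k \<in> J i)"

definition amp :: "nat \<Rightarrow> real" where
  "amp k = a (block_of k)"

lemma block_of:
  assumes "k \<in> {1..D}"
  shows "block_of k \<in> {1..b}" "k \<in> J (block_of k)"
proof -
  have "\<exists>i. i \<in> {1..b} \<and> k \<in> J i"
    using assms blocks unfolding indexed_partition_def by blast
  then have "block_of k \<in> {1..b} \<and> k \<in> J (block_of k)"
    unfolding block_of_def by (rule someI_ex)
  then show "block_of k \<in> {1..b}" "k \<in> J (block_of k)" by auto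
qed

lemma J_subset: "i \<in> {1..b} \<Longrightarrow> J i \<subseteq> {1..D}"
  using blocks unfolding indexed_partition_def by blast

lemma finite_J: "i \<in> {1..b} \<Longrightarrow> finite (J i)"
  using J_subset finite_subset by blast

lemma block_of_eq: "i \<in> {1..b} \<Longrightarrow> k \<in> J i \<Longrightarrow> block_of k = i"
proof -
  assume i: "i \<in> {1..b}" "k \<in> J i"
  then have k: "k \<in> {1..D}" using J_subset by blast
  show ?thesis
    using block_of[OF k] i blocks unfolding indexed_partition_def disjoint_family_on_def
    by (metis disjoint_iff)
qed

lemma sum_blocks: "(\<Sum>k=1..D. f k) = (\<Sum>i=1..b. \<Sum>k\<in>J i. f k)" for f :: "nat \<Rightarrow> real"
proof -
  have D: "{1..D} = (\<Union>i\<in>{1..b}. J i)" using blocks unfolding indexed_partition_def by simp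
  show ?thesis
    unfolding D using blocks finite_J unfolding indexed_partition_def disjoint_family_on_def
    by (intro sum.UNION_disjoint) auto
qed

lemma amp_pos: "k \<in> {1..D} \<Longrightarrow> 0 < amp k"
  unfolding amp_def using amplitude_pos block_of by blast

lemma amp_le: "k \<in> {1..D} \<Longrightarrow> amp k \<le> a b"
  unfolding amp_def using amplitude_le block_of by blast

lemma a_b_pos: "0 < a b"
  using b_pos amplitude_pos by simp

lemma basis_le_amp:
  assumes "k \<in> {1..D}" "z \<in> space M"
  shows "\<bar>\<phi> k z\<bar> \<le> r * sqrt (amp k)"
  unfolding amp_def using basis_bound block_of[OF assms(1)] assms(2) by blast

lemma basis_square_le:
  assumes "k \<in> {1..D}" "z \<in> space M"
  shows "(\<phi> k z)\<^sup>2 \<le> r\<^sup>2 * amp k"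
proof -
  have "\<bar>\<phi> k z\<bar>\<^sup>2 \<le> (r * sqrt (amp k))\<^sup>2"
    by (rule power_mono[OF basis_le_amp[OF assms]]) simp
  then show ?thesis using amp_pos[OF assms(1)] by (simp add: power_mult_distrib)
qed

lemma integrable_basis_mult:
  assumes "k \<in> {1..D}" "l \<in> {1..D}"
  shows "integrable M (\<lambda>z. \<phi> k z * \<phi> l z)"
  by (rule integrable_const_bound[of _ "(r * sqrt (amp k)) * (r * sqrt (amp l))"])
    (use constants_pos assms in \<open>auto simp: abs_mult less_imp_le amp_pos intro!: AE_I2 mult_mono basis_le_amp\<close>)

text \<open>Within a block, all functions that do not vanish at \<open>z\<close> overlap any one of
  them, so there are at most \<open>Ac\<close> of them, each with square at most
  \<open>r\<^sup>2 * a i\<close>. Over the blocks, the sum of the \<open>a i\<close> is at most the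
  squared sum of their roots, which is controlled by \<open>D\<close>.\<close>

lemma sum_basis_square_le:
  assumes z: "z \<in> space M"
  shows "(\<Sum>k=1..D. (\<phi> k z)\<^sup>2) \<le> Ac * r ^ 4 * real D"
proof -
  have "(\<Sum>k\<in>J i. (\<phi> k z)\<^sup>2) \<le> Ac * r\<^sup>2 * a i" if i: "i \<in> {1..b}" for i
  proof (cases "\<exists>k\<in>J i. \<phi> k z \<noteq> 0")
    case False
    then have "(\<Sum>k\<in>J i. (\<phi> k z)\<^sup>2) = 0" by simp
    then show ?thesis using constants_pos amplitude_pos[OF i] by simp
  next
    case True
    then obtain k where k: "k \<in> J i" "\<phi> k z \<noteq> 0" by blast
    let ?A = "{l \<in> J i. \<exists>z\<in>space M. \<phi> k z \<noteq> 0 \<and> \<phi> l z \<noteq> 0}"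
    have "(\<Sum>l\<in>J i. (\<phi> l z)\<^sup>2) = (\<Sum>l\<in>?A. (\<phi> l z)\<^sup>2)"
      using k z finite_J[OF i] by (intro sum.mono_neutral_right) auto
    also have "\<dots> \<le> (\<Sum>l\<in>?A. r\<^sup>2 * a i)"
    proof (rule sum_mono)
      fix l assume "l \<in> ?A"
      then have l: "l \<in> J i" by simp
      then have "l \<in> {1..D}" using J_subset i by blast
      from basis_square_le[OF this z] show "(\<phi> l z)\<^sup>2 \<le> r\<^sup>2 * a i"
        using block_of_eq[OF i l] by (simp add: amp_def)
    qed
    also have "\<dots> = real (card ?A) * (r\<^sup>2 * a i)" by simp
    also have "\<dots> \<le> (Ac * max (a i / a i) 1) * (r\<^sup>2 * a i)"
      using amplitude_pos[OF i] by (intro mult_right_mono overlap i k) simp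
    finally show ?thesis using amplitude_pos[OF i] by simp
  qed
  then have "(\<Sum>k=1..D. (\<phi> k z)\<^sup>2) \<le> (\<Sum>i=1..b. Ac * r\<^sup>2 * a i)"
    unfolding sum_blocks by (intro sum_mono)
  also have "\<dots> = Ac * r\<^sup>2 * (\<Sum>i=1..b. a i)" by (simp add: sum_distrib_left)
  also have "(\<Sum>i=1..b. a i) \<le> (\<Sum>i=1..b. sqrt (a i))\<^sup>2"
    by (rule sum_le_square_sum_sqrt) (use amplitude_pos less_imp_le in blast)
  also have "\<dots> \<le> (r * sqrt (real D))\<^sup>2"
    using amplitude_pos by (intro power_mono amplitude_sum sum_nonneg) (auto simp: less_imp_le)
  also have "\<dots> = r\<^sup>2 * real D" by (simp add: power_mult_distrib)
  finally show ?thesis using constants_pos by (simp add: mult_left_mono power4_eq_xxxx power2_eq_square mult.assoc)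
qed

lemma n_pos: "0 < real n"
  using ln_ge by (cases "n = 0") auto

lemma dim_le_n: "real D \<le> Ap * real n"
proof -
  have "1 \<le> (ln (real n))\<^sup>2" using ln_ge by (simp add: one_le_power)
  then have "Ap * real n / (ln (real n))\<^sup>2 \<le> Ap * real n / 1"
    using constants_pos n_pos by (intro divide_left_mono) auto
  then show ?thesis using dim_le by simp
qed

lemma a_b_le: "a b \<le> Ap * real n / (ln (real n))\<^sup>2"
proof -
  have "1 * a b \<le> (real b)\<^sup>2 * a b"
    using b_pos a_b_pos by (intro mult_right_mono) (auto simp: one_le_power)
  then show ?thesis using blocks_le by simp
qed

lemma holds_except_adapted:
  fixes g :: "nat \<Rightarrow> (nat \<Rightarrow> 'z) \<Rightarrow> 'z \<Rightarrow> real"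
  assumes meas: "\<And>m i. i \<in> {1..m} \<Longrightarrow> (\<lambda>u. g i u (u i)) \<in> borel_measurable (PiM {1..m} (\<lambda>_. M))"
    and meas1: "\<And>i u. g i u \<in> borel_measurable M"
    and adapted: "\<And>i j u y z. i \<le> j \<Longrightarrow> g i (u(j := y)) z = g i u z"
    and bound: "\<And>i u. AE z in M. \<bar>g i u z\<bar> \<le> c" and mean: "\<And>i u. (\<integral>z. g i u z \<partial>M) = 0"
    and var: "\<And>i u. (\<integral>z. (g i u z)\<^sup>2 \<partial>M) \<le> v"
    and pos: "0 < c" "0 \<le> v" "0 < x"
  shows "holds_except N (2 * exp (- x)) (\<lambda>u. \<bar>\<Sum>i=1..n. g i u (u i)\<bar> \<le> 2 * (sqrt (real n * v * x) + c * x))"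
proof (rule holds_exceptI)
  note [measurable] = meas
  show "{u \<in> space N. \<not> \<bar>\<Sum>i=1..n. g i u (u i)\<bar> \<le> 2 * (sqrt (real n * v * x) + c * x)} \<in> sets N"
    by measurable
  show "measure N {u \<in> space N. \<not> \<bar>\<Sum>i=1..n. g i u (u i)\<bar> \<le> 2 * (sqrt (real n * v * x) + c * x)} \<le> 2 * exp (- x)"
    using adapted_sum_bernstein[where g=g and n=n, OF meas meas1 adapted bound mean var pos]
    by (simp add: not_le)
qed

text \<open>A sum over a subset is read as a sum over all indices whose increments vanish outside
  \<open>I\<close>. The variance term therefore carries \<open>n\<close> in place of
  \<open>card I\<close>, a loss of a bounded factor for folds and training sets when the number of
  folds is bounded.\<close>

lemma holds_except_iid:
  fixes f :: "'z \<Rightarrow> real"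
  assumes I: "I \<subseteq> {1..n}" and [measurable]: "f \<in> borel_measurable M"
    and bound: "AE z in M. \<bar>f z\<bar> \<le> c" and mean: "(\<integral>z. f z \<partial>M) = 0"
    and var: "(\<integral>z. (f z)\<^sup>2 \<partial>M) \<le> v"
    and pos: "0 < c" "0 < x"
  shows "holds_except N (2 * exp (- x)) (\<lambda>u. \<bar>\<Sum>i\<in>I. f (u i)\<bar> \<le> 2 * (sqrt (real n * v * x) + c * x))"
proof -
  have v: "0 \<le> v" using var by (rule order_trans[rotated]) simp
  have "holds_except N (2 * exp (- x)) (\<lambda>u. \<bar>\<Sum>i=1..n. (\<lambda>i u z. if i \<in> I then f z else 0) i u (u i)\<bar> \<le> 2 * (sqrt (real n * v * x) + c * x))"
  proof (rule holds_except_adapted)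
    show "(\<integral>z. (if i \<in> I then f z else 0) \<partial>M) = 0" for i
      using mean by (cases "i \<in> I") auto
    show "(\<integral>z. (if i \<in> I then f z else 0)\<^sup>2 \<partial>M) \<le> v" for i
      using var v by (cases "i \<in> I") auto
  qed (use assms v in auto)
  then show ?thesis
    by (rule holds_except_mono) (use I in \<open>auto simp: sum.If_cases Int_absorb1\<close>)
qed

end

section \<open>Gram matrices\<close>

text \<open>Here \<open>p\<close> and \<open>q\<close> are the square roots of two block amplitudes.
  The overlap count, the entry threshold and the inverse scale \<open>1 / q\<close> combine exactly
  into an increasing function of \<open>max p q\<close>, divided by \<open>p\<close>. Every block
  thus contributes no more than a block at the top amplitude would.\<close>

lemma schur_row_entry:
  fixes p q m x R c :: real
  assumes "0 < p" "0 < q" "p \<le> m" "q \<le> m" "0 \<le> R" "0 \<le> c"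
  shows "max (q\<^sup>2 / p\<^sup>2) 1 * (2 * (R * min p q + c * (p * q))) / q \<le> 2 * (R * m + c * m\<^sup>2) / p"
proof -
  define t where "t = max p q"
  have t: "0 < t" "t \<le> m" using assms by (auto simp: t_def)
  have "max (q\<^sup>2 / p\<^sup>2) 1 * (2 * (R * min p q + c * (p * q))) / q = 2 * (R * t + c * t\<^sup>2) / p"
  proof (cases "p \<le> q")
    case True
    then have eqs: "max (q\<^sup>2 / p\<^sup>2) 1 = q\<^sup>2 / p\<^sup>2" "min p q = p" "t = q"
      using assms by (auto simp: t_def max_def power_mono)
    show ?thesis unfolding eqs using assms by (simp add: field_simps power2_eq_square)
  next
    case False
    then have "q\<^sup>2 \<le> p\<^sup>2" using assms by (intro power_mono) auto
    then have eqs: "max (q\<^sup>2 / p\<^sup>2) 1 = 1" "min p q = q" "t = p"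
      using assms False by (auto simp: t_def max_def)
    show ?thesis unfolding eqs using assms by (simp add: field_simps power2_eq_square)
  qed
  also have "\<dots> \<le> 2 * (R * m + c * m\<^sup>2) / p"
    using assms t by (intro divide_right_mono mult_left_mono add_mono power_mono) auto
  finally show ?thesis .
qed

context localized_model
begin

definition gram_const :: "real \<Rightarrow> real" where
  "gram_const K = 2 * Ac * (r * sqrt (Ap * K) + 2 * r\<^sup>2 * K * Ap)"

text \<open>The condition on \<open>(real b)\<^sup>2 * a b\<close> makes
  \<open>b * sqrt (a b)\<close> of order sqrt n / ln n and \<open>b * a b\<close> of order n / (ln
  n)^2. At level \<open>x = K * ln n\<close> the two Bernstein terms, summed over the blocks, become
  of order n / sqrt (ln n) and n / ln n.\<close>

lemma block_count_le:
  assumes K: "0 < K"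
  defines "x \<equiv> K * ln (real n)"
  shows "real b * (Ac * (2 * (r * sqrt (real n * x) * sqrt (a b) + 2 * r\<^sup>2 * x * a b)))
    \<le> gram_const K * real n / sqrt (ln (real n))"
proof -
  define L where "L = ln (real n)"
  have L: "1 \<le> L" using ln_ge by (simp add: L_def)
  have "sqrt ((real b)\<^sup>2 * a b) \<le> sqrt (Ap * real n / L\<^sup>2)"
    using blocks_le by (simp add: L_def)
  then have 1: "real b * sqrt (a b) \<le> sqrt (Ap * real n) / L"
    using L by (simp add: real_sqrt_mult real_sqrt_divide)
  have "real b * 1 \<le> real b * real b" using b_pos by (intro mult_left_mono) auto
  then have "real b * a b \<le> (real b)\<^sup>2 * a b"
    using a_b_pos by (intro mult_right_mono) (auto simp: power2_eq_square)
  then have 2: "real b * a b \<le> Ap * real n / L\<^sup>2"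
    using blocks_le by (simp add: L_def)
  have "r * sqrt (real n * x) * (real b * sqrt (a b)) \<le> r * sqrt (real n * x) * (sqrt (Ap * real n) / L)"
    using constants_pos L K by (intro mult_left_mono 1) (auto simp: x_def L_def)
  also have "\<dots> = r * sqrt (Ap * K) * (real n / sqrt L)"
  proof -
    have A: "sqrt (real n * x) * sqrt (Ap * real n) = real n * sqrt (Ap * K) * sqrt L"
      by (simp add: x_def L_def real_sqrt_mult)
    have B: "sqrt L / L = 1 / sqrt L" using L by (simp add: field_simps)
    have "r * sqrt (real n * x) * (sqrt (Ap * real n) / L) = r * (sqrt (real n * x) * sqrt (Ap * real n)) / L"
      by simp
    also have "\<dots> = r * (real n * sqrt (Ap * K)) * (sqrt L / L)" unfolding A by simp
    also have "\<dots> = r * sqrt (Ap * K) * (real n / sqrt L)" unfolding B by simp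
    finally show ?thesis .
  qed
  finally have 3: "r * sqrt (real n * x) * (real b * sqrt (a b)) \<le> r * sqrt (Ap * K) * (real n / sqrt L)" .
  have "2 * r\<^sup>2 * x * (real b * a b) \<le> 2 * r\<^sup>2 * x * (Ap * real n / L\<^sup>2)"
    using K L by (intro mult_left_mono 2) (auto simp: x_def L_def)
  also have "\<dots> = 2 * r\<^sup>2 * K * Ap * (real n / L)"
    using L by (simp add: x_def L_def[symmetric] power2_eq_square)
  also have "\<dots> \<le> 2 * r\<^sup>2 * K * Ap * (real n / sqrt L)"
  proof (intro mult_left_mono divide_left_mono)
    show "sqrt L \<le> L" using L by (intro real_le_lsqrt) (auto simp: power2_eq_square)
  qed (use L K constants_pos in auto)
  finally have 4: "2 * r\<^sup>2 * x * (real b * a b) \<le> 2 * r\<^sup>2 * K * Ap * (real n / sqrt L)" .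
  have "real b * (Ac * (2 * (r * sqrt (real n * x) * sqrt (a b) + 2 * r\<^sup>2 * x * a b)))
     = 2 * Ac * (r * sqrt (real n * x) * (real b * sqrt (a b)) + 2 * r\<^sup>2 * x * (real b * a b))"
    by (simp add: algebra_simps)
  also have "\<dots> \<le> 2 * Ac * (r * sqrt (Ap * K) * (real n / sqrt L) + 2 * r\<^sup>2 * K * Ap * (real n / sqrt L))"
    using constants_pos by (intro mult_left_mono add_mono 3 4) auto
  also have "\<dots> = gram_const K * real n / sqrt (ln (real n))"
    by (simp add: gram_const_def L_def algebra_simps add_divide_distrib)
  finally show ?thesis .
qed

text \<open>This is \<open>card I\<close> times the difference between the empirical Gram matrix and
  the identity. Without normalization, sets of all sizes share one threshold.\<close>

definition gram_dev :: "nat set \<Rightarrow> (nat \<Rightarrow> 'z) \<Rightarrow> nat \<Rightarrow> nat \<Rightarrow> real" where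
  "gram_dev I u k l = (\<Sum>i\<in>I. \<phi> k (u i) * \<phi> l (u i) - (if k = l then 1 else 0))"

text \<open>The Bernstein threshold with variance \<open>r\<^sup>2 * min (amp k) (amp l)\<close>.
  The minimum, as opposed to a mean of the two amplitudes, is what \<open>schur_row_entry\<close>
  sets against the overlap count.\<close>

definition gram_threshold :: "real \<Rightarrow> nat \<Rightarrow> nat \<Rightarrow> real" where
  "gram_threshold x k l = 2 * (sqrt (real n * (r\<^sup>2 * min (amp k) (amp l)) * x) + (2 * r\<^sup>2 * sqrt (amp k * amp l)) * x)"

lemma gram_entry:
  assumes I: "I \<subseteq> {1..n}" and kl: "k \<in> {1..D}" "l \<in> {1..D}" and x: "0 < x"
  shows "holds_except N (2 * exp (- x)) (\<lambda>u. \<bar>gram_dev I u k l\<bar> \<le> gram_threshold x k l)"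
  unfolding gram_dev_def gram_threshold_def
proof (rule holds_except_iid[OF I])
  note ak = amp_pos[OF kl(1)] and al = amp_pos[OF kl(2)]
  let ?d = "if k = l then 1 else 0 :: real"
  have int: "integrable M (\<lambda>z. \<phi> k z * \<phi> l z)" by (rule integrable_basis_mult[OF kl])
  have b1: "\<bar>\<phi> k z * \<phi> l z\<bar> \<le> r\<^sup>2 * sqrt (amp k * amp l)" if "z \<in> space M" for z
  proof -
    have "\<bar>\<phi> k z * \<phi> l z\<bar> \<le> (r * sqrt (amp k)) * (r * sqrt (amp l))"
      unfolding abs_mult using constants_pos ak kl that by (intro mult_mono basis_le_amp) auto
    then show ?thesis by (simp add: real_sqrt_mult power2_eq_square mult_ac)
  qed
  have "\<bar>\<integral>z. \<phi> k z * \<phi> l z \<partial>M\<bar> \<le> (\<integral>z. r\<^sup>2 * sqrt (amp k * amp l) \<partial>M)"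
    by (rule order_trans[OF integral_abs_bound]) (rule integral_mono, use int b1 in auto)
  then have d: "\<bar>?d\<bar> \<le> r\<^sup>2 * sqrt (amp k * amp l)"
    using orthonormal[OF kl] by (simp add: prob_space)
  show "AE z in M. \<bar>\<phi> k z * \<phi> l z - ?d\<bar> \<le> 2 * r\<^sup>2 * sqrt (amp k * amp l)"
  proof (rule AE_I2)
    fix z assume "z \<in> space M"
    from b1[OF this] d show "\<bar>\<phi> k z * \<phi> l z - ?d\<bar> \<le> 2 * r\<^sup>2 * sqrt (amp k * amp l)" by linarith
  qed
  show "(\<integral>z. \<phi> k z * \<phi> l z - ?d \<partial>M) = 0"
    using int orthonormal[OF kl] by (simp add: prob_space)
  have int2: "integrable M (\<lambda>z. (\<phi> k z * \<phi> l z)\<^sup>2)"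
    by (rule integrable_const_bound[of _ "(r\<^sup>2 * sqrt (amp k * amp l))\<^sup>2"])
      (auto simp del: abs_mult simp: abs_le_square_iff[symmetric] intro!: AE_I2 order_trans[OF b1])
  \<comment> \<open>Either factor can be bounded pointwise while the square of the other integrates
    to 1; the better of the two orders yields the minimum of the amplitudes.\<close>
  have m1: "(\<integral>z. (\<phi> k z * \<phi> l z)\<^sup>2 \<partial>M) \<le> r\<^sup>2 * amp i" if i: "(i = k \<and> j = l) \<or> (i = l \<and> j = k)" for i j
  proof -
    have j: "j \<in> {1..D}" and i': "i \<in> {1..D}" using i kl by auto
    have "(\<integral>z. (\<phi> k z * \<phi> l z)\<^sup>2 \<partial>M) \<le> (\<integral>z. r\<^sup>2 * amp i * (\<phi> j z * \<phi> j z) \<partial>M)"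
    proof (rule integral_mono[OF int2])
      show "integrable M (\<lambda>z. r\<^sup>2 * amp i * (\<phi> j z * \<phi> j z))"
        using integrable_basis_mult[OF j j] by simp
      fix z assume z: "z \<in> space M"
      have "(\<phi> k z * \<phi> l z)\<^sup>2 = (\<phi> i z)\<^sup>2 * (\<phi> j z)\<^sup>2" using i by (auto simp: power_mult_distrib)
      also have "\<dots> \<le> r\<^sup>2 * amp i * (\<phi> j z)\<^sup>2" by (intro mult_right_mono basis_square_le i' z) simp
      finally show "(\<phi> k z * \<phi> l z)\<^sup>2 \<le> r\<^sup>2 * amp i * (\<phi> j z * \<phi> j z)" by (simp add: power2_eq_square)
    qed
    then show ?thesis using orthonormal[OF j j] by simp
  qed
  have "(\<integral>z. (\<phi> k z * \<phi> l z - ?d)\<^sup>2 \<partial>M) = (\<integral>z. (\<phi> k z * \<phi> l z)\<^sup>2 \<partial>M) - ?d"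
  proof -
    have "(\<integral>z. (\<phi> k z * \<phi> l z - ?d)\<^sup>2 \<partial>M) = (\<integral>z. (\<phi> k z * \<phi> l z)\<^sup>2 - 2 * ?d * (\<phi> k z * \<phi> l z) + ?d \<partial>M)"
      by (intro Bochner_Integration.integral_cong) (auto simp: power2_eq_square algebra_simps)
    also have "\<dots> = (\<integral>z. (\<phi> k z * \<phi> l z)\<^sup>2 \<partial>M) - 2 * ?d * (\<integral>z. \<phi> k z * \<phi> l z \<partial>M) + ?d"
      using int int2 by (simp add: prob_space)
    finally show ?thesis using orthonormal[OF kl] by simp
  qed
  also have "\<dots> \<le> (\<integral>z. (\<phi> k z * \<phi> l z)\<^sup>2 \<partial>M)" by simp
  also have "\<dots> \<le> r\<^sup>2 * min (amp k) (amp l)"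
    using m1[of k l] m1[of l k] by (simp add: min_def)
  finally show "(\<integral>z. (\<phi> k z * \<phi> l z - ?d)\<^sup>2 \<partial>M) \<le> r\<^sup>2 * min (amp k) (amp l)" .
  show "0 < 2 * r\<^sup>2 * sqrt (amp k * amp l)" using constants_pos ak al by simp
qed (use x in auto)

lemma gram_dev_eq_0:
  assumes "u \<in> space N" "I \<subseteq> {1..n}" "k \<in> {1..D}" "l \<in> {1..D}"
    and disj: "\<not> (\<exists>z\<in>space M. \<phi> k z \<noteq> 0 \<and> \<phi> l z \<noteq> 0)"
  shows "gram_dev I u k l = 0"
proof -
  have "(\<integral>z. \<phi> k z * \<phi> l z \<partial>M) = (\<integral>z. 0 \<partial>M)"
    by (rule Bochner_Integration.integral_cong) (use disj in auto)
  \<comment> \<open>A basis function overlaps itself, because its norm is 1; this rules out the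
    diagonal.\<close>
  then have "k \<noteq> l" using orthonormal[OF assms(3,4)] by auto
  moreover have "\<phi> k (u i) * \<phi> l (u i) = 0" if "i \<in> I" for i
  proof -
    have "u i \<in> space M" using assms(1,2) that by (auto simp: space_PiM)
    then show ?thesis using disj by auto
  qed
  ultimately show ?thesis unfolding gram_dev_def by (intro sum.neutral) simp
qed

text \<open>
  The weight of a basis function in the Schur test is the inverse of the scale of its amplitude, which
  compensates the factor \<open>max (a j / a i) 1\<close> in the number of overlaps.
\<close>

lemma gram_row:
  assumes u: "u \<in> space N" "I \<subseteq> {1..n}" and K: "0 < K" and k: "k \<in> {1..D}"
    and dev: "\<And>l. l \<in> {1..D} \<Longrightarrow> \<bar>gram_dev I u k l\<bar> \<le> gram_threshold (K * ln (real n)) k l"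
  shows "(\<Sum>l=1..D. \<bar>gram_dev I u k l\<bar> * (1 / sqrt (amp l))) \<le> gram_const K * real n / sqrt (ln (real n)) * (1 / sqrt (amp k))"
proof -
  define x where "x = K * ln (real n)"
  have x: "0 < x" using K ln_ge by (simp add: x_def)
  define i where "i = block_of k"
  have i: "i \<in> {1..b}" "k \<in> J i" using block_of[OF k] by (auto simp: i_def)
  let ?T = "2 * (r * sqrt (real n * x) * sqrt (a b) + 2 * r\<^sup>2 * x * a b) / sqrt (a i)"
  have row: "(\<Sum>l\<in>J j. \<bar>gram_dev I u k l\<bar> * (1 / sqrt (amp l))) \<le> Ac * ?T" if j: "j \<in> {1..b}" for j
  proof -
    define \<tau> where "\<tau> = 2 * (r * sqrt (real n * x) * min (sqrt (a i)) (sqrt (a j)) + 2 * r\<^sup>2 * x * (sqrt (a i) * sqrt (a j)))"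
    have aij: "0 < a i" "0 < a j" using amplitude_pos i j by auto
    have \<tau>0: "0 \<le> \<tau>" using constants_pos x aij by (simp add: \<tau>_def)
    have mins: "sqrt (min (a i) (a j)) = min (sqrt (a i)) (sqrt (a j))"
      by (simp add: min_def)
    have th: "gram_threshold x k l = \<tau>" if "l \<in> J j" for l
      using block_of_eq[OF i] block_of_eq[OF j that] constants_pos
      by (simp add: gram_threshold_def amp_def \<tau>_def real_sqrt_mult mins mult_ac)
    let ?A = "{l \<in> J j. \<exists>z\<in>space M. \<phi> k z \<noteq> 0 \<and> \<phi> l z \<noteq> 0}"
    \<comment> \<open>Pairs without overlap have deviation exactly zero, so the number of terms is
      governed by the overlap count and not by the size of the block.\<close>
    have "(\<Sum>l\<in>J j. \<bar>gram_dev I u k l\<bar> * (1 / sqrt (amp l))) = (\<Sum>l\<in>?A. \<bar>gram_dev I u k l\<bar> * (1 / sqrt (amp l)))"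
    proof (rule sum.mono_neutral_right[OF finite_J[OF j]])
      show "\<forall>l\<in>J j - ?A. \<bar>gram_dev I u k l\<bar> * (1 / sqrt (amp l)) = 0"
      proof
        fix l assume l: "l \<in> J j - ?A"
        then have "l \<in> {1..D}" using J_subset[OF j] by auto
        then have "gram_dev I u k l = 0" using l by (intro gram_dev_eq_0 u k) auto
        then show "\<bar>gram_dev I u k l\<bar> * (1 / sqrt (amp l)) = 0" by simp
      qed
    qed auto
    also have "\<dots> \<le> (\<Sum>l\<in>?A. \<tau> * (1 / sqrt (a j)))"
    proof (rule sum_mono)
      fix l assume "l \<in> ?A"
      then have l: "l \<in> J j" by simp
      then have l': "l \<in> {1..D}" using J_subset[OF j] by auto
      show "\<bar>gram_dev I u k l\<bar> * (1 / sqrt (amp l)) \<le> \<tau> * (1 / sqrt (a j))"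
        using dev[OF l'] th[OF l] block_of_eq[OF j l] aij
        by (simp add: x_def[symmetric] amp_def divide_right_mono)
    qed
    also have "\<dots> = real (card ?A) * (\<tau> / sqrt (a j))" by simp
    also have "\<dots> \<le> (Ac * max (a j / a i) 1) * (\<tau> / sqrt (a j))"
      using \<tau>0 aij by (intro mult_right_mono overlap i j) auto
    also have "\<dots> = Ac * (max ((sqrt (a j))\<^sup>2 / (sqrt (a i))\<^sup>2) 1 * \<tau> / sqrt (a j))"
      using aij by simp
    also have "\<dots> \<le> Ac * (2 * (r * sqrt (real n * x) * sqrt (a b) + 2 * r\<^sup>2 * x * (sqrt (a b))\<^sup>2) / sqrt (a i))"
      unfolding \<tau>_def using aij constants_pos x amplitude_le[OF i(1)] amplitude_le[OF j]
      by (intro mult_left_mono schur_row_entry) auto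
    finally show ?thesis using a_b_pos by simp
  qed
  have "(\<Sum>l=1..D. \<bar>gram_dev I u k l\<bar> * (1 / sqrt (amp l))) \<le> (\<Sum>j=1..b. Ac * ?T)"
    unfolding sum_blocks by (rule sum_mono) (rule row)
  also have "\<dots> = real b * (Ac * (2 * (r * sqrt (real n * x) * sqrt (a b) + 2 * r\<^sup>2 * x * a b))) * (1 / sqrt (a i))"
    by simp
  also have "\<dots> \<le> gram_const K * real n / sqrt (ln (real n)) * (1 / sqrt (a i))"
    unfolding x_def using amplitude_pos[OF i(1)] by (intro mult_right_mono block_count_le K) auto
  finally show ?thesis by (simp add: amp_def i_def)
qed

lemma gram_const_pos: "0 < K \<Longrightarrow> 0 < gram_const K"
  using constants_pos by (simp add: gram_const_def add_pos_pos)

text \<open>Probability enters through the entries only, by a union bound over index pairs. The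
  Schur test is deterministic, so the conclusion is uniform in the vectors and applies to
  coefficients that depend on the sample.\<close>

lemma gram_bound:
  assumes I: "I \<subseteq> {1..n}" and K: "0 < K"
  shows "holds_except N ((real D)\<^sup>2 * (2 * exp (- (K * ln (real n)))))
    (\<lambda>u. \<forall>\<beta> t. \<bar>\<Sum>k=1..D. \<Sum>l=1..D. \<beta> k * t l * gram_dev I u k l\<bar>
       \<le> gram_const K * real n / sqrt (ln (real n)) * sqrt (\<Sum>k=1..D. (\<beta> k)\<^sup>2) * sqrt (\<Sum>k=1..D. (t k)\<^sup>2))"
proof -
  define x where "x = K * ln (real n)"
  have x: "0 < x" using K ln_ge by (simp add: x_def)
  have "holds_except N (real (card ({1..D} \<times> {1..D})) * (2 * exp (- x)))
     (\<lambda>u. \<forall>p\<in>{1..D} \<times> {1..D}. \<bar>gram_dev I u (fst p) (snd p)\<bar> \<le> gram_threshold x (fst p) (snd p))"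
    by (intro N.holds_except_ball gram_entry I x) auto
  then show ?thesis
  proof (rule holds_except_mono)
    fix u assume u: "u \<in> space N"
      and dev: "\<forall>p\<in>{1..D} \<times> {1..D}. \<bar>gram_dev I u (fst p) (snd p)\<bar> \<le> gram_threshold x (fst p) (snd p)"
    show "\<forall>\<beta> t. \<bar>\<Sum>k=1..D. \<Sum>l=1..D. \<beta> k * t l * gram_dev I u k l\<bar>
       \<le> gram_const K * real n / sqrt (ln (real n)) * sqrt (\<Sum>k=1..D. (\<beta> k)\<^sup>2) * sqrt (\<Sum>k=1..D. (t k)\<^sup>2)"
    proof (intro allI schur_test)
      show "gram_dev I u k l = gram_dev I u l k" for k l
        by (simp add: gram_dev_def mult.commute eq_commute)
      show "0 < 1 / sqrt (amp k)" if "k \<in> {1..D}" for k using amp_pos[OF that] by simp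
      show "0 \<le> gram_const K * real n / sqrt (ln (real n))"
        using gram_const_pos[OF K] ln_ge by simp
      show "(\<Sum>l=1..D. \<bar>gram_dev I u k l\<bar> * (1 / sqrt (amp l))) \<le> gram_const K * real n / sqrt (ln (real n)) * (1 / sqrt (amp k))"
        if k: "k \<in> {1..D}" for k
        using dev k by (intro gram_row u I K) (auto simp: x_def)
    qed simp
  qed (simp add: x_def power2_eq_square)
qed

end

section \<open>Noise vectors\<close>

context localized_model
begin

definition noise_sum :: "nat set \<Rightarrow> (nat \<Rightarrow> 'z) \<Rightarrow> nat \<Rightarrow> real" where
  "noise_sum I u k = (\<Sum>i\<in>I. \<phi> k (u i) * w (u i))"

definition noise_energy :: real where
  "noise_energy = (\<integral>z. (\<Sum>k=1..D. (\<phi> k z * w z)\<^sup>2) \<partial>M)"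

definition coord_const :: "real \<Rightarrow> real" where
  "coord_const K = 2 * B * (sqrt K + r * sqrt Ap * K)"

definition energy_bound :: real where
  "energy_bound = B\<^sup>2 * (Ac * r ^ 4)"

lemma energy_bound_pos: "0 < energy_bound"
  using constants_pos by (simp add: energy_bound_def)

lemma coord_const_pos: "0 < K \<Longrightarrow> 0 < coord_const K"
  using constants_pos by (simp add: coord_const_def add_pos_pos)

lemma ln_le_sqrt: "ln (real n) \<le> sqrt (real n * ln (real n))"
proof (rule real_le_rsqrt)
  have "(ln (real n))\<^sup>2 * 1 \<le> real n * ln (real n)"
    using ln_ge ln_square_le by (intro mult_mono) auto
  then show "(ln (real n))\<^sup>2 \<le> real n * ln (real n)" by simp
qed

lemma sqrt_n_le: "sqrt (real n) \<le> sqrt (real n * ln (real n))"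
  using mult_left_mono[OF ln_ge, of "real n"] by simp

lemma basis_noise_bound:
  assumes k: "k \<in> {1..D}"
  shows "AE z in M. \<bar>\<phi> k z * w z\<bar> \<le> r * sqrt (a b) * B"
  using noise_bound AE_space
proof eventually_elim
  case (elim z)
  have "\<bar>\<phi> k z\<bar> \<le> r * sqrt (amp k)" by (rule basis_le_amp[OF k elim(2)])
  also have "\<dots> \<le> r * sqrt (a b)" using constants_pos amp_le[OF k] by simp
  finally show ?case
    unfolding abs_mult using elim constants_pos a_b_pos by (intro mult_mono) auto
qed

lemma integrable_basis_noise:
  assumes k: "k \<in> {1..D}"
  shows "integrable M (\<lambda>z. \<phi> k z * w z)"
  by (rule integrable_const_bound[of _ "r * sqrt (a b) * B"]) (use basis_noise_bound[OF k] in auto)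

lemma integrable_basis_noise_square:
  assumes k: "k \<in> {1..D}"
  shows "integrable M (\<lambda>z. (\<phi> k z * w z)\<^sup>2)"
  by (rule integrable_const_bound[of _ "(r * sqrt (a b) * B)\<^sup>2"])
    (use AE_abs_square_le[OF basis_noise_bound[OF k]] in auto)

lemma basis_combination:
  shows "integrable M (\<lambda>z. (\<Sum>k=1..D. t k * \<phi> k z)\<^sup>2)"
    and "(\<integral>z. (\<Sum>k=1..D. t k * \<phi> k z)\<^sup>2 \<partial>M) = (\<Sum>k=1..D. (t k)\<^sup>2)"
proof -
  have eq: "(\<Sum>k=1..D. t k * \<phi> k z)\<^sup>2 = (\<Sum>k=1..D. \<Sum>l=1..D. t k * t l * (\<phi> k z * \<phi> l z))" for z
    unfolding power2_eq_square sum_product by (intro sum.cong) (auto simp: mult_ac)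
  have int: "integrable M (\<lambda>z. t k * t l * (\<phi> k z * \<phi> l z))" if "k \<in> {1..D}" "l \<in> {1..D}" for k l
    using integrable_basis_mult[OF that] by simp
  show "integrable M (\<lambda>z. (\<Sum>k=1..D. t k * \<phi> k z)\<^sup>2)"
    unfolding eq by (intro Bochner_Integration.integrable_sum int) auto
  have "(\<integral>z. (\<Sum>k=1..D. t k * \<phi> k z)\<^sup>2 \<partial>M) = (\<Sum>k=1..D. \<Sum>l=1..D. (\<integral>z. t k * t l * (\<phi> k z * \<phi> l z) \<partial>M))"
    unfolding eq
    by (subst Bochner_Integration.integral_sum, intro Bochner_Integration.integrable_sum int, assumption+)
      (intro sum.cong refl Bochner_Integration.integral_sum int, assumption+)
  also have "\<dots> = (\<Sum>k=1..D. \<Sum>l=1..D. if k = l then t k * t l else 0)"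
    by (intro sum.cong refl) (simp add: orthonormal)
  also have "\<dots> = (\<Sum>k=1..D. (t k)\<^sup>2)"
    by (simp add: power2_eq_square)
  finally show "(\<integral>z. (\<Sum>k=1..D. t k * \<phi> k z)\<^sup>2 \<partial>M) = (\<Sum>k=1..D. (t k)\<^sup>2)" .
qed

text \<open>Bounding \<open>w\<close> pointwise and applying Parseval gives a variance that depends
  on the norm of the coefficients and not on \<open>D\<close>. With past noise sums as coefficients,
  this is the conditional variance of the increments in \<open>off_diagonal_bound\<close>.\<close>

lemma noise_combination_integral_le:
  "(\<integral>z. (\<Sum>k=1..D. t k * (\<phi> k z * w z))\<^sup>2 \<partial>M) \<le> B\<^sup>2 * (\<Sum>k=1..D. (t k)\<^sup>2)"
proof -
  have "(\<integral>z. (\<Sum>k=1..D. t k * (\<phi> k z * w z))\<^sup>2 \<partial>M) \<le> (\<integral>z. B\<^sup>2 * (\<Sum>k=1..D. t k * \<phi> k z)\<^sup>2 \<partial>M)"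
  proof (rule integral_mono_AE')
    show "integrable M (\<lambda>z. B\<^sup>2 * (\<Sum>k=1..D. t k * \<phi> k z)\<^sup>2)"
      using basis_combination(1)[of t] by simp
    show "AE z in M. (\<Sum>k=1..D. t k * (\<phi> k z * w z))\<^sup>2 \<le> B\<^sup>2 * (\<Sum>k=1..D. t k * \<phi> k z)\<^sup>2"
      using noise_bound
    proof eventually_elim
      case (elim z)
      have "(\<Sum>k=1..D. t k * (\<phi> k z * w z)) = w z * (\<Sum>k=1..D. t k * \<phi> k z)"
        by (simp add: sum_distrib_left mult_ac)
      moreover have "(w z)\<^sup>2 \<le> B\<^sup>2" using elim constants_pos by (simp add: abs_le_square_iff[symmetric])
      ultimately show ?case by (simp add: power_mult_distrib mult_right_mono)
    qed
  qed auto
  then show ?thesis using basis_combination(2)[of t] by simp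
qed

lemma basis_noise_square_integral_le:
  assumes k: "k \<in> {1..D}"
  shows "(\<integral>z. (\<phi> k z * w z)\<^sup>2 \<partial>M) \<le> B\<^sup>2"
proof -
  have if_mult: "(if l = k then 1 else 0) * c = (if l = k then c else 0)" for l and c :: real
    by simp
  have if_sq: "(if l = k then 1 else 0 :: real)\<^sup>2 = (if l = k then 1 else 0)" for l
    by simp
  show ?thesis
    using noise_combination_integral_le[of "\<lambda>l. if l = k then 1 else 0"] k
    unfolding if_mult if_sq by simp
qed

lemma noise_energy_eq: "noise_energy = (\<Sum>k=1..D. \<integral>z. (\<phi> k z * w z)\<^sup>2 \<partial>M)"
  unfolding noise_energy_def
  by (rule Bochner_Integration.integral_sum) (rule integrable_basis_noise_square)

lemma noise_energy_ge: "s * real D \<le> noise_energy"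
  unfolding noise_energy_eq using sum_bounded_below[of "{1..D}" s] noise_lower
  by (simp add: mult.commute)

lemma noise_energy_le: "noise_energy \<le> B\<^sup>2 * real D"
  unfolding noise_energy_eq using sum_bounded_above[of "{1..D}" _ "B\<^sup>2"] basis_noise_square_integral_le
  by (simp add: mult.commute)

text \<open>Since \<open>sqrt (a b) * ln n\<close> is of order at most sqrt n, the linear Bernstein
  term is absorbed by the square-root term.\<close>

lemma coordinate_bound:
  assumes I: "I \<subseteq> {1..n}" and k: "k \<in> {1..D}" and K: "0 < K"
  shows "holds_except N (2 * exp (- (K * ln (real n))))
    (\<lambda>u. \<bar>noise_sum I u k\<bar> \<le> coord_const K * sqrt (real n * ln (real n)))"
proof -
  define L where "L = ln (real n)"
  have L: "1 \<le> L" using ln_ge by (simp add: L_def)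
  have "holds_except N (2 * exp (- (K * L)))
    (\<lambda>u. \<bar>\<Sum>i\<in>I. \<phi> k (u i) * w (u i)\<bar> \<le> 2 * (sqrt (real n * B\<^sup>2 * (K * L)) + (r * sqrt (a b) * B) * (K * L)))"
    by (rule holds_except_iid[OF I _ basis_noise_bound[OF k] noise_centered[OF k] basis_noise_square_integral_le[OF k]])
      (use constants_pos a_b_pos K L in auto)
  then show ?thesis
    unfolding L_def[symmetric]
  proof (rule holds_except_mono)
    fix u assume u: "\<bar>\<Sum>i\<in>I. \<phi> k (u i) * w (u i)\<bar> \<le> 2 * (sqrt (real n * B\<^sup>2 * (K * L)) + (r * sqrt (a b) * B) * (K * L))"
    have 1: "sqrt (real n * B\<^sup>2 * (K * L)) = B * sqrt K * sqrt (real n * L)"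
      using constants_pos by (simp add: real_sqrt_mult)
    have "sqrt (a b) \<le> sqrt (Ap * real n / L\<^sup>2)" using a_b_le by (simp add: L_def)
    also have "\<dots> = sqrt Ap * sqrt (real n) / L" using L by (simp add: real_sqrt_mult real_sqrt_divide)
    finally have "sqrt (a b) * L \<le> sqrt Ap * sqrt (real n)" using L by (simp add: field_simps)
    also have "\<dots> \<le> sqrt Ap * sqrt (real n * L)"
      using sqrt_n_le constants_pos by (intro mult_left_mono) (auto simp: L_def)
    finally have "(r * B * K) * (sqrt (a b) * L) \<le> (r * B * K) * (sqrt Ap * sqrt (real n * L))"
      using constants_pos K by (intro mult_left_mono) auto
    then show "\<bar>noise_sum I u k\<bar> \<le> coord_const K * sqrt (real n * L)"
      using u unfolding 1 noise_sum_def coord_const_def by (simp add: algebra_simps)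
  qed simp
qed

lemma sum_noise_square_le:
  "AE z in M. (\<Sum>k=1..D. (\<phi> k z * w z)\<^sup>2) \<le> energy_bound * real D"
  using noise_bound AE_space
proof eventually_elim
  case (elim z)
  have "(w z)\<^sup>2 \<le> B\<^sup>2" using elim constants_pos by (simp add: abs_le_square_iff[symmetric])
  then have "(w z)\<^sup>2 * (\<Sum>k=1..D. (\<phi> k z)\<^sup>2) \<le> B\<^sup>2 * (Ac * r ^ 4 * real D)"
    using sum_basis_square_le[OF elim(2)] by (intro mult_mono) (auto intro: sum_nonneg)
  then show ?case by (simp add: energy_bound_def power_mult_distrib sum_distrib_left mult_ac)
qed

text \<open>The summands are independent and bounded by a multiple of \<open>D\<close>. The crude
  variance bound given by the square of their range suffices: the resulting error is later dominated
  by n * D / sqrt (ln n).\<close>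

lemma diagonal_bound:
  assumes I: "I \<subseteq> {1..n}" and K: "0 < K"
  shows "holds_except N (2 * exp (- (K * ln (real n))))
    (\<lambda>u. \<bar>(\<Sum>i\<in>I. \<Sum>k=1..D. (\<phi> k (u i) * w (u i))\<^sup>2) - real (card I) * noise_energy\<bar>
       \<le> 4 * energy_bound * (sqrt K + K) * (real D * sqrt (real n * ln (real n))))"
proof -
  define L where "L = ln (real n)"
  have L: "1 \<le> L" using ln_ge by (simp add: L_def)
  define q where "q = energy_bound * real D"
  have q: "0 < q" using energy_bound_pos dim_pos by (simp add: q_def)
  let ?d = "\<lambda>z. \<Sum>k=1..D. (\<phi> k z * w z)\<^sup>2"
  have int: "integrable M ?d"
    by (intro Bochner_Integration.integrable_sum integrable_basis_noise_square)
  have d0: "0 \<le> ?d z" for z by (simp add: sum_nonneg)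
  have e0: "0 \<le> noise_energy" unfolding noise_energy_def by (intro Bochner_Integration.integral_nonneg d0)
  have "noise_energy \<le> (\<integral>z. q \<partial>M)"
    unfolding noise_energy_def by (rule integral_mono_AE) (use int sum_noise_square_le in \<open>auto simp: q_def\<close>)
  then have eq: "noise_energy \<le> q" by (simp add: prob_space)
  have bd: "AE z in M. \<bar>?d z - noise_energy\<bar> \<le> 2 * q"
    using sum_noise_square_le
  proof eventually_elim
    case (elim z)
    then show ?case using d0[of z] e0 eq q by (simp add: q_def abs_le_iff)
  qed
  have "holds_except N (2 * exp (- (K * L)))
    (\<lambda>u. \<bar>\<Sum>i\<in>I. ?d (u i) - noise_energy\<bar> \<le> 2 * (sqrt (real n * (2 * q)\<^sup>2 * (K * L)) + 2 * q * (K * L)))"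
  proof (rule holds_except_iid[OF I _ bd])
    show "(\<integral>z. ?d z - noise_energy \<partial>M) = 0"
      using int by (simp add: prob_space noise_energy_def)
    have "(\<integral>z. (?d z - noise_energy)\<^sup>2 \<partial>M) \<le> (\<integral>z. (2 * q)\<^sup>2 \<partial>M)"
    proof (rule integral_mono_AE')
      show "AE z in M. (?d z - noise_energy)\<^sup>2 \<le> (2 * q)\<^sup>2"
        using AE_abs_square_le[OF bd] by simp
    qed auto
    then show "(\<integral>z. (?d z - noise_energy)\<^sup>2 \<partial>M) \<le> (2 * q)\<^sup>2" by (simp add: prob_space)
  qed (use q K L in auto)
  then show ?thesis
    unfolding L_def[symmetric]
  proof (rule holds_except_mono)
    fix u assume u: "\<bar>\<Sum>i\<in>I. ?d (u i) - noise_energy\<bar> \<le> 2 * (sqrt (real n * (2 * q)\<^sup>2 * (K * L)) + 2 * q * (K * L))"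
    have 1: "sqrt (real n * (2 * q)\<^sup>2 * (K * L)) = 2 * q * sqrt K * sqrt (real n * L)"
      using q by (simp add: real_sqrt_mult)
    have "2 * q * K * L \<le> 2 * q * K * sqrt (real n * L)"
      using q K ln_le_sqrt by (intro mult_left_mono) (auto simp: L_def)
    then have "2 * (sqrt (real n * (2 * q)\<^sup>2 * (K * L)) + 2 * q * (K * L)) \<le> 4 * q * (sqrt K + K) * sqrt (real n * L)"
      unfolding 1 by (simp add: algebra_simps)
    also have "\<dots> = 4 * energy_bound * (sqrt K + K) * (real D * sqrt (real n * L))" by (simp add: q_def)
    finally show "\<bar>(\<Sum>i\<in>I. ?d (u i)) - real (card I) * noise_energy\<bar> \<le> 4 * energy_bound * (sqrt K + K) * (real D * sqrt (real n * L))"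
      using u by (simp add: sum_subtractf)
  qed simp
qed

definition cross_const :: "real \<Rightarrow> real" where
  "cross_const K = 2 * B * coord_const K * (sqrt K + sqrt Ac * r\<^sup>2 * K * sqrt Ap)"

text \<open>
  The off-diagonal part of the squared norm of the noise sums is a martingale. Its increments are
  truncated where the past sum exceeds its typical size, so that they are bounded uniformly.
\<close>

lemma off_diagonal_bound:
  assumes I: "I \<subseteq> {1..n}" and K: "0 < K"
  shows "holds_except N ((1 + real n * real D) * (2 * exp (- (K * ln (real n)))))
    (\<lambda>u. \<bar>\<Sum>i\<in>I. \<Sum>k=1..D. noise_sum (I \<inter> {1..<i}) u k * (\<phi> k (u i) * w (u i))\<bar>
       \<le> cross_const K * (sqrt (real D) * (real n * ln (real n))))"
proof -
  define L where "L = ln (real n)"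
  have L: "1 \<le> L" using ln_ge by (simp add: L_def)
  \<comment> \<open>The norm of a vector whose \<open>D\<close> coordinates all meet the coordinate
    bound; outside the exceptional set no past noise sum exceeds it.\<close>
  define R where "R = coord_const K * sqrt (real D * (real n * L))"
  have R: "0 < R" using coord_const_pos[OF K] dim_pos n_pos L by (simp add: R_def)
  let ?T = "\<lambda>i u k. noise_sum (I \<inter> {1..<i}) u k"
  \<comment> \<open>The truncation test reads coordinates before \<open>i\<close> only, so the
    increments remain predictable in the sense of \<open>adapted\<close> and centred.\<close>
  define g where "g = (\<lambda>i u z. if i \<in> I \<and> (\<Sum>k=1..D. (?T i u k)\<^sup>2) \<le> R\<^sup>2
     then \<Sum>k=1..D. ?T i u k * (\<phi> k z * w z) else 0)"
  define c where "c = R * (B * sqrt (Ac * r ^ 4 * real D))"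
  have c: "0 < c" using R constants_pos dim_pos by (simp add: c_def)
  have c_eq: "c = R * sqrt (energy_bound * real D)"
    using constants_pos by (simp add: c_def energy_bound_def real_sqrt_mult)
  have mart: "holds_except N (2 * exp (- (K * L)))
    (\<lambda>u. \<bar>\<Sum>i=1..n. g i u (u i)\<bar> \<le> 2 * (sqrt (real n * (B\<^sup>2 * R\<^sup>2) * (K * L)) + c * (K * L)))"
  proof (rule holds_except_adapted)
    show "(\<lambda>u. g i u (u i)) \<in> borel_measurable (PiM {1..m} (\<lambda>_. M))" if "i \<in> {1..m}" for m i
    proof -
      have [measurable]: "(\<lambda>u. ?T i u k) \<in> borel_measurable (PiM {1..m} (\<lambda>_. M))" for k
        unfolding noise_sum_def
      proof (rule borel_measurable_sum)
        fix j assume "j \<in> I \<inter> {1..<i}"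
        then have [measurable]: "(\<lambda>u. u j) \<in> measurable (PiM {1..m} (\<lambda>_. M)) M"
          using \<open>i \<in> {1..m}\<close> by (intro measurable_component_singleton) auto
        show "(\<lambda>u. \<phi> k (u j) * w (u j)) \<in> borel_measurable (PiM {1..m} (\<lambda>_. M))"
          by measurable
      qed
      show ?thesis unfolding g_def using that by measurable
    qed
    show "g i u \<in> borel_measurable M" for i u unfolding g_def by measurable
    show "g i (u(j := y)) z = g i u z" if "i \<le> j" for i j u y z
    proof -
      have "?T i (u(j := y)) k = ?T i u k" for k
        unfolding noise_sum_def using that by (intro sum.cong) auto
      then show ?thesis unfolding g_def by simp
    qed
    show "AE z in M. \<bar>g i u z\<bar> \<le> c" for i u
      using sum_noise_square_le
    proof eventually_elim
      case (elim z)
      show ?case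
      proof (cases "i \<in> I \<and> (\<Sum>k=1..D. (?T i u k)\<^sup>2) \<le> R\<^sup>2")
        case True
        have "\<bar>\<Sum>k=1..D. ?T i u k * (\<phi> k z * w z)\<bar> \<le> sqrt (\<Sum>k=1..D. (?T i u k)\<^sup>2) * sqrt (\<Sum>k=1..D. (\<phi> k z * w z)\<^sup>2)"
          by (rule sum_mult_le_sqrt)
        also have "\<dots> \<le> R * sqrt (energy_bound * real D)"
          using True elim R by (intro mult_mono) (auto intro!: real_le_lsqrt sum_nonneg)
        finally show ?thesis using True by (simp add: g_def c_eq)
      next
        case False
        then show ?thesis using c by (auto simp: g_def)
      qed
    qed
    show "(\<integral>z. g i u z \<partial>M) = 0" for i u
    proof (cases "i \<in> I \<and> (\<Sum>k=1..D. (?T i u k)\<^sup>2) \<le> R\<^sup>2")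
      case True
      then have "(\<integral>z. g i u z \<partial>M) = (\<integral>z. (\<Sum>k=1..D. ?T i u k * (\<phi> k z * w z)) \<partial>M)"
        by (simp add: g_def)
      also have "\<dots> = (\<Sum>k=1..D. \<integral>z. ?T i u k * (\<phi> k z * w z) \<partial>M)"
        by (rule Bochner_Integration.integral_sum) (use integrable_basis_noise in auto)
      also have "\<dots> = 0" using noise_centered by (intro sum.neutral) auto
      finally show ?thesis .
    next
      case False
      then show ?thesis by (auto simp: g_def)
    qed
    show "(\<integral>z. (g i u z)\<^sup>2 \<partial>M) \<le> B\<^sup>2 * R\<^sup>2" for i u
    proof (cases "i \<in> I \<and> (\<Sum>k=1..D. (?T i u k)\<^sup>2) \<le> R\<^sup>2")
      case True
      then have "(\<integral>z. (g i u z)\<^sup>2 \<partial>M) = (\<integral>z. (\<Sum>k=1..D. ?T i u k * (\<phi> k z * w z))\<^sup>2 \<partial>M)"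
        by (simp add: g_def)
      also have "\<dots> \<le> B\<^sup>2 * (\<Sum>k=1..D. (?T i u k)\<^sup>2)" by (rule noise_combination_integral_le)
      also have "\<dots> \<le> B\<^sup>2 * R\<^sup>2" using True by (intro mult_left_mono) auto
      finally show ?thesis .
    next
      case False
      then show ?thesis by (auto simp: g_def)
    qed
  qed (use c K L in auto)
  \<comment> \<open>A union bound over all times and coordinates. On the resulting event the
    truncation never acts, and the truncated sum is the original one.\<close>
  have "holds_except N (real (card ({1..n} \<times> {1..D})) * (2 * exp (- (K * L))))
    (\<lambda>u. \<forall>p\<in>{1..n} \<times> {1..D}. \<bar>?T (fst p) u (snd p)\<bar> \<le> coord_const K * sqrt (real n * L))"
    unfolding L_def
  proof (rule N.holds_except_ball)
    fix p assume "p \<in> {1..n} \<times> {1..D}"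
    then show "holds_except N (2 * exp (- (K * ln (real n))))
        (\<lambda>u. \<bar>?T (fst p) u (snd p)\<bar> \<le> coord_const K * sqrt (real n * ln (real n)))"
      using I by (intro coordinate_bound K) auto
  qed simp
  from N.holds_except_conj[OF mart this] show ?thesis
    unfolding L_def[symmetric]
  proof (rule holds_except_mono)
    fix u assume u: "\<bar>\<Sum>i=1..n. g i u (u i)\<bar> \<le> 2 * (sqrt (real n * (B\<^sup>2 * R\<^sup>2) * (K * L)) + c * (K * L)) \<and>
      (\<forall>p\<in>{1..n} \<times> {1..D}. \<bar>?T (fst p) u (snd p)\<bar> \<le> coord_const K * sqrt (real n * L))"
    have R2: "(\<Sum>k=1..D. (?T i u k)\<^sup>2) \<le> R\<^sup>2" if i: "i \<in> {1..n}" for i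
    proof -
      have "(?T i u k)\<^sup>2 \<le> (coord_const K * sqrt (real n * L))\<^sup>2" if "k \<in> {1..D}" for k
      proof -
        have "\<bar>?T i u k\<bar> \<le> coord_const K * sqrt (real n * L)" using u i that by auto
        from power_mono[OF this, of 2] show ?thesis by simp
      qed
      then have "(\<Sum>k=1..D. (?T i u k)\<^sup>2) \<le> real (card {1..D}) * (coord_const K * sqrt (real n * L))\<^sup>2"
        by (rule sum_bounded_above)
      also have "\<dots> = R\<^sup>2" using L by (simp add: R_def power_mult_distrib)
      finally show ?thesis .
    qed
    have "(\<Sum>i=1..n. g i u (u i)) = (\<Sum>i=1..n. if i \<in> I then \<Sum>k=1..D. ?T i u k * (\<phi> k (u i) * w (u i)) else 0)"
      unfolding g_def by (intro sum.cong) (use R2 in auto)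
    also have "\<dots> = (\<Sum>i\<in>I. \<Sum>k=1..D. ?T i u k * (\<phi> k (u i) * w (u i)))"
      using I by (simp add: sum.If_cases Int_absorb1)
    finally have "\<bar>\<Sum>i\<in>I. \<Sum>k=1..D. ?T i u k * (\<phi> k (u i) * w (u i))\<bar>
        \<le> 2 * (sqrt (real n * (B\<^sup>2 * R\<^sup>2) * (K * L)) + c * (K * L))"
      using u by simp
    also have "\<dots> \<le> cross_const K * (sqrt (real D) * (real n * L))"
    proof -
      have 1: "sqrt (real n * (B\<^sup>2 * R\<^sup>2) * (K * L)) = B * R * sqrt K * sqrt (real n * L)"
        using R constants_pos by (simp add: real_sqrt_mult)
      \<comment> \<open>The dimension bound keeps the linear Bernstein term, of order R * sqrt D *
        L, below the variance term, of order R * sqrt (n * L).\<close>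
      have "real D * L\<^sup>2 \<le> Ap * real n"
        using dim_le L by (simp add: L_def[symmetric] field_simps)
      then have "sqrt (real D * L\<^sup>2) \<le> sqrt (Ap * real n)" by simp
      then have "sqrt (real D) * L \<le> sqrt Ap * sqrt (real n)" using L by (simp add: real_sqrt_mult)
      also have "\<dots> \<le> sqrt Ap * sqrt (real n * L)"
        using sqrt_n_le constants_pos by (intro mult_left_mono) (auto simp: L_def)
      finally have "(B * R * sqrt Ac * r\<^sup>2 * K) * (sqrt (real D) * L) \<le> (B * R * sqrt Ac * r\<^sup>2 * K) * (sqrt Ap * sqrt (real n * L))"
        using constants_pos R K by (intro mult_left_mono) auto
      moreover have "sqrt (r ^ 4) = r\<^sup>2"
        by (rule real_sqrt_unique) (auto simp: power_mult[symmetric])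
      then have "c = B * R * sqrt Ac * r\<^sup>2 * sqrt (real D)"
        by (simp add: c_def real_sqrt_mult)
      ultimately have "2 * (sqrt (real n * (B\<^sup>2 * R\<^sup>2) * (K * L)) + c * (K * L))
        \<le> 2 * B * (sqrt K + sqrt Ac * r\<^sup>2 * K * sqrt Ap) * (R * sqrt (real n * L))"
        unfolding 1 by (simp add: algebra_simps)
      also have "R * sqrt (real n * L) = coord_const K * (sqrt (real D) * (real n * L))"
      proof -
        have "sqrt (real n * L) * sqrt (real n * L) = real n * L" using L by simp
        then show ?thesis unfolding R_def real_sqrt_mult[of "real D"] mult.assoc by (simp only:)
      qed
      finally show ?thesis by (simp add: cross_const_def algebra_simps)
    qed
    finally show "\<bar>\<Sum>i\<in>I. \<Sum>k=1..D. ?T i u k * (\<phi> k (u i) * w (u i))\<bar> \<le> cross_const K * (sqrt (real D) * (real n * L))" .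
  qed (simp add: algebra_simps)
qed

text \<open>Pairs of observations are grouped by their larger index, which displays the cross terms
  as a martingale in that index.\<close>

lemma noise_norm_expand:
  assumes I: "I \<subseteq> {1..n}"
  shows "(\<Sum>k=1..D. (noise_sum I u k)\<^sup>2) = (\<Sum>i\<in>I. \<Sum>k=1..D. (\<phi> k (u i) * w (u i))\<^sup>2)
    + 2 * (\<Sum>i\<in>I. \<Sum>k=1..D. noise_sum (I \<inter> {1..<i}) u k * (\<phi> k (u i) * w (u i)))"
proof -
  have fin: "finite I" using I finite_subset by blast
  have *: "(noise_sum I u k)\<^sup>2 = (\<Sum>i\<in>I. (\<phi> k (u i) * w (u i))\<^sup>2) + 2 * (\<Sum>i\<in>I. noise_sum (I \<inter> {1..<i}) u k * (\<phi> k (u i) * w (u i)))" for k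
  proof -
    let ?c = "\<lambda>i. if i \<in> I then \<phi> k (u i) * w (u i) else 0"
    have 1: "(\<Sum>i=1..n. ?c i) = noise_sum I u k"
      using I unfolding noise_sum_def by (simp add: sum.If_cases Int_absorb1)
    have 2: "(\<Sum>j=1..<i. ?c j) = noise_sum (I \<inter> {1..<i}) u k" for i
      unfolding noise_sum_def by (simp add: sum.If_cases Int_commute)
    have 3: "(\<Sum>i=1..n. (?c i)\<^sup>2) = (\<Sum>i\<in>I. (\<phi> k (u i) * w (u i))\<^sup>2)"
      using I by (simp add: if_distrib[of "\<lambda>x. x\<^sup>2"] sum.If_cases Int_absorb1 cong: if_cong)
    have 4: "(\<Sum>i=1..n. noise_sum (I \<inter> {1..<i}) u k * ?c i) = (\<Sum>i\<in>I. noise_sum (I \<inter> {1..<i}) u k * (\<phi> k (u i) * w (u i)))"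
      using I by (simp add: if_distrib sum.If_cases Int_absorb1 cong: if_cong)
    show ?thesis using sum_square_expand[of ?c n] unfolding 1 2 3 4 .
  qed
  have s1: "(\<Sum>i\<in>I. \<Sum>k=1..D. f i k) = (\<Sum>k=1..D. \<Sum>i\<in>I. f i k)" for f :: "nat \<Rightarrow> nat \<Rightarrow> real"
    by (rule sum.swap)
  show ?thesis unfolding * s1 by (simp add: sum.distrib sum_distrib_left)
qed

definition norm_const :: "real \<Rightarrow> real" where
  "norm_const K = 4 * energy_bound * (sqrt K + K) + 2 * cross_const K"

lemma noise_norm_bound:
  assumes I: "I \<subseteq> {1..n}" and K: "0 < K"
  shows "holds_except N ((2 + real n * real D) * (2 * exp (- (K * ln (real n)))))
    (\<lambda>u. \<bar>(\<Sum>k=1..D. (noise_sum I u k)\<^sup>2) - real (card I) * noise_energy\<bar>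
       \<le> norm_const K * (real n * (real D / sqrt (ln (real n)) + ln (real n) ^ 3)))"
proof (rule holds_except_mono[OF N.holds_except_conj[OF diagonal_bound[OF I K] off_diagonal_bound[OF I K]]])
  define L where "L = ln (real n)"
  have L: "1 \<le> L" "L\<^sup>2 \<le> real n" using ln_ge ln_square_le by (auto simp: L_def)
  have sL: "1 \<le> sqrt L" "(sqrt L)\<^sup>2 = L" using L by auto
  let ?E = "real n * (real D / sqrt L + L ^ 3)"
  fix u
  assume u: "\<bar>(\<Sum>i\<in>I. \<Sum>k=1..D. (\<phi> k (u i) * w (u i))\<^sup>2) - real (card I) * noise_energy\<bar>
       \<le> 4 * energy_bound * (sqrt K + K) * (real D * sqrt (real n * ln (real n))) \<and>
    \<bar>\<Sum>i\<in>I. \<Sum>k=1..D. noise_sum (I \<inter> {1..<i}) u k * (\<phi> k (u i) * w (u i))\<bar>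
       \<le> cross_const K * (sqrt (real D) * (real n * ln (real n)))"
  \<comment> \<open>This step rests on \<open>L\<^sup>2 \<le> n\<close>: it gives sqrt (n * L) at
    most n / sqrt L.\<close>
  have 1: "real D * sqrt (real n * L) \<le> ?E"
  proof -
    have "L\<^sup>2 * real n \<le> real n * real n" using L by (intro mult_right_mono) auto
    then have "real n * L \<le> (real n / sqrt L)\<^sup>2"
      using L sL by (simp add: power_divide power2_eq_square field_simps)
    then have "sqrt (real n * L) \<le> real n / sqrt L"
      by (rule real_le_lsqrt[rotated]) (use L in auto)
    then have "real D * sqrt (real n * L) \<le> real D * (real n / sqrt L)"
      by (intro mult_left_mono) auto
    also have "\<dots> \<le> ?E" using L by (simp add: algebra_simps)
    finally show ?thesis .
  qed
  have 2: "sqrt (real D) * (real n * L) \<le> ?E"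
  proof -
    define y where "y = sqrt L"
    have y: "1 \<le> y" "y\<^sup>2 = L" using sL by (auto simp: y_def)
    define d where "d = sqrt (real D)"
    have d: "0 \<le> d" "d\<^sup>2 = real D" by (auto simp: d_def)
    \<comment> \<open>The square of \<open>d - y ^ 3\<close> balances the two parts. Raising
      \<open>y ^ 6\<close> to \<open>y ^ 7\<close> makes the remainder an integral power of
      \<open>L\<close> after division by \<open>y = sqrt L\<close>, namely
      \<open>L ^ 3\<close>.\<close>
    have "2 * (d * y ^ 3) \<le> d\<^sup>2 + y ^ 6"
      using zero_le_power2[of "d - y ^ 3"] by (simp add: power2_diff power_mult[symmetric])
    moreover have "y ^ 6 \<le> y ^ 7" using y by (intro power_increasing) auto
    moreover have "0 \<le> d * y ^ 3" using y d by simp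
    ultimately have "d * y ^ 3 \<le> d\<^sup>2 + y ^ 7" by linarith
    then have "d * y\<^sup>2 \<le> d\<^sup>2 / y + y ^ 6"
      using y by (simp add: field_simps eval_nat_numeral)
    moreover have "L ^ 3 = y ^ 6" unfolding y(2)[symmetric] by (simp add: power_mult[symmetric])
    ultimately have "sqrt (real D) * L \<le> real D / sqrt L + L ^ 3"
      using y(2) d(2) by (simp add: y_def d_def)
    from mult_left_mono[OF this, of "real n"] show ?thesis by (simp add: mult_ac)
  qed
  have c: "0 \<le> 4 * energy_bound * (sqrt K + K)" "0 \<le> cross_const K"
    using energy_bound_pos K coord_const_pos[OF K] constants_pos by (auto simp: cross_const_def)
  have "\<bar>(\<Sum>k=1..D. (noise_sum I u k)\<^sup>2) - real (card I) * noise_energy\<bar>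
    \<le> 4 * energy_bound * (sqrt K + K) * (real D * sqrt (real n * L)) + 2 * (cross_const K * (sqrt (real D) * (real n * L)))"
    using u unfolding noise_norm_expand[OF I] L_def by (smt (verit, best))
  also have "\<dots> \<le> 4 * energy_bound * (sqrt K + K) * ?E + 2 * (cross_const K * ?E)"
    using c 1 2 by (intro add_mono mult_left_mono) auto
  also have "\<dots> = norm_const K * ?E" by (simp add: norm_const_def algebra_simps)
  finally show "\<bar>(\<Sum>k=1..D. (noise_sum I u k)\<^sup>2) - real (card I) * noise_energy\<bar>
       \<le> norm_const K * (real n * (real D / sqrt (ln (real n)) + ln (real n) ^ 3))"
    by (simp add: L_def)
qed (simp add: algebra_simps)

end

section \<open>Perturbed normal equations\<close>

lemma L2_set_square: "(L2_set f I)\<^sup>2 = (\<Sum>i\<in>I. (f i)\<^sup>2)"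
  unfolding L2_set_def by (simp add: sum_nonneg)

lemma L2_set_inner_le: "\<bar>\<Sum>k\<in>I. x k * y k\<bar> \<le> L2_set x I * L2_set y I"
  unfolding L2_set_def by (rule sum_mult_le_sqrt)

lemma L2_set_scale: "0 \<le> c \<Longrightarrow> L2_set (\<lambda>k. c * f k) I = c * L2_set f I"
  by (simp add: L2_set_right_distrib)

text \<open>Duality: the residual vector is itself taken as the test vector, and one factor of its
  norm cancels.\<close>

lemma bilinear_bound_residual:
  fixes g :: "'a \<Rightarrow> 'a \<Rightarrow> real"
  assumes g: "\<And>x y. \<bar>\<Sum>k\<in>I. \<Sum>l\<in>I. x k * y l * g k l\<bar> \<le> e * L2_set x I * L2_set y I" and e: "0 \<le> e"
  shows "L2_set (\<lambda>k. \<Sum>l\<in>I. y l * g k l) I \<le> e * L2_set y I"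
proof -
  let ?x = "\<lambda>k. \<Sum>l\<in>I. y l * g k l"
  have "(L2_set ?x I)\<^sup>2 = (\<Sum>k\<in>I. \<Sum>l\<in>I. ?x k * y l * g k l)"
    unfolding L2_set_square by (simp add: power2_eq_square sum_distrib_left mult_ac)
  also have "\<dots> \<le> e * L2_set ?x I * L2_set y I" using g[of ?x y] by linarith
  finally have "L2_set ?x I * L2_set ?x I \<le> L2_set ?x I * (e * L2_set y I)"
    by (simp add: power2_eq_square mult_ac)
  then show ?thesis
    by (cases "L2_set ?x I = 0") (use e L2_set_nonneg[of ?x I] L2_set_nonneg[of y I] in \<open>auto simp: mult_le_cancel_left\<close>)
qed

text \<open>For a sample of size \<open>\<tau>\<close>, \<open>e\<close> bounds the operator norm of
  the unnormalized Gram deviation. As \<open>e\<close> is at most half of \<open>\<tau>\<close>, the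
  vectors \<open>S\<close> and \<open>\<tau> * \<beta>\<close> have comparable norms and differ by
  at most \<open>e\<close> times the norm of \<open>\<beta>\<close>, so the known squared norm of
  \<open>S\<close> carries over to \<open>\<beta>\<close>.\<close>

lemma normal_equations_perturbation:
  fixes g :: "'a \<Rightarrow> 'a \<Rightarrow> real" and S \<beta> :: "'a \<Rightarrow> real"
  assumes g: "\<And>x y. \<bar>\<Sum>k\<in>I. \<Sum>l\<in>I. x k * y l * g k l\<bar> \<le> e * L2_set x I * L2_set y I"
    and e: "0 \<le> e" "e \<le> \<tau> / 2" and \<tau>: "0 < \<tau>" and C: "0 \<le> C"
    and normal: "\<And>k. k \<in> I \<Longrightarrow> S k = \<tau> * \<beta> k + (\<Sum>l\<in>I. \<beta> l * g k l)"
    and S: "\<bar>(L2_set S I)\<^sup>2 - \<tau> * C\<bar> \<le> E"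
  shows "L2_set (\<lambda>k. S k - \<tau> * \<beta> k) I \<le> e * L2_set \<beta> I"
    and "\<tau> * L2_set \<beta> I \<le> 2 * L2_set S I"
    and "\<bar>\<tau>\<^sup>2 * (L2_set \<beta> I)\<^sup>2 - \<tau> * C\<bar> \<le> 6 * E + 10 * e * C"
proof -
  let ?d = "\<lambda>k. S k - \<tau> * \<beta> k"
  let ?b = "L2_set \<beta> I" and ?s = "L2_set S I"
  have b0: "0 \<le> ?b" and s0: "0 \<le> ?s" by (auto intro: L2_set_nonneg)
  have "L2_set ?d I = L2_set (\<lambda>k. \<Sum>l\<in>I. \<beta> l * g k l) I"
    by (rule L2_set_cong) (use normal in auto)
  then show d: "L2_set ?d I \<le> e * ?b" using bilinear_bound_residual[OF g e(1), of \<beta>] by simp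
  have eb: "e * ?b \<le> \<tau> / 2 * ?b" using e b0 by (intro mult_right_mono) auto
  have sc: "L2_set (\<lambda>k. \<tau> * \<beta> k) I = \<tau> * ?b" using \<tau> by (intro L2_set_scale) auto
  have "L2_set (\<lambda>k. ?d k + \<tau> * \<beta> k) I \<le> L2_set ?d I + L2_set (\<lambda>k. \<tau> * \<beta> k) I"
    by (rule L2_set_triangle_ineq)
  then have t1: "?s \<le> e * ?b + \<tau> * ?b" using d sc by simp
  have "L2_set (\<lambda>k. S k + - ?d k) I \<le> L2_set S I + L2_set (\<lambda>k. - ?d k) I"
    by (rule L2_set_triangle_ineq)
  moreover have "L2_set (\<lambda>k. - ?d k) I = L2_set ?d I" unfolding L2_set_def by (simp add: power2_commute)
  ultimately have t2: "\<tau> * ?b \<le> ?s + e * ?b" using d sc by simp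
  show bs: "\<tau> * ?b \<le> 2 * ?s" using t2 eb by (simp add: field_simps)
  have "\<bar>?s\<^sup>2 - (\<tau> * ?b)\<^sup>2\<bar> = \<bar>?s - \<tau> * ?b\<bar> * (?s + \<tau> * ?b)"
  proof -
    have "?s\<^sup>2 - (\<tau> * ?b)\<^sup>2 = (?s - \<tau> * ?b) * (?s + \<tau> * ?b)" by (simp add: power2_eq_square algebra_simps)
    then show ?thesis using s0 b0 \<tau> by (simp add: abs_mult)
  qed
  \<comment> \<open>\<open>?s\<close> is at most 3/2 of \<open>\<tau> * ?b\<close>, hence 5/2 for
    the sum of the two; below, \<open>\<tau> * ?b \<le> 2 * ?s\<close> turns 5/2 into 10.\<close>
  also have "\<dots> \<le> (e * ?b) * (5/2 * (\<tau> * ?b))"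
    using t1 t2 eb s0 b0 e \<tau> by (intro mult_mono) (auto simp: abs_le_iff)
  also have "\<dots> = 5/2 * (e / \<tau>) * (\<tau> * ?b)\<^sup>2" using \<tau> by (simp add: power2_eq_square field_simps)
  also have "\<dots> \<le> 5/2 * (e / \<tau>) * (2 * ?s)\<^sup>2"
    using bs b0 \<tau> e by (intro mult_left_mono power_mono) auto
  also have "\<dots> = 10 * (e / \<tau>) * ?s\<^sup>2" by (simp add: power_mult_distrib)
  also have "\<dots> \<le> 10 * (e / \<tau>) * (\<tau> * C + E)"
    using S e \<tau> by (intro mult_left_mono) auto
  also have "\<dots> = 10 * e * C + 10 * (e / \<tau>) * E" using \<tau> by (simp add: field_simps)
  also have "10 * (e / \<tau>) * E \<le> 10 * (1/2) * E"
    using e \<tau> S by (intro mult_right_mono mult_left_mono) (auto simp: field_simps)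
  finally have "\<bar>?s\<^sup>2 - (\<tau> * ?b)\<^sup>2\<bar> \<le> 10 * e * C + 5 * E" by simp
  then show "\<bar>\<tau>\<^sup>2 * ?b\<^sup>2 - \<tau> * C\<bar> \<le> 6 * E + 10 * e * C"
    using S by (simp add: power_mult_distrib abs_le_iff)
qed

text \<open>
  The inner product of the noise sums over the training set and over the fold is controlled by
  polarization, since their sum is the noise sum over the whole sample.
\<close>

lemma held_out_estimate:
  fixes g h :: "'a \<Rightarrow> 'a \<Rightarrow> real" and S U \<beta> :: "'a \<Rightarrow> real"
  assumes g: "\<And>x y. \<bar>\<Sum>k\<in>I. \<Sum>l\<in>I. x k * y l * g k l\<bar> \<le> e * L2_set x I * L2_set y I"
    and h: "\<And>x y. \<bar>\<Sum>k\<in>I. \<Sum>l\<in>I. x k * y l * h k l\<bar> \<le> e * L2_set x I * L2_set y I"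
    and e: "0 \<le> e" "e \<le> \<tau> / 2" and \<tau>: "0 < \<tau>" "0 \<le> v" "v \<le> \<tau>" and C: "0 \<le> C"
    and normal: "\<And>k. k \<in> I \<Longrightarrow> S k = \<tau> * \<beta> k + (\<Sum>l\<in>I. \<beta> l * g k l)"
    and S: "\<bar>(L2_set S I)\<^sup>2 - \<tau> * C\<bar> \<le> E" and U: "\<bar>(L2_set U I)\<^sup>2 - v * C\<bar> \<le> E"
    and SU: "\<bar>(L2_set (\<lambda>k. S k + U k) I)\<^sup>2 - (\<tau> + v) * C\<bar> \<le> E"
  shows "\<bar>v * (L2_set \<beta> I)\<^sup>2 + (\<Sum>k\<in>I. \<Sum>l\<in>I. \<beta> k * \<beta> l * h k l) - 2 * (\<Sum>k\<in>I. \<beta> k * U k) - v * C / \<tau>\<bar>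
    \<le> (13 * E + 18 * e * C) / \<tau>"
proof -
  let ?b = "L2_set \<beta> I" and ?s = "L2_set S I" and ?u = "L2_set U I"
  note pert = normal_equations_perturbation[OF g e \<tau>(1) C normal S]
  have b0: "0 \<le> ?b" and s0: "0 \<le> ?s" and u0: "0 \<le> ?u" by (auto intro: L2_set_nonneg)
  have E0: "0 \<le> E" using S by linarith
  have eC: "0 \<le> e * C" using e C by simp
  have e\<tau>: "e / \<tau> \<le> 1/2" using e \<tau> by (simp add: field_simps)
  have eE: "e / \<tau> * E \<le> E / 2" using mult_right_mono[OF e\<tau> E0] by simp
  have 1: "\<bar>v * ?b\<^sup>2 - v * C / \<tau>\<bar> \<le> (6 * E + 10 * e * C) / \<tau>"
  proof -
    have "v * ?b\<^sup>2 - v * C / \<tau> = v / \<tau>\<^sup>2 * (\<tau>\<^sup>2 * ?b\<^sup>2 - \<tau> * C)"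
      using \<tau> by (simp add: field_simps power2_eq_square)
    then have "\<bar>v * ?b\<^sup>2 - v * C / \<tau>\<bar> = v / \<tau>\<^sup>2 * \<bar>\<tau>\<^sup>2 * ?b\<^sup>2 - \<tau> * C\<bar>"
      using \<tau> by (simp only: abs_mult) simp
    also have "\<dots> \<le> \<tau> / \<tau>\<^sup>2 * (6 * E + 10 * e * C)"
      using pert(3) \<tau> by (intro mult_mono divide_right_mono) auto
    finally show ?thesis using \<tau> by (simp add: power2_eq_square)
  qed
  have bsq: "e * ?b\<^sup>2 \<le> (2 * E + 4 * e * C) / \<tau>"
  proof -
    have "(\<tau> * ?b)\<^sup>2 \<le> (2 * ?s)\<^sup>2" using pert(2) b0 \<tau> by (intro power_mono) auto
    also have "\<dots> \<le> 4 * (\<tau> * C + E)" using S by (simp add: power_mult_distrib)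
    finally have "e / \<tau> * (\<tau> * ?b)\<^sup>2 \<le> e / \<tau> * (4 * (\<tau> * C + E))"
      using e \<tau> by (intro mult_left_mono) auto
    also have "\<dots> = 4 * e * C + 4 * (e / \<tau> * E)" using \<tau> by (simp add: field_simps)
    also have "\<dots> \<le> 2 * E + 4 * e * C" using eE by simp
    finally show ?thesis using \<tau> by (simp add: field_simps power2_eq_square)
  qed
  have 2: "\<bar>\<Sum>k\<in>I. \<Sum>l\<in>I. \<beta> k * \<beta> l * h k l\<bar> \<le> (2 * E + 4 * e * C) / \<tau>"
    using h[of \<beta> \<beta>] bsq by (simp add: power2_eq_square mult.assoc)
  have pol: "(L2_set (\<lambda>k. S k + U k) I)\<^sup>2 = ?s\<^sup>2 + ?u\<^sup>2 + 2 * (\<Sum>k\<in>I. S k * U k)"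
    unfolding L2_set_square by (simp add: power2_sum sum.distrib sum_distrib_left mult_ac)
  \<comment> \<open>The leading terms \<open>\<tau> * C\<close> and \<open>v * C\<close> cancel, so
    the inner product is of the order of the errors alone.\<close>
  have "2 * (\<Sum>k\<in>I. S k * U k) = ((L2_set (\<lambda>k. S k + U k) I)\<^sup>2 - (\<tau> + v) * C) - (?s\<^sup>2 - \<tau> * C) - (?u\<^sup>2 - v * C)"
    unfolding pol by (simp add: algebra_simps)
  then have 3: "\<bar>2 * (\<Sum>k\<in>I. S k * U k)\<bar> \<le> 3 * E" using S U SU by linarith
  \<comment> \<open>The gap between \<open>S\<close> and \<open>\<tau> * \<beta>\<close> is paired
    with \<open>U\<close> by Cauchy-Schwarz; \<open>v \<le> \<tau>\<close> keeps the norm of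
    \<open>U\<close> comparable to that of \<open>S\<close>.\<close>
  have 4: "\<bar>\<Sum>k\<in>I. (S k - \<tau> * \<beta> k) * U k\<bar> \<le> 2 * e * C + E"
  proof -
    have "\<bar>\<Sum>k\<in>I. (S k - \<tau> * \<beta> k) * U k\<bar> \<le> L2_set (\<lambda>k. S k - \<tau> * \<beta> k) I * ?u"
      by (rule L2_set_inner_le)
    also have "\<dots> \<le> e * ?b * ?u" using pert(1) u0 by (intro mult_right_mono) auto
    also have "\<dots> = e / \<tau> * ((\<tau> * ?b) * ?u)" using \<tau> by simp
    also have "\<dots> \<le> e / \<tau> * ((2 * ?s) * ?u)"
      using pert(2) u0 e \<tau> by (intro mult_left_mono mult_right_mono) auto
    also have "\<dots> \<le> e / \<tau> * (?s\<^sup>2 + ?u\<^sup>2)"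
      using e \<tau> sum_squares_bound[of ?s ?u] by (intro mult_left_mono) (auto simp: mult.assoc)
    also have "\<dots> \<le> e / \<tau> * (2 * \<tau> * C + 2 * E)"
    proof (intro mult_left_mono)
      have "v * C \<le> \<tau> * C" using \<tau> C by (intro mult_right_mono) auto
      then show "?s\<^sup>2 + ?u\<^sup>2 \<le> 2 * \<tau> * C + 2 * E" using S U by linarith
    qed (use e \<tau> in auto)
    also have "\<dots> = 2 * e * C + 2 * (e / \<tau> * E)" using \<tau> by (simp add: field_simps)
    finally show ?thesis using eE by linarith
  qed
  have "\<tau> * (\<Sum>k\<in>I. \<beta> k * U k) = (\<Sum>k\<in>I. S k * U k) - (\<Sum>k\<in>I. (S k - \<tau> * \<beta> k) * U k)"
    by (simp add: sum_subtractf[symmetric] sum_distrib_left algebra_simps)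
  then have "\<bar>2 * (\<tau> * (\<Sum>k\<in>I. \<beta> k * U k))\<bar> \<le> 5 * E + 4 * e * C" using 3 4 by linarith
  then have 5: "\<bar>2 * (\<Sum>k\<in>I. \<beta> k * U k)\<bar> \<le> (5 * E + 4 * e * C) / \<tau>"
    using \<tau> by (simp add: field_simps abs_mult)
  \<comment> \<open>The totals are 13 = 6 + 2 + 5 and 18 = 10 + 4 + 4.\<close>
  have "(6 * E + 10 * e * C) / \<tau> + (2 * E + 4 * e * C) / \<tau> + (5 * E + 4 * e * C) / \<tau> \<le> (13 * E + 18 * e * C) / \<tau>"
    by (simp add: add_divide_distrib[symmetric] algebra_simps)
  then show ?thesis using 1 2 5 by linarith
qed

text \<open>Adds the loss gap \<open>h\<close> between the projection and the regression function,
  whose mean \<open>bias\<close> is the approximation error. The condition \<open>bias_var\<close>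
  bounds its second moment by a multiple of its mean, which makes its fluctuations relative to the
  bias.\<close>

locale localized_regression = localized_model +
  fixes h :: "'a \<Rightarrow> real" and bias H :: real
  assumes bias_measurable: "h \<in> borel_measurable M"
    and H_pos: "0 < H" and bias_nonneg: "0 \<le> bias"
    and bias_bound: "AE z in M. \<bar>h z\<bar> \<le> H"
    and bias_mean: "(\<integral>z. h z \<partial>M) = bias"
    and bias_var: "(\<integral>z. (h z)\<^sup>2 \<partial>M) \<le> H * bias"
begin

section \<open>Concentration of the loss gap and the typical event\<close>

declare bias_measurable [measurable]

definition bias_const :: "real \<Rightarrow> real" where
  "bias_const K = 2 * sqrt (H * K) + 4 * H * K"

lemma bias_concentration:
  assumes K: "0 < K"
  shows "holds_except N (2 * exp (- (K * ln (real n))))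
    (\<lambda>u. \<bar>(\<Sum>i=1..n. h (u i)) - real n * bias\<bar>
       \<le> bias_const K * (real n * (bias / sqrt (ln (real n))) + ln (real n) ^ 3))"
proof -
  define L where "L = ln (real n)"
  have L: "1 \<le> L" using ln_ge by (simp add: L_def)
  have int: "integrable M h" by (rule integrable_const_bound[of _ H]) (use bias_bound in auto)
  have int2: "integrable M (\<lambda>z. (h z)\<^sup>2)"
  proof (rule integrable_const_bound[of _ "H\<^sup>2"])
    show "AE z in M. norm ((h z)\<^sup>2) \<le> H\<^sup>2"
      using AE_abs_square_le[OF bias_bound] by simp
  qed auto
  have "bias \<le> (\<integral>z. H \<partial>M)"
    unfolding bias_mean[symmetric] by (rule integral_mono_AE) (use int bias_bound in auto)
  then have bH: "bias \<le> H" by (simp add: prob_space)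
  have "holds_except N (2 * exp (- (K * L)))
    (\<lambda>u. \<bar>\<Sum>i\<in>{1..n}. h (u i) - bias\<bar> \<le> 2 * (sqrt (real n * (H * bias) * (K * L)) + 2 * H * (K * L)))"
  proof (rule holds_except_iid)
    show "AE z in M. \<bar>h z - bias\<bar> \<le> 2 * H"
      using bias_bound by eventually_elim (use bH bias_nonneg in linarith)
    show "(\<integral>z. h z - bias \<partial>M) = 0" using int by (simp add: prob_space bias_mean)
    have "(\<integral>z. (h z - bias)\<^sup>2 \<partial>M) = (\<integral>z. (h z)\<^sup>2 - 2 * bias * h z + bias\<^sup>2 \<partial>M)"
      by (intro Bochner_Integration.integral_cong) (auto simp: power2_eq_square algebra_simps)
    also have "\<dots> = (\<integral>z. (h z)\<^sup>2 \<partial>M) - bias\<^sup>2"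
      using int int2 by (simp add: prob_space bias_mean power2_eq_square)
    also have "\<dots> \<le> H * bias" using bias_var zero_le_power2[of bias] by linarith
    finally show "(\<integral>z. (h z - bias)\<^sup>2 \<partial>M) \<le> H * bias" .
  qed (use H_pos K L in auto)
  then show ?thesis
    unfolding L_def[symmetric]
  proof (rule holds_except_mono)
    fix u assume u: "\<bar>\<Sum>i\<in>{1..n}. h (u i) - bias\<bar> \<le> 2 * (sqrt (real n * (H * bias) * (K * L)) + 2 * H * (K * L))"
    define X where "X = real n * (bias / sqrt L)"
    define Y where "Y = L ^ 3"
    have X: "0 \<le> X" using bias_nonneg L by (simp add: X_def)
    have LY: "L \<le> Y" using power_increasing[of 1 3 L] L by (simp add: Y_def)
    have Y: "0 \<le> Y" using L LY by linarith
    have "sqrt (real n * (H * bias) * (K * L)) = sqrt (H * K) * sqrt (real n * bias * L)"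
      by (simp add: real_sqrt_mult mult_ac)
    also have "sqrt (real n * bias * L) \<le> X + Y"
    proof (rule real_le_lsqrt)
      \<comment> \<open>The radicand is \<open>X\<close> times L^(3/2), hence at most
        \<open>X * Y\<close>; a square root of a product is at most the sum, which separates the
        relative part \<open>X\<close> from the absolute part \<open>Y\<close>.\<close>
      have "real n * bias * L = X * (sqrt L * L)" using L by (simp add: X_def)
      also have "sqrt L * L \<le> Y"
      proof -
        have "sqrt L \<le> L" using L by (intro real_le_lsqrt) (auto simp: power2_eq_square)
        then have "sqrt L * L \<le> L * L" using L by (intro mult_right_mono) auto
        also have "\<dots> \<le> Y" using power_increasing[of 2 3 L] L by (simp add: Y_def power2_eq_square)
        finally show ?thesis .
      qed
      then have "X * (sqrt L * L) \<le> X * Y" using X by (intro mult_left_mono) auto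
      also have "X * Y \<le> (X + Y)\<^sup>2"
        using X Y by (simp add: power2_sum)
      finally show "real n * bias * L \<le> (X + Y)\<^sup>2" .
    qed (use X Y in auto)
    finally have 1: "sqrt (real n * (H * bias) * (K * L)) \<le> sqrt (H * K) * (X + Y)"
      using H_pos K by (auto intro: mult_left_mono)
    have 2: "2 * H * (K * L) \<le> 2 * H * K * (X + Y)"
    proof -
      have "2 * H * K * L \<le> 2 * H * K * (X + Y)" using H_pos K X LY by (intro mult_left_mono) auto
      then show ?thesis by (simp add: mult.assoc)
    qed
    have "(\<Sum>i\<in>{1..n}. h (u i) - bias) = (\<Sum>i=1..n. h (u i)) - real n * bias" by (simp add: sum_subtractf)
    then show "\<bar>(\<Sum>i=1..n. h (u i)) - real n * bias\<bar> \<le> bias_const K * (real n * (bias / sqrt L) + L ^ 3)"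
      using u 1 2 unfolding X_def[symmetric] Y_def[symmetric] bias_const_def by (simp add: algebra_simps)
  qed simp
qed

definition rel_error :: "real \<Rightarrow> real" where
  "rel_error t = t / sqrt (ln (real n)) + ln (real n) ^ 3 / real n"

text \<open>On this event the rest of the argument is deterministic. The Gram bound is required for
  all \<open>x\<close> and \<open>y\<close>, since it is applied to coefficients of
  estimators.\<close>

definition typical :: "real \<Rightarrow> nat set set \<Rightarrow> (nat \<Rightarrow> 'a) \<Rightarrow> bool" where
  "typical K \<J> u \<longleftrightarrow>
    (\<forall>I\<in>\<J>. (\<forall>x y. \<bar>\<Sum>k=1..D. \<Sum>l=1..D. x k * y l * gram_dev I u k l\<bar>
        \<le> gram_const K * real n / sqrt (ln (real n)) * L2_set x {1..D} * L2_set y {1..D}) \<and>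
      \<bar>(L2_set (noise_sum I u) {1..D})\<^sup>2 - real (card I) * noise_energy\<bar>
        \<le> norm_const K * (real n * (real D / sqrt (ln (real n)) + ln (real n) ^ 3))) \<and>
    \<bar>(\<Sum>i=1..n. h (u i)) - real n * bias\<bar>
       \<le> bias_const K * (real n * (bias / sqrt (ln (real n))) + ln (real n) ^ 3)"

lemma holds_except_typical:
  assumes K: "0 < K" and \<J>: "finite \<J>" "\<And>I. I \<in> \<J> \<Longrightarrow> I \<subseteq> {1..n}"
  shows "holds_except N ((real (card \<J>) * ((real D)\<^sup>2 + 2 + real n * real D) + 1) * (2 * exp (- (K * ln (real n)))))
    (typical K \<J>)"
proof -
  let ?p = "2 * exp (- (K * ln (real n)))"
  have "holds_except N (real (card \<J>) * ((real D)\<^sup>2 * ?p + (2 + real n * real D) * ?p) + ?p) (typical K \<J>)"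
    unfolding typical_def
  proof (intro N.holds_except_conj N.holds_except_ball \<J>(1))
    fix I assume "I \<in> \<J>"
    then have I: "I \<subseteq> {1..n}" by (rule \<J>(2))
    show "holds_except N ((real D)\<^sup>2 * ?p) (\<lambda>u. \<forall>x y. \<bar>\<Sum>k=1..D. \<Sum>l=1..D. x k * y l * gram_dev I u k l\<bar>
        \<le> gram_const K * real n / sqrt (ln (real n)) * L2_set x {1..D} * L2_set y {1..D})"
      unfolding L2_set_def by (rule gram_bound[OF I K])
    show "holds_except N ((2 + real n * real D) * ?p) (\<lambda>u. \<bar>(L2_set (noise_sum I u) {1..D})\<^sup>2 - real (card I) * noise_energy\<bar>
        \<le> norm_const K * (real n * (real D / sqrt (ln (real n)) + ln (real n) ^ 3)))"
      unfolding L2_set_square by (rule noise_norm_bound[OF I K])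
  qed (rule bias_concentration[OF K])
  then show ?thesis by (rule holds_except_mono) (simp_all add: algebra_simps)
qed

end

section \<open>Risks and criterion over one model\<close>

text \<open>The whole sample belongs here for two reasons: the final estimator is trained on it, and
  polarization between a training set and its fold needs its noise norm.\<close>

definition cv_sets :: "nat \<Rightarrow> nat \<Rightarrow> (nat \<Rightarrow> nat set) \<Rightarrow> nat set set" where
  "cv_sets n V F = insert {1..n} (F ` {1..V} \<union> (\<lambda>j. {1..n} - F j) ` {1..V})"

lemma regular_folds_subset:
  assumes "regular_folds n V F" "j \<in> {1..V}"
  shows "F j \<subseteq> {1..n}"
  using assms unfolding regular_folds_def indexed_partition_def by blast

lemma cv_sets_subset:
  assumes "regular_folds n V F" "I \<in> cv_sets n V F"
  shows "I \<subseteq> {1..n}"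
  using assms regular_folds_subset unfolding cv_sets_def by blast

lemma finite_cv_sets: "finite (cv_sets n V F)"
  by (simp add: cv_sets_def)

lemma card_cv_sets: "card (cv_sets n V F) \<le> 2 * V + 1"
proof -
  have "card (F ` {1..V} \<union> (\<lambda>j. {1..n} - F j) ` {1..V}) \<le> V + V"
    by (rule order_trans[OF card_Un_le]) (intro add_mono order_trans[OF card_image_le], auto)
  then show ?thesis
    unfolding cv_sets_def by (intro order_trans[OF card_insert_le_m1]) auto
qed

lemma card_training_set:
  assumes "regular_folds n V F" "j \<in> {1..V}"
  shows "real (card ({1..n} - F j)) = real n - real n / real V"
proof -
  note sub = regular_folds_subset[OF assms]
  have "card (F j) \<le> n" using card_mono[OF _ sub] by simp
  then have "real (card ({1..n} - F j)) = real n - real (card (F j))"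
    using finite_subset[OF sub] sub by (simp add: card_Diff_subset of_nat_diff)
  then show ?thesis using assms by (simp add: regular_folds_def)
qed

lemma half_fold_le: "2 \<le> V \<Longrightarrow> real n / real V \<le> real n / 2"
  by (rule divide_left_mono) auto

lemma sum_folds:
  fixes f :: "nat \<Rightarrow> real"
  assumes "regular_folds n V F"
  shows "(\<Sum>i=1..n. f i) = (\<Sum>j=1..V. \<Sum>i\<in>F j. f i)"
proof -
  have eq: "{1..n} = (\<Union>j\<in>{1..V}. F j)"
    using assms unfolding regular_folds_def indexed_partition_def by simp
  have fin: "finite (F j)" if "j \<in> {1..V}" for j
    using regular_folds_subset[OF assms that] finite_subset by blast
  show ?thesis
    unfolding eq using assms fin unfolding regular_folds_def indexed_partition_def disjoint_family_on_def
    by (intro sum.UNION_disjoint) auto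
qed

section \<open>Deterministic consequences of the typical event\<close>

context localized_regression
begin

text \<open>\<open>\<beta>\<close> stands for the coordinates of the estimator minus the projection.
  After this shift the response is \<open>w\<close>, and the right-hand side of the linear system is
  a centred noise sum.\<close>

definition normal_eqs :: "nat set \<Rightarrow> (nat \<Rightarrow> 'a) \<Rightarrow> (nat \<Rightarrow> real) \<Rightarrow> bool" where
  "normal_eqs I u \<beta> \<longleftrightarrow> (\<forall>k\<in>{1..D}. (\<Sum>i\<in>I. \<phi> k (u i) * (w (u i) - (\<Sum>l=1..D. \<beta> l * \<phi> l (u i)))) = 0)"

lemma sum_gram:
  assumes "finite I" "k \<in> {1..D}"
  shows "(\<Sum>l=1..D. \<beta> l * (\<Sum>i\<in>I. \<phi> k (u i) * \<phi> l (u i))) = real (card I) * \<beta> k + (\<Sum>l=1..D. \<beta> l * gram_dev I u k l)"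
proof -
  have eq: "(\<Sum>i\<in>I. \<phi> k (u i) * \<phi> l (u i)) = gram_dev I u k l + (if k = l then real (card I) else 0)" for l
    unfolding gram_dev_def by (simp add: sum_subtractf)
  have "(\<Sum>l=1..D. \<beta> l * (\<Sum>i\<in>I. \<phi> k (u i) * \<phi> l (u i)))
     = (\<Sum>l=1..D. \<beta> l * gram_dev I u k l) + (\<Sum>l=1..D. if k = l then \<beta> l * real (card I) else 0)"
    unfolding eq distrib_left sum.distrib by (intro arg_cong2[where f=plus] refl sum.cong) simp_all
  then show ?thesis using assms by simp
qed

lemma normal_eqs_iff:
  assumes I: "finite I" and ne: "normal_eqs I u \<beta>" and k: "k \<in> {1..D}"
  shows "noise_sum I u k = real (card I) * \<beta> k + (\<Sum>l=1..D. \<beta> l * gram_dev I u k l)"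
proof -
  have "0 = (\<Sum>i\<in>I. \<phi> k (u i) * (w (u i) - (\<Sum>l=1..D. \<beta> l * \<phi> l (u i))))"
    using ne k by (simp add: normal_eqs_def)
  also have "\<dots> = noise_sum I u k - (\<Sum>i\<in>I. \<Sum>l=1..D. \<beta> l * (\<phi> k (u i) * \<phi> l (u i)))"
    by (simp add: noise_sum_def right_diff_distrib sum_subtractf sum_distrib_left mult_ac)
  also have "(\<Sum>i\<in>I. \<Sum>l=1..D. \<beta> l * (\<phi> k (u i) * \<phi> l (u i))) = (\<Sum>l=1..D. \<beta> l * (\<Sum>i\<in>I. \<phi> k (u i) * \<phi> l (u i)))"
    by (subst sum.swap) (simp add: sum_distrib_left)
  finally show ?thesis using sum_gram[OF I k, of \<beta> u] by simp
qed

text \<open>The left side is the loss on \<open>I\<close> of the estimator with coordinates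
  \<open>\<beta>\<close>, in excess of the loss of the projection. The right side is the expression
  estimated in \<open>held_out_estimate\<close>.\<close>

lemma fold_loss_eq:
  assumes I: "finite I"
  shows "(\<Sum>i\<in>I. (\<Sum>k=1..D. \<beta> k * \<phi> k (u i))\<^sup>2 - 2 * (\<Sum>k=1..D. \<beta> k * \<phi> k (u i)) * w (u i))
    = real (card I) * (L2_set \<beta> {1..D})\<^sup>2 + (\<Sum>k=1..D. \<Sum>l=1..D. \<beta> k * \<beta> l * gram_dev I u k l)
       - 2 * (\<Sum>k=1..D. \<beta> k * noise_sum I u k)"
proof -
  have "(\<Sum>i\<in>I. (\<Sum>k=1..D. \<beta> k * \<phi> k (u i))\<^sup>2) = (\<Sum>i\<in>I. \<Sum>k=1..D. \<beta> k * (\<Sum>l=1..D. \<beta> l * (\<phi> k (u i) * \<phi> l (u i))))"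
    unfolding power2_eq_square sum_product by (simp add: sum_distrib_left mult_ac)
  also have "\<dots> = (\<Sum>k=1..D. \<beta> k * (\<Sum>l=1..D. \<beta> l * (\<Sum>i\<in>I. \<phi> k (u i) * \<phi> l (u i))))"
  proof (subst sum.swap, intro sum.cong refl)
    fix k
    have "(\<Sum>i\<in>I. \<Sum>l=1..D. \<beta> l * (\<phi> k (u i) * \<phi> l (u i))) = (\<Sum>l=1..D. \<beta> l * (\<Sum>i\<in>I. \<phi> k (u i) * \<phi> l (u i)))"
      by (subst sum.swap) (simp add: sum_distrib_left)
    then show "(\<Sum>i\<in>I. \<beta> k * (\<Sum>l=1..D. \<beta> l * (\<phi> k (u i) * \<phi> l (u i)))) = \<beta> k * (\<Sum>l=1..D. \<beta> l * (\<Sum>i\<in>I. \<phi> k (u i) * \<phi> l (u i)))"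
      by (simp only: sum_distrib_left[symmetric])
  qed
  also have "\<dots> = (\<Sum>k=1..D. \<beta> k * (real (card I) * \<beta> k + (\<Sum>l=1..D. \<beta> l * gram_dev I u k l)))"
    by (intro sum.cong refl) (simp only: sum_gram[OF I])
  also have "\<dots> = real (card I) * (L2_set \<beta> {1..D})\<^sup>2 + (\<Sum>k=1..D. \<Sum>l=1..D. \<beta> k * \<beta> l * gram_dev I u k l)"
    unfolding L2_set_square by (simp add: distrib_left sum.distrib sum_distrib_left power2_eq_square mult_ac)
  finally have 1: "(\<Sum>i\<in>I. (\<Sum>k=1..D. \<beta> k * \<phi> k (u i))\<^sup>2) = real (card I) * (L2_set \<beta> {1..D})\<^sup>2 + (\<Sum>k=1..D. \<Sum>l=1..D. \<beta> k * \<beta> l * gram_dev I u k l)" .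
  have 2: "(\<Sum>i\<in>I. (\<Sum>k=1..D. \<beta> k * \<phi> k (u i)) * w (u i)) = (\<Sum>k=1..D. \<beta> k * noise_sum I u k)"
    unfolding noise_sum_def sum_distrib_right sum_distrib_left by (subst sum.swap) (simp add: mult_ac)
  show ?thesis
    unfolding sum_subtractf 1 mult.assoc sum_distrib_left[symmetric] 2 by simp
qed

definition dev_const :: "real \<Rightarrow> real" where
  "dev_const K = (norm_const K + gram_const K * B\<^sup>2) * (1 + 1 / s)"

text \<open>The first constant pays for the loss gaps. The second adds the errors of at most
  \<open>R\<close> folds, each \<open>36 * dev_const K\<close> times the sample size.\<close>

definition cv_const :: "real \<Rightarrow> real \<Rightarrow> real" where
  "cv_const K R = bias_const K + 36 * R * dev_const K"

lemma norm_const_pos: "0 < K \<Longrightarrow> 0 < norm_const K"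
  using energy_bound_pos coord_const_pos[of K] constants_pos
  by (simp add: norm_const_def cross_const_def add_pos_pos)

lemma cv_const_nonneg:
  assumes "0 < K" "0 \<le> R"
  shows "0 \<le> cv_const K R"
  using norm_const_pos[OF assms(1)] gram_const_pos[OF assms(1)] constants_pos H_pos assms
  by (auto simp: cv_const_def dev_const_def bias_const_def intro!: add_nonneg_nonneg mult_nonneg_nonneg)

lemma rel_error_mono: "t \<le> t' \<Longrightarrow> rel_error t \<le> rel_error t'"
  using ln_ge by (simp add: rel_error_def divide_right_mono)

lemma rel_error_nonneg: "0 \<le> t \<Longrightarrow> 0 \<le> rel_error t"
  using ln_ge by (simp add: rel_error_def)

lemma energy_nonneg: "0 \<le> noise_energy"
  using noise_energy_ge constants_pos by (smt (verit) mult_nonneg_nonneg of_nat_0_le_iff)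

text \<open>This is where errors proportional to \<open>D\<close> become relative. The noise level
  gives \<open>D \<le> noise_energy / s\<close>, and \<open>noise_energy\<close> is at most
  \<open>n\<close> times \<open>noise_energy / \<tau>\<close>, the variance part of the risk; the
  factor \<open>1 + 1 / s\<close> also covers the absolute part.\<close>

lemma deviation_le:
  assumes K: "0 < K" and \<tau>: "0 < \<tau>" "\<tau> \<le> real n"
  defines "E \<equiv> norm_const K * (real n * (real D / sqrt (ln (real n)) + ln (real n) ^ 3))"
    and "e \<equiv> gram_const K * real n / sqrt (ln (real n))"
  shows "E + e * noise_energy \<le> dev_const K * (real n)\<^sup>2 * rel_error (noise_energy / \<tau>)"
proof -
  define L where "L = ln (real n)"
  have L: "1 \<le> L" using ln_ge by (simp add: L_def)
  define X where "X = real D / sqrt L + L ^ 3"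
  have "e * noise_energy \<le> e * (B\<^sup>2 * real D)"
    using gram_const_pos[OF K] ln_ge by (intro mult_left_mono noise_energy_le) (auto simp: e_def)
  also have "\<dots> = gram_const K * B\<^sup>2 * (real n * (real D / sqrt L))" by (simp add: e_def L_def)
  also have "\<dots> \<le> gram_const K * B\<^sup>2 * (real n * X)"
    using gram_const_pos[OF K] L by (intro mult_left_mono) (auto simp: X_def)
  finally have 1: "E + e * noise_energy \<le> (norm_const K + gram_const K * B\<^sup>2) * (real n * X)"
    by (simp add: E_def X_def L_def algebra_simps)
  have 2: "real n * X \<le> (1 + 1 / s) * ((real n)\<^sup>2 * rel_error (noise_energy / \<tau>))"
  proof -
    have "real D \<le> noise_energy / s" using noise_energy_ge constants_pos by (simp add: field_simps)
    also have "\<dots> \<le> 1 / s * (real n * (noise_energy / \<tau>))"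
    proof -
      have "1 * noise_energy \<le> real n / \<tau> * noise_energy"
        using \<tau> energy_nonneg by (intro mult_right_mono) (auto simp: field_simps)
      then show ?thesis using constants_pos by (simp add: field_simps)
    qed
    also have "\<dots> \<le> (1 + 1 / s) * (real n * (noise_energy / \<tau>))"
      using constants_pos \<tau> energy_nonneg by (intro mult_right_mono) auto
    finally have "real D / sqrt L \<le> (1 + 1 / s) * (real n * (noise_energy / \<tau>)) / sqrt L"
      using L by (intro divide_right_mono) auto
    moreover have "1 * L ^ 3 \<le> (1 + 1 / s) * L ^ 3"
      using constants_pos L by (intro mult_right_mono) auto
    ultimately have "X \<le> (1 + 1 / s) * (real n * (noise_energy / \<tau>) / sqrt L + L ^ 3)"
      unfolding X_def distrib_left[of "1 + 1 / s"] by (simp only: times_divide_eq_right mult_1_left add_mono)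
    also have "real n * (noise_energy / \<tau>) / sqrt L + L ^ 3 = real n * rel_error (noise_energy / \<tau>)"
      using n_pos by (simp add: rel_error_def L_def algebra_simps)
    finally have "real n * X \<le> real n * ((1 + 1 / s) * (real n * rel_error (noise_energy / \<tau>)))"
      by (intro mult_left_mono) auto
    then show ?thesis by (simp add: power2_eq_square mult_ac)
  qed
  have "(norm_const K + gram_const K * B\<^sup>2) * (real n * X) \<le>
     (norm_const K + gram_const K * B\<^sup>2) * ((1 + 1 / s) * ((real n)\<^sup>2 * rel_error (noise_energy / \<tau>)))"
    using norm_const_pos[OF K] gram_const_pos[OF K] by (intro mult_left_mono 2) auto
  then show ?thesis using 1 by (simp add: dev_const_def mult_ac)
qed

text \<open>The condition \<open>small\<close> puts the Gram deviation below n / 4, hence below half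
  the size of \<open>I\<close>, as the perturbation lemma requires. The constant is 10, for that
  lemma, times 4, because n^2 is at most 4 times the squared size of \<open>I\<close>.\<close>

lemma estimation_error:
  assumes K: "0 < K" and tp: "typical K \<J> u" and I: "I \<in> \<J>" "I \<subseteq> {1..n}"
    and half: "real n / 2 \<le> real (card I)" and small: "gram_const K / sqrt (ln (real n)) \<le> 1 / 4"
    and ne: "normal_eqs I u \<beta>"
  shows "\<bar>(\<Sum>k=1..D. (\<beta> k)\<^sup>2) - noise_energy / real (card I)\<bar> \<le> 40 * dev_const K * rel_error (noise_energy / real (card I))"
proof -
  let ?\<tau> = "real (card I)"
  define E where "E = norm_const K * (real n * (real D / sqrt (ln (real n)) + ln (real n) ^ 3))"
  define e where "e = gram_const K * real n / sqrt (ln (real n))"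
  have fin: "finite I" using I(2) finite_subset by blast
  have \<tau>: "0 < ?\<tau>" using half n_pos by linarith
  have "card I \<le> card {1..n}" using I(2) by (intro card_mono) auto
  then have \<tau>n: "?\<tau> \<le> real n" by simp
  have e0: "0 \<le> e" using gram_const_pos[OF K] ln_ge by (simp add: e_def)
  have "e \<le> real n / 4" using mult_right_mono[OF small, of "real n"] by (simp add: e_def)
  then have e: "e \<le> ?\<tau> / 2" using half by linarith
  have E0: "0 \<le> E" using norm_const_pos[OF K] ln_ge by (simp add: E_def)
  have "\<bar>?\<tau>\<^sup>2 * (L2_set \<beta> {1..D})\<^sup>2 - ?\<tau> * noise_energy\<bar> \<le> 6 * E + 10 * e * noise_energy"
    by (rule normal_equations_perturbation(3)[OF _ e0 e \<tau> energy_nonneg normal_eqs_iff[OF fin ne]])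
      (use tp I in \<open>auto simp: typical_def e_def E_def\<close>)
  also have "\<dots> \<le> 10 * (E + e * noise_energy)" using E0 by simp
  also have "\<dots> \<le> 10 * (dev_const K * (real n)\<^sup>2 * rel_error (noise_energy / ?\<tau>))"
    unfolding E_def e_def using deviation_le[OF K \<tau> \<tau>n] by simp
  finally have 1: "\<bar>?\<tau>\<^sup>2 * (L2_set \<beta> {1..D})\<^sup>2 - ?\<tau> * noise_energy\<bar> \<le> 10 * (dev_const K * (real n)\<^sup>2 * rel_error (noise_energy / ?\<tau>))" .
  define Z where "Z = dev_const K * rel_error (noise_energy / ?\<tau>)"
  have "(real n)\<^sup>2 \<le> (2 * ?\<tau>)\<^sup>2" using half by (intro power_mono) auto
  then have n\<tau>: "(real n)\<^sup>2 \<le> 4 * ?\<tau>\<^sup>2" by (simp add: power_mult_distrib)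
  have Z0: "0 \<le> Z"
    using norm_const_pos[OF K] gram_const_pos[OF K] constants_pos energy_nonneg \<tau>
    by (auto simp: Z_def dev_const_def intro!: mult_nonneg_nonneg rel_error_nonneg divide_nonneg_nonneg add_nonneg_nonneg)
  have "?\<tau>\<^sup>2 * \<bar>(L2_set \<beta> {1..D})\<^sup>2 - noise_energy / ?\<tau>\<bar> = \<bar>?\<tau>\<^sup>2 * (L2_set \<beta> {1..D})\<^sup>2 - ?\<tau> * noise_energy\<bar>"
  proof -
    have "?\<tau>\<^sup>2 * (L2_set \<beta> {1..D})\<^sup>2 - ?\<tau> * noise_energy = ?\<tau>\<^sup>2 * ((L2_set \<beta> {1..D})\<^sup>2 - noise_energy / ?\<tau>)"
      using \<tau> by (simp add: field_simps power2_eq_square)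
    then show ?thesis by (simp add: abs_mult)
  qed
  also have "\<dots> \<le> 10 * Z * (real n)\<^sup>2" using 1 by (simp add: Z_def mult_ac)
  also have "\<dots> \<le> 10 * Z * (4 * ?\<tau>\<^sup>2)" using n\<tau> Z0 by (intro mult_left_mono) auto
  finally have "?\<tau>\<^sup>2 * \<bar>(L2_set \<beta> {1..D})\<^sup>2 - noise_energy / ?\<tau>\<bar> \<le> ?\<tau>\<^sup>2 * (40 * Z)" by (simp add: mult_ac)
  then show ?thesis using \<tau> unfolding L2_set_square Z_def by simp
qed

text \<open>Training set, fold and whole sample are all covered by the typical event, so
  \<open>held_out_estimate\<close> applies; 36 is 18 times 2, from \<open>\<tau>\<close> being at
  least n / 2. The error is proportional to \<open>n\<close>, although the fold contains only n / V
  observations.\<close>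

lemma fold_estimate:
  assumes K: "0 < K" and folds: "regular_folds n V F" "2 \<le> V" and j: "j \<in> {1..V}"
    and tp: "typical K (cv_sets n V F) u"
    and small: "gram_const K / sqrt (ln (real n)) \<le> 1 / 4"
    and ne: "normal_eqs ({1..n} - F j) u \<beta>"
  defines "\<tau> \<equiv> real n - real n / real V"
  shows "\<bar>(\<Sum>i\<in>F j. (\<Sum>k=1..D. \<beta> k * \<phi> k (u i))\<^sup>2 - 2 * (\<Sum>k=1..D. \<beta> k * \<phi> k (u i)) * w (u i))
     - real (card (F j)) * noise_energy / \<tau>\<bar> \<le> 36 * dev_const K * real n * rel_error (noise_energy / \<tau>)"
proof -
  define E where "E = norm_const K * (real n * (real D / sqrt (ln (real n)) + ln (real n) ^ 3))"
  define e where "e = gram_const K * real n / sqrt (ln (real n))"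
  let ?T = "{1..n} - F j"
  note sub = regular_folds_subset[OF folds(1) j]
  have fin: "finite (F j)" using sub finite_subset by blast
  have cF: "real (card (F j)) = real n / real V" using folds(1) j by (simp add: regular_folds_def)
  have cT: "real (card ?T) = \<tau>"
    using card_training_set[OF folds(1) j] by (simp add: \<tau>_def)
  have Vn: "real n / real V \<le> real n / 2" using folds(2) by (rule half_fold_le)
  have half: "real n / 2 \<le> \<tau>" using Vn by (simp add: \<tau>_def)
  have \<tau>: "0 < \<tau>" using half n_pos by linarith
  have \<tau>n: "\<tau> \<le> real n" by (simp add: \<tau>_def)
  have e0: "0 \<le> e" using gram_const_pos[OF K] ln_ge by (simp add: e_def)
  have "e \<le> real n / 4" using mult_right_mono[OF small, of "real n"] by (simp add: e_def)
  then have e: "e \<le> \<tau> / 2" using half by linarith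
  have E0: "0 \<le> E" using norm_const_pos[OF K] ln_ge by (simp add: E_def)
  have mem: "?T \<in> cv_sets n V F" "F j \<in> cv_sets n V F" "{1..n} \<in> cv_sets n V F"
    using j by (auto simp: cv_sets_def)
  have split: "noise_sum {1..n} u k = noise_sum ?T u k + noise_sum (F j) u k" for k
    unfolding noise_sum_def using sum.subset_diff[OF sub, of "\<lambda>i. \<phi> k (u i) * w (u i)"] by simp
  have gram: "\<bar>\<Sum>k=1..D. \<Sum>l=1..D. x k * y l * gram_dev I u k l\<bar> \<le> e * L2_set x {1..D} * L2_set y {1..D}"
    and norm: "\<bar>(L2_set (noise_sum I u) {1..D})\<^sup>2 - real (card I) * noise_energy\<bar> \<le> E"
    if "I \<in> cv_sets n V F" for I x y
    using tp that by (auto simp: typical_def e_def E_def)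
  have "\<bar>real (card (F j)) * (L2_set \<beta> {1..D})\<^sup>2 + (\<Sum>k=1..D. \<Sum>l=1..D. \<beta> k * \<beta> l * gram_dev (F j) u k l)
      - 2 * (\<Sum>k=1..D. \<beta> k * noise_sum (F j) u k) - real (card (F j)) * noise_energy / \<tau>\<bar>
    \<le> (13 * E + 18 * e * noise_energy) / \<tau>"
  proof (rule held_out_estimate[OF gram[OF mem(1)] gram[OF mem(2)] e0 e \<tau>])
    show "noise_sum ?T u k = \<tau> * \<beta> k + (\<Sum>l=1..D. \<beta> l * gram_dev ?T u k l)" if "k \<in> {1..D}" for k
      using normal_eqs_iff[OF _ ne that] cT by simp
    show "\<bar>(L2_set (noise_sum ?T u) {1..D})\<^sup>2 - \<tau> * noise_energy\<bar> \<le> E"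
      using norm[OF mem(1)] cT by simp
    show "\<bar>(L2_set (noise_sum (F j) u) {1..D})\<^sup>2 - real (card (F j)) * noise_energy\<bar> \<le> E"
      by (rule norm[OF mem(2)])
    have "\<tau> + real (card (F j)) = real (card {1..n})" by (simp add: \<tau>_def cF)
    then show "\<bar>(L2_set (\<lambda>k. noise_sum ?T u k + noise_sum (F j) u k) {1..D})\<^sup>2 - (\<tau> + real (card (F j))) * noise_energy\<bar> \<le> E"
      using norm[OF mem(3)] unfolding split[symmetric] by simp
    show "real (card (F j)) \<le> \<tau>" using cF Vn half by linarith
  qed (use energy_nonneg in auto)
  also have "\<dots> \<le> 18 * (E + e * noise_energy) / \<tau>"
    using E0 \<tau> by (intro divide_right_mono) auto
  also have "\<dots> \<le> 18 * (E + e * noise_energy) / (real n / 2)"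
    using half n_pos E0 e0 energy_nonneg \<tau> by (intro divide_left_mono) auto
  also have "\<dots> \<le> 18 * (dev_const K * (real n)\<^sup>2 * rel_error (noise_energy / \<tau>)) / (real n / 2)"
    using deviation_le[OF K \<tau> \<tau>n] unfolding E_def e_def by (intro divide_right_mono mult_left_mono) auto
  also have "\<dots> = 36 * dev_const K * real n * rel_error (noise_energy / \<tau>)"
    using n_pos by (simp add: power2_eq_square)
  finally show ?thesis unfolding fold_loss_eq[OF fin] .
qed

text \<open>The deterministic centre \<open>t\<close> is the approximation error plus the expected
  estimation error on a training set. The full sample satisfies only an upper bound, because its
  variance part \<open>noise_energy / n\<close> is smaller.\<close>

lemma cv_comparison:
  assumes K: "0 < K" and folds: "regular_folds n V F" "2 \<le> V" "real V \<le> R"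
    and tp: "typical K (cv_sets n V F) u"
    and small: "gram_const K / sqrt (ln (real n)) \<le> 1 / 4"
  defines "t \<equiv> bias + noise_energy / (real n - real n / real V)"
  shows "normal_eqs {1..n} u \<beta> \<Longrightarrow> bias + (\<Sum>k=1..D. (\<beta> k)\<^sup>2) \<le> t + cv_const K R * rel_error t"
    and "j \<in> {1..V} \<Longrightarrow> normal_eqs ({1..n} - F j) u \<beta> \<Longrightarrow> t - cv_const K R * rel_error t \<le> bias + (\<Sum>k=1..D. (\<beta> k)\<^sup>2)"
    and "(\<And>j. j \<in> {1..V} \<Longrightarrow> normal_eqs ({1..n} - F j) u (\<gamma> j)) \<Longrightarrow>
      \<bar>((\<Sum>i=1..n. h (u i)) + (\<Sum>j=1..V. \<Sum>i\<in>F j. (\<Sum>k=1..D. \<gamma> j k * \<phi> k (u i))\<^sup>2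
         - 2 * (\<Sum>k=1..D. \<gamma> j k * \<phi> k (u i)) * w (u i))) / real n - t\<bar> \<le> cv_const K R * rel_error t"
proof -
  define \<tau> where "\<tau> = real n - real n / real V"
  have Vn: "real n / real V \<le> real n / 2" "0 \<le> real n / real V" using half_fold_le[OF folds(2)] by auto
  have half: "real n / 2 \<le> \<tau>" using Vn by (simp add: \<tau>_def)
  have \<tau>: "0 < \<tau>" "\<tau> \<le> real n" using half n_pos Vn \<tau>_def by linarith+
  define \<kappa> where "\<kappa> = noise_energy / \<tau>"
  have \<kappa>: "0 \<le> \<kappa>" using \<tau> energy_nonneg by (simp add: \<kappa>_def)
  have t: "t = bias + \<kappa>" by (simp add: t_def \<kappa>_def \<tau>_def)
  have d0: "0 \<le> dev_const K"
    using norm_const_pos[OF K] gram_const_pos[OF K] constants_pos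
    by (auto simp: dev_const_def intro!: mult_nonneg_nonneg add_nonneg_nonneg)
  have b0: "0 \<le> bias_const K" using K H_pos by (simp add: bias_const_def)
  have rt: "0 \<le> rel_error t" using t \<kappa> bias_nonneg by (intro rel_error_nonneg) simp
  have R: "2 \<le> R" using folds by linarith
  \<comment> \<open>One constant serves all three bounds, since \<open>R\<close> is at least
    2.\<close>
  have "40 * dev_const K \<le> 36 * R * dev_const K" using R d0 by (intro mult_right_mono) auto
  then have "40 * dev_const K \<le> cv_const K R" using b0 by (simp add: cv_const_def)
  then have c40: "40 * dev_const K * rel_error x \<le> cv_const K R * rel_error t" if "0 \<le> x" "x \<le> t" for x
    using that d0 rt by (intro mult_mono rel_error_mono rel_error_nonneg) auto
  have V1: "1 \<in> {1..V}" using folds by auto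
  {
    assume ne: "normal_eqs {1..n} u \<beta>"
    have "\<bar>(\<Sum>k=1..D. (\<beta> k)\<^sup>2) - noise_energy / real (card {1..n})\<bar> \<le> 40 * dev_const K * rel_error (noise_energy / real (card {1..n}))"
      by (rule estimation_error[OF K tp _ _ _ small ne]) (auto simp: cv_sets_def)
    moreover have "noise_energy / real n \<le> \<kappa>"
      unfolding \<kappa>_def using \<tau> energy_nonneg by (intro divide_left_mono) auto
    moreover have "0 \<le> noise_energy / real n" using energy_nonneg by simp
    ultimately show "bias + (\<Sum>k=1..D. (\<beta> k)\<^sup>2) \<le> t + cv_const K R * rel_error t"
      using c40[of "noise_energy / real n"] bias_nonneg unfolding t by (simp add: abs_le_iff)
  next
    assume j: "j \<in> {1..V}" and ne: "normal_eqs ({1..n} - F j) u \<beta>"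
    have cT: "real (card ({1..n} - F j)) = \<tau>"
      using card_training_set[OF folds(1) j] by (simp add: \<tau>_def)
    have "\<bar>(\<Sum>k=1..D. (\<beta> k)\<^sup>2) - noise_energy / real (card ({1..n} - F j))\<bar> \<le> 40 * dev_const K * rel_error (noise_energy / real (card ({1..n} - F j)))"
      by (rule estimation_error[OF K tp _ _ _ small ne]) (use j half cT in \<open>auto simp: cv_sets_def\<close>)
    then show "t - cv_const K R * rel_error t \<le> bias + (\<Sum>k=1..D. (\<beta> k)\<^sup>2)"
      using c40[of \<kappa>] bias_nonneg \<kappa> unfolding cT \<kappa>_def[symmetric] t by (simp add: abs_le_iff)
  next
    assume ne: "\<And>j. j \<in> {1..V} \<Longrightarrow> normal_eqs ({1..n} - F j) u (\<gamma> j)"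
    define Q where "Q = (\<lambda>j. \<Sum>i\<in>F j. (\<Sum>k=1..D. \<gamma> j k * \<phi> k (u i))\<^sup>2 - 2 * (\<Sum>k=1..D. \<gamma> j k * \<phi> k (u i)) * w (u i))"
    have Q: "\<bar>Q j - real n / real V * \<kappa>\<bar> \<le> 36 * dev_const K * real n * rel_error \<kappa>" if j: "j \<in> {1..V}" for j
      using fold_estimate[OF K folds(1,2) j tp small ne[OF j]] folds(1) j
      unfolding Q_def \<kappa>_def \<tau>_def regular_folds_def by simp
    have "(\<Sum>j=1..V. Q j) - real n * \<kappa> = (\<Sum>j=1..V. Q j - real n / real V * \<kappa>)"
      using folds(2) by (simp add: sum_subtractf)
    also have "\<bar>\<dots>\<bar> \<le> (\<Sum>j=1..V. 36 * dev_const K * real n * rel_error \<kappa>)"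
      by (rule order_trans[OF sum_abs]) (intro sum_mono Q)
    also have "\<dots> = real V * (36 * dev_const K * real n * rel_error \<kappa>)" by simp
    \<comment> \<open>The bound on the number of folds is spent here: errors of order
      \<open>n\<close>, one per fold, are added up.\<close>
    also have "\<dots> \<le> R * (36 * dev_const K * real n * rel_error \<kappa>)"
      using folds d0 rel_error_nonneg[OF \<kappa>] by (intro mult_right_mono) auto
    also have "\<dots> \<le> R * (36 * dev_const K * real n * rel_error t)"
      using R d0 t bias_nonneg by (intro mult_left_mono rel_error_mono) auto
    finally have 1: "\<bar>(\<Sum>j=1..V. Q j) - real n * \<kappa>\<bar> \<le> real n * (36 * R * dev_const K * rel_error t)"
      by (simp add: mult_ac)
    have "\<bar>(\<Sum>i=1..n. h (u i)) - real n * bias\<bar>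
       \<le> bias_const K * (real n * (bias / sqrt (ln (real n))) + ln (real n) ^ 3)"
      using tp by (simp add: typical_def)
    also have "real n * (bias / sqrt (ln (real n))) + ln (real n) ^ 3 = real n * rel_error bias"
      using n_pos by (simp add: rel_error_def distrib_left)
    also have "bias_const K * (real n * rel_error bias) \<le> bias_const K * (real n * rel_error t)"
      using b0 t \<kappa> by (intro mult_left_mono rel_error_mono) auto
    finally have 2: "\<bar>(\<Sum>i=1..n. h (u i)) - real n * bias\<bar> \<le> real n * (bias_const K * rel_error t)"
      by (simp add: mult_ac)
    let ?X = "(\<Sum>i=1..n. h (u i)) + (\<Sum>j=1..V. Q j)"
    have "\<bar>?X - real n * t\<bar> \<le> real n * (cv_const K R * rel_error t)"
      using 1 2 unfolding t cv_const_def distrib_left distrib_right by linarith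
    moreover have "?X / real n - t = (?X - real n * t) / real n" using n_pos by (simp add: field_simps)
    ultimately have "\<bar>?X / real n - t\<bar> \<le> cv_const K R * rel_error t"
      using n_pos by (simp add: abs_divide field_simps)
    then show "\<bar>((\<Sum>i=1..n. h (u i)) + (\<Sum>j=1..V. \<Sum>i\<in>F j. (\<Sum>k=1..D. \<gamma> j k * \<phi> k (u i))\<^sup>2
         - 2 * (\<Sum>k=1..D. \<gamma> j k * \<phi> k (u i)) * w (u i))) / real n - t\<bar> \<le> cv_const K R * rel_error t"
      by (simp add: Q_def)
  }
qed

end

section \<open>Least squares and the regression model\<close>

lemma sum_fun_apply: "(\<Sum>i\<in>I. f i) x = (\<Sum>i\<in>I. f i x)" for f :: "'a \<Rightarrow> 'b \<Rightarrow> 'c::comm_monoid_add"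
  by (induction I rule: infinite_finite_induct) auto

lemma span_image_combination:
  fixes \<phi> :: "'a \<Rightarrow> 'b \<Rightarrow> real"
  assumes "finite I" "f \<in> span (\<phi> ` I)"
  shows "\<exists>c. \<forall>x. f x = (\<Sum>k\<in>I. c k * \<phi> k x)"
  using assms(2)
proof (induction rule: span_induct)
  case base
  show ?case
  proof (rule subspaceI)
    show "0 \<in> {f. \<exists>c. \<forall>x. f x = (\<Sum>k\<in>I. c k * \<phi> k x)}"
      by (auto intro!: exI[of _ "\<lambda>_. 0"])
    fix f g :: "'b \<Rightarrow> real"
    assume "f \<in> {f. \<exists>c. \<forall>x. f x = (\<Sum>k\<in>I. c k * \<phi> k x)}" "g \<in> {f. \<exists>c. \<forall>x. f x = (\<Sum>k\<in>I. c k * \<phi> k x)}"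
    then obtain c c' where "\<forall>x. f x = (\<Sum>k\<in>I. c k * \<phi> k x)" "\<forall>x. g x = (\<Sum>k\<in>I. c' k * \<phi> k x)" by auto
    then show "f + g \<in> {f. \<exists>c. \<forall>x. f x = (\<Sum>k\<in>I. c k * \<phi> k x)}"
      by (auto intro!: exI[of _ "\<lambda>k. c k + c' k"] simp: sum.distrib distrib_right)
  next
    fix a and f :: "'b \<Rightarrow> real"
    assume "f \<in> {f. \<exists>c. \<forall>x. f x = (\<Sum>k\<in>I. c k * \<phi> k x)}"
    then obtain c where "\<forall>x. f x = (\<Sum>k\<in>I. c k * \<phi> k x)" by auto
    then show "a *\<^sub>R f \<in> {f. \<exists>c. \<forall>x. f x = (\<Sum>k\<in>I. c k * \<phi> k x)}"
      by (auto intro!: exI[of _ "\<lambda>k. a * c k"] simp: scaleR_fun_def sum_distrib_left mult.assoc)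
  qed
next
  case (step f)
  then obtain j where "j \<in> I" "f = \<phi> j" by blast
  then show ?case
    using assms(1) by (intro exI[of _ "\<lambda>k. if k = j then 1 else 0"]) (simp add: if_distrib[of "\<lambda>c. c * _"] cong: if_cong)
qed

text \<open>Tested at \<open>c = a / (b + 1)\<close>; the shifted denominator covers
  \<open>b = 0\<close>.\<close>

lemma quadratic_nonneg_imp_linear_0:
  fixes a b :: real
  assumes "\<And>c. 2 * c * a \<le> c\<^sup>2 * b" "0 \<le> b"
  shows "a = 0"
proof (rule ccontr)
  assume a: "a \<noteq> 0"
  have "2 * (a / (b + 1)) * a \<le> (a / (b + 1))\<^sup>2 * b" by (rule assms(1))
  then have "(2 * a\<^sup>2) / (b + 1) \<le> (a\<^sup>2 * b) / (b + 1)\<^sup>2"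
    by (simp add: power2_eq_square mult_ac)
  also have "\<dots> = (a\<^sup>2 * (b / (b + 1))) / (b + 1)" using assms(2) by (simp add: power2_eq_square)
  finally have "2 * a\<^sup>2 \<le> a\<^sup>2 * (b / (b + 1))"
    unfolding divide_le_cancel using assms(2) by linarith
  also have "\<dots> \<le> a\<^sup>2 * 1" using assms(2) by (intro mult_left_mono) auto
  finally show False using a by simp
qed

text \<open>First-order condition: along the line from \<open>f\<close> in direction
  \<open>g\<close> the empirical risk is a quadratic polynomial with its minimum at 0. The argument
  applies to every minimizer, also when there are several.\<close>

lemma least_squares_normal_equation:
  assumes I: "finite I" "I \<noteq> {}" and ls: "least_squares I u m f"
    and m: "subspace m" and g: "g \<in> m"
  shows "(\<Sum>i\<in>I. g (fst (u i)) * (snd (u i) - f (fst (u i)))) = 0"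
proof (rule quadratic_nonneg_imp_linear_0)
  show "0 \<le> (\<Sum>i\<in>I. (g (fst (u i)))\<^sup>2)" by (intro sum_nonneg) auto
  fix c
  have f: "f \<in> m" and min: "\<And>t. t \<in> m \<Longrightarrow> empirical I u (contrast f) \<le> empirical I u (contrast t)"
    using ls unfolding least_squares_def is_arg_min_linorder by auto
  have "f + c *\<^sub>R g \<in> m" using m f g by (intro subspace_add subspace_scale)
  from min[OF this] have "(\<Sum>i\<in>I. contrast f (u i)) \<le> (\<Sum>i\<in>I. contrast (f + c *\<^sub>R g) (u i))"
    using I by (simp add: empirical_def divide_le_cancel card_gt_0_iff)
  also have "\<dots> = (\<Sum>i\<in>I. contrast f (u i) - 2 * c * (g (fst (u i)) * (snd (u i) - f (fst (u i)))) + c\<^sup>2 * (g (fst (u i)))\<^sup>2)"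
    by (intro sum.cong refl) (simp add: contrast_def scaleR_fun_def power2_eq_square algebra_simps split: prod.split)
  also have "\<dots> = (\<Sum>i\<in>I. contrast f (u i)) - 2 * c * (\<Sum>i\<in>I. g (fst (u i)) * (snd (u i) - f (fst (u i)))) + c\<^sup>2 * (\<Sum>i\<in>I. (g (fst (u i)))\<^sup>2)"
    by (simp add: sum.distrib sum_subtractf sum_distrib_left)
  finally show "2 * c * (\<Sum>i\<in>I. g (fst (u i)) * (snd (u i) - f (fst (u i)))) \<le> c\<^sup>2 * (\<Sum>i\<in>I. (g (fst (u i)))\<^sup>2)"
    by simp
qed

text \<open>The cross term vanishes by centring and the square integrates by Parseval. As the
  integral is over a fresh observation, \<open>\<beta>\<close> may be taken from the sample.\<close>

lemma (in localized_regression) excess_integral: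
  "(\<integral>z. h z + ((\<Sum>k=1..D. \<beta> k * \<phi> k z)\<^sup>2 - 2 * (\<Sum>k=1..D. \<beta> k * \<phi> k z) * w z) \<partial>M) = bias + (\<Sum>k=1..D. (\<beta> k)\<^sup>2)"
proof -
  have h: "integrable M h" by (rule integrable_const_bound[of _ H]) (use bias_bound in auto)
  have eq: "2 * (\<Sum>k=1..D. \<beta> k * \<phi> k z) * w z = (\<Sum>k=1..D. 2 * \<beta> k * (\<phi> k z * w z))" for z
    by (simp add: sum_distrib_left sum_distrib_right mult_ac)
  have int: "integrable M (\<lambda>z. 2 * \<beta> k * (\<phi> k z * w z))" if "k \<in> {1..D}" for k
    using integrable_basis_noise[OF that] by simp
  have cross: "(\<integral>z. (\<Sum>k=1..D. 2 * \<beta> k * (\<phi> k z * w z)) \<partial>M) = 0"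
  proof -
    have "(\<integral>z. (\<Sum>k=1..D. 2 * \<beta> k * (\<phi> k z * w z)) \<partial>M) = (\<Sum>k=1..D. \<integral>z. 2 * \<beta> k * (\<phi> k z * w z) \<partial>M)"
      by (rule Bochner_Integration.integral_sum[OF int])
    also have "\<dots> = 0" using noise_centered by (intro sum.neutral) auto
    finally show ?thesis .
  qed
  have ints: "integrable M (\<lambda>z. \<Sum>k=1..D. 2 * \<beta> k * (\<phi> k z * w z))"
    by (rule Bochner_Integration.integrable_sum[OF int])
  have "(\<integral>z. h z + ((\<Sum>k=1..D. \<beta> k * \<phi> k z)\<^sup>2 - (\<Sum>k=1..D. 2 * \<beta> k * (\<phi> k z * w z))) \<partial>M)
    = (\<integral>z. h z \<partial>M) + ((\<integral>z. (\<Sum>k=1..D. \<beta> k * \<phi> k z)\<^sup>2 \<partial>M) - (\<integral>z. (\<Sum>k=1..D. 2 * \<beta> k * (\<phi> k z * w z)) \<partial>M))"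
    using h basis_combination(1)[of \<beta>] ints by simp
  then show ?thesis unfolding eq cross basis_combination(2) bias_mean by simp
qed

section \<open>Moments of the residual in the bounded regression model\<close>

locale bounded_regression =
  fixes d :: nat and \<X> :: "point set" and P :: "observation measure" and s_star \<sigma> :: "point \<Rightarrow> real"
    and A \<sigma>m :: real and Q :: "point measure"
  assumes model: "regression_model d \<X> P s_star \<sigma>" and Q: "Q = lawX d \<X> P"
    and noise_level: "An \<sigma>m Q \<sigma>" and response_bound: "AE z in P. \<bar>snd z\<bar> \<le> A"
    and A_pos: "0 < A" and \<sigma>m_pos: "0 < \<sigma>m"
begin

sublocale prob_space P
  using model unfolding regression_model_def law_on_def by blast

lemma sets_P: "sets P = sets (restrict_space (euclid d) \<X> \<Otimes>\<^sub>M borel)"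
  and X_subset: "\<X> \<subseteq> space (euclid d)"
  using model unfolding regression_model_def law_on_def by auto

lemma space_restrict: "space (restrict_space (euclid d) \<X>) = \<X>"
  using X_subset by (auto simp: space_restrict_space)

lemma space_P: "space P = \<X> \<times> UNIV"
  using sets_eq_imp_space_eq[OF sets_P] by (simp add: space_pair_measure space_restrict)

lemma fst_measurable: "fst \<in> measurable P (restrict_space (euclid d) \<X>)"
  by (subst measurable_cong_sets[OF sets_P refl]) simp

lemma snd_measurable [measurable]: "snd \<in> borel_measurable P"
  by (subst measurable_cong_sets[OF sets_P refl]) simp

lemma sets_Q: "sets Q = sets (restrict_space (euclid d) \<X>)"
  by (simp add: Q lawX_def)

lemma space_Q: "space Q = \<X>"
  by (simp add: Q lawX_def space_restrict)

lemma measurable_Q_iff: "f \<in> borel_measurable Q \<longleftrightarrow> f \<in> borel_measurable (restrict_space (euclid d) \<X>)"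
  by (rule arg_cong[where f="\<lambda>S. f \<in> S"], rule measurable_cong_sets[OF sets_Q refl])

lemma lift_measurable: "f \<in> borel_measurable Q \<Longrightarrow> (\<lambda>z. f (fst z)) \<in> borel_measurable P" for f :: "point \<Rightarrow> real"
  unfolding measurable_Q_iff by (rule measurable_compose[OF fst_measurable])

lemma lift_integral: "f \<in> borel_measurable Q \<Longrightarrow> (\<integral>x. f x \<partial>Q) = (\<integral>z. f (fst z) \<partial>P)" for f :: "point \<Rightarrow> real"
  using integral_distr[OF fst_measurable, of f] by (simp add: measurable_Q_iff) (simp add: Q lawX_def)

lemma lift_integrable: "integrable Q f \<Longrightarrow> integrable P (\<lambda>z. f (fst z))" for f :: "point \<Rightarrow> real"
  unfolding Q lawX_def by (rule integrable_distr[OF fst_measurable])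

lemma s_star_L2: "s_star \<in> borel_measurable Q" "integrable Q (\<lambda>x. (s_star x)\<^sup>2)"
  and \<sigma>_measurable: "\<sigma> \<in> borel_measurable Q"
  using model unfolding regression_model_def L2_def Q[symmetric] by auto

definition residual :: "observation \<Rightarrow> real" where
  "residual z = snd z - s_star (fst z)"

lemma residual_measurable [measurable]: "residual \<in> borel_measurable P"
  unfolding residual_def[abs_def] using lift_measurable[OF s_star_L2(1)] by simp

lemma residual_integrable: "integrable P residual"
  and residual_square_integrable: "integrable P (\<lambda>z. (residual z)\<^sup>2)"
proof -
  have [measurable]: "(\<lambda>z. s_star (fst z)) \<in> borel_measurable P" by (rule lift_measurable[OF s_star_L2(1)])
  have y: "integrable P snd" by (rule integrable_const_bound[of _ A]) (use response_bound in auto)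
  have s: "integrable P (\<lambda>z. s_star (fst z))"
    by (rule square_integrable_imp_integrable[OF _ lift_integrable[OF s_star_L2(2)]]) auto
  show "integrable P residual" unfolding residual_def[abs_def] using y s by simp
  have y2: "integrable P (\<lambda>z. (snd z)\<^sup>2)"
  proof (rule integrable_const_bound[of _ "A\<^sup>2"])
    show "AE z in P. norm ((snd z)\<^sup>2) \<le> A\<^sup>2"
      using AE_abs_square_le[OF response_bound] by simp
  qed auto
  have ys: "integrable P (\<lambda>z. snd z * s_star (fst z))"
  proof (rule Bochner_Integration.integrable_bound)
    show "integrable P (\<lambda>z. A * s_star (fst z))" using s by simp
    show "AE z in P. norm (snd z * s_star (fst z)) \<le> norm (A * s_star (fst z))"
      using response_bound
    proof eventually_elim
      case (elim z)
      then show ?case using A_pos by (auto simp: abs_mult intro!: mult_right_mono)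
    qed
  qed auto
  have "integrable P (\<lambda>z. (snd z)\<^sup>2 - 2 * (snd z * s_star (fst z)) + (s_star (fst z))\<^sup>2)"
    using y2 ys lift_integrable[OF s_star_L2(2)] by simp
  moreover have "(residual z)\<^sup>2 = (snd z)\<^sup>2 - 2 * (snd z * s_star (fst z)) + (s_star (fst z))\<^sup>2" for z
    by (simp add: residual_def power2_eq_square algebra_simps)
  ultimately show "integrable P (\<lambda>z. (residual z)\<^sup>2)" by simp
qed

lemma integrable_bounded_mult:
  fixes g :: "observation \<Rightarrow> real"
  assumes "g \<in> borel_measurable P" "AE z in P. \<bar>g z\<bar> \<le> c" "integrable P f"
  shows "integrable P (\<lambda>z. g z * f z)"
proof (rule Bochner_Integration.integrable_bound)
  show "integrable P (\<lambda>z. c * f z)" using assms(3) by simp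
  show "AE z in P. norm (g z * f z) \<le> norm (c * f z)"
    using assms(2) by eventually_elim (auto simp: abs_mult intro!: mult_right_mono)
  show "(\<lambda>z. g z * f z) \<in> borel_measurable P"
    using assms(1) borel_measurable_integrable[OF assms(3)] by measurable
qed

text \<open>Factors measurable in the covariate are moved through the conditional expectation of
  \<open>\<epsilon>\<close> and of its square. The integrability this requires is read off the
  residual, which is almost surely \<open>\<sigma> (fst z) * \<epsilon> z\<close>;
  \<open>\<sigma>\<close> by itself is known to be measurable only.\<close>

lemma
  fixes g :: "point \<Rightarrow> real"
  assumes g: "g \<in> borel_measurable Q" "AE z in P. \<bar>g (fst z)\<bar> \<le> c"
  shows residual_centered: "(\<integral>z. g (fst z) * residual z \<partial>P) = 0"
    and residual_variance: "(\<integral>z. g (fst z) * (residual z)\<^sup>2 \<partial>P) = (\<integral>z. g (fst z) * (\<sigma> (fst z))\<^sup>2 \<partial>P)"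
    and sigma_integrable: "integrable P (\<lambda>z. g (fst z) * (\<sigma> (fst z))\<^sup>2)"
proof -
  define F where "F = vimage_algebra (space P) fst (restrict_space (euclid d) \<X>)"
  obtain \<epsilon> where \<epsilon>: "\<epsilon> \<in> borel_measurable P" "integrable P \<epsilon>" "integrable P (\<lambda>z. (\<epsilon> z)\<^sup>2)"
    and eq: "AE z in P. snd z = s_star (fst z) + \<sigma> (fst z) * \<epsilon> z"
    and ce: "AE z in P. real_cond_exp P F \<epsilon> z = 0" "AE z in P. real_cond_exp P F (\<lambda>z. (\<epsilon> z)\<^sup>2) z = 1"
    using model unfolding regression_model_def F_def Let_def by blast
  note [measurable] = \<epsilon>(1)
  have fs: "fst \<in> space P \<rightarrow> space (restrict_space (euclid d) \<X>)"
    using measurable_space[OF fst_measurable] by auto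
  have sub: "subalgebra P F"
    unfolding subalgebra_def
  proof
    show "space F = space P" by (simp add: F_def)
    show "sets F \<subseteq> sets P"
      unfolding F_def sets_vimage_algebra2[OF fs] using measurable_sets[OF fst_measurable] by auto
  qed
  interpret F: finite_measure_subalgebra P F
    by standard (rule sub)
  have lift: "(\<lambda>z. f (fst z)) \<in> borel_measurable F" if "f \<in> borel_measurable Q" for f :: "point \<Rightarrow> real"
    using that unfolding measurable_Q_iff F_def by (rule measurable_compose[OF measurable_vimage_algebra1[OF fs]])
  note gm = lift_measurable[OF g(1)] and sm = lift_measurable[OF \<sigma>_measurable]
  note [measurable] = gm sm
  have eq1: "AE z in P. g (fst z) * residual z = g (fst z) * \<sigma> (fst z) * \<epsilon> z"
    using eq by eventually_elim (simp add: residual_def)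
  have eq2: "AE z in P. g (fst z) * (residual z)\<^sup>2 = g (fst z) * (\<sigma> (fst z))\<^sup>2 * (\<epsilon> z)\<^sup>2"
    using eq by eventually_elim (simp add: residual_def power_mult_distrib)
  have i1: "integrable P (\<lambda>z. g (fst z) * \<sigma> (fst z) * \<epsilon> z)"
    using integrable_bounded_mult[OF gm g(2) residual_integrable]
    by (rule integrable_cong_AE_imp) (use eq1 in auto)
  have i2: "integrable P (\<lambda>z. g (fst z) * (\<sigma> (fst z))\<^sup>2 * (\<epsilon> z)\<^sup>2)"
    using integrable_bounded_mult[OF gm g(2) residual_square_integrable]
    by (rule integrable_cong_AE_imp) (use eq2 in auto)
  have "(\<integral>z. g (fst z) * residual z \<partial>P) = (\<integral>z. g (fst z) * \<sigma> (fst z) * \<epsilon> z \<partial>P)"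
    by (rule integral_cong_AE) (use eq1 in auto)
  also have "\<dots> = (\<integral>z. g (fst z) * \<sigma> (fst z) * real_cond_exp P F \<epsilon> z \<partial>P)"
    by (rule F.real_cond_exp_intg(2)[symmetric]) (use i1 lift[OF g(1)] lift[OF \<sigma>_measurable] in auto)
  also have "\<dots> = (\<integral>z. 0 \<partial>P)"
    by (rule integral_cong_AE) (use ce(1) in \<open>auto elim: eventually_mono\<close>)
  finally show "(\<integral>z. g (fst z) * residual z \<partial>P) = 0" by simp
  have fm: "(\<lambda>z. g (fst z) * (\<sigma> (fst z))\<^sup>2) \<in> borel_measurable F"
    using lift[OF g(1)] lift[OF \<sigma>_measurable] by measurable
  have one: "AE z in P. g (fst z) * (\<sigma> (fst z))\<^sup>2 * real_cond_exp P F (\<lambda>z. (\<epsilon> z)\<^sup>2) z = g (fst z) * (\<sigma> (fst z))\<^sup>2"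
    using ce(2) by eventually_elim simp
  have "(\<integral>z. g (fst z) * (residual z)\<^sup>2 \<partial>P) = (\<integral>z. g (fst z) * (\<sigma> (fst z))\<^sup>2 * (\<epsilon> z)\<^sup>2 \<partial>P)"
    by (rule integral_cong_AE) (use eq2 in auto)
  also have "\<dots> = (\<integral>z. g (fst z) * (\<sigma> (fst z))\<^sup>2 * real_cond_exp P F (\<lambda>z. (\<epsilon> z)\<^sup>2) z \<partial>P)"
    by (rule F.real_cond_exp_intg(2)[symmetric, OF i2 fm]) simp
  also have "\<dots> = (\<integral>z. g (fst z) * (\<sigma> (fst z))\<^sup>2 \<partial>P)"
    by (rule integral_cong_AE) (use one in auto)
  finally show "(\<integral>z. g (fst z) * (residual z)\<^sup>2 \<partial>P) = (\<integral>z. g (fst z) * (\<sigma> (fst z))\<^sup>2 \<partial>P)" .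
  have "integrable P (\<lambda>z. g (fst z) * (\<sigma> (fst z))\<^sup>2 * real_cond_exp P F (\<lambda>z. (\<epsilon> z)\<^sup>2) z)"
    by (rule F.real_cond_exp_intg(1)[OF i2 fm]) simp
  then show "integrable P (\<lambda>z. g (fst z) * (\<sigma> (fst z))\<^sup>2)"
    by (rule integrable_cong_AE_imp) (use one in \<open>auto elim: eventually_mono\<close>)
qed

lemma residual_variance_ge:
  assumes g: "g \<in> borel_measurable Q" "AE z in P. \<bar>g (fst z)\<bar> \<le> c" "\<And>x. 0 \<le> g x"
  shows "\<sigma>m\<^sup>2 * (\<integral>z. g (fst z) \<partial>P) \<le> (\<integral>z. g (fst z) * (residual z)\<^sup>2 \<partial>P)"
proof -
  have "AE z in distr P (restrict_space (euclid d) \<X>) fst. \<sigma>m \<le> \<sigma> z"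
    using noise_level unfolding An_def Q lawX_def .
  then have s: "AE z in P. \<sigma>m \<le> \<sigma> (fst z)"
    by (rule AE_distrD[OF fst_measurable])
  have ig: "integrable P (\<lambda>z. g (fst z))"
    by (rule integrable_const_bound[of _ c]) (use g lift_measurable in auto)
  have "(\<integral>z. \<sigma>m\<^sup>2 * g (fst z) \<partial>P) \<le> (\<integral>z. g (fst z) * (\<sigma> (fst z))\<^sup>2 \<partial>P)"
  proof (rule integral_mono_AE)
    show "AE z in P. \<sigma>m\<^sup>2 * g (fst z) \<le> g (fst z) * (\<sigma> (fst z))\<^sup>2"
      using s
    proof eventually_elim
      case (elim z)
      then have "\<sigma>m\<^sup>2 \<le> (\<sigma> (fst z))\<^sup>2" using \<sigma>m_pos by (intro power_mono) auto
      then show ?case using g(3) by (simp add: mult.commute mult_left_mono)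
    qed
  qed (use ig sigma_integrable[OF g(1,2)] in auto)
  then show ?thesis using residual_variance[OF g(1,2)] by simp
qed

text \<open>Where \<open>c * s_star\<close> exceeds \<open>A\<close>, the response lies strictly on
  one side of \<open>s_star\<close>. The indicator of that event times the signed residual is thus
  nonnegative with mean zero, so it vanishes almost surely, which forces the event to be null. The
  two signs \<open>c\<close> give the absolute value.\<close>

lemma s_star_bound: "AE z in P. \<bar>s_star (fst z)\<bar> \<le> A"
proof -
  have main: "AE z in P. c * s_star (fst z) \<le> A" if c: "c = 1 \<or> c = -1" for c :: real
  proof -
    define g where "g = (\<lambda>x. if c * s_star x > A then 1 else 0 :: real)"
    have gm: "g \<in> borel_measurable Q" unfolding g_def using s_star_L2(1) by measurable
    have gb: "AE z in P. \<bar>g (fst z)\<bar> \<le> 1" by (auto simp: g_def)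
    note [measurable] = lift_measurable[OF gm]
    let ?f = "\<lambda>z. - c * (g (fst z) * residual z)"
    have f0: "AE z in P. 0 \<le> ?f z"
      using response_bound
    proof eventually_elim
      case (elim z)
      then show ?case using c by (auto simp: g_def residual_def)
    qed
    have int: "integrable P ?f" using integrable_bounded_mult[OF _ gb residual_integrable] by simp
    have "(\<integral>z. ?f z \<partial>P) = 0" using residual_centered[OF gm gb] by simp
    then have "AE z in P. ?f z = 0" using integral_nonneg_eq_0_iff_AE[OF int f0] by simp
    then show ?thesis
      using response_bound
    proof eventually_elim
      case (elim z)
      then show ?case using c by (auto simp: g_def residual_def split: if_splits)
    qed
  qed
  show ?thesis using main[of 1] main[of "-1"] by (auto simp: abs_le_iff)
qed

end

text \<open>With \<open>y = ln x / 4\<close>, the bounds 4 * y at most (1 + y)^2 and 1 + y at most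
  exp y give (4 * y)^2 at most exp (4 * y) = x.\<close>

lemma ln_square_le_self:
  fixes x :: real
  assumes "1 \<le> x"
  shows "(ln x)\<^sup>2 \<le> x"
proof -
  define y where "y = ln x / 4"
  have y: "0 \<le> y" using assms by (simp add: y_def)
  have "4 * y \<le> (1 + y)\<^sup>2" using zero_le_power2[of "1 - y"] by (simp add: power2_eq_square algebra_simps)
  then have "(4 * y)\<^sup>2 \<le> ((1 + y)\<^sup>2)\<^sup>2" using y by (intro power_mono) auto
  also have "\<dots> = (1 + y) ^ 4" by (simp add: power_mult[symmetric])
  also have "\<dots> \<le> exp y ^ 4" using y by (intro power_mono) auto
  also have "\<dots> = x" using assms by (simp add: y_def exp_of_nat_mult[symmetric])
  finally show ?thesis by (simp add: y_def)
qed

section \<open>One model of the collection and its projection\<close>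

locale regression_with_model = bounded_regression +
  fixes m :: "(point \<Rightarrow> real) set" and b n :: nat and J :: "nat \<Rightarrow> nat set" and a :: "nat \<Rightarrow> real"
    and \<phi> :: "nat \<Rightarrow> point \<Rightarrow> real" and r Ac Ap :: real
  assumes is_model: "is_model Q m"
    and basis: "localized_basis r Ac Q m b J a \<phi>" and dims: "P2 Ap n m b a"
    and proj_bound: "sup_norm (space Q) (orth_proj Q m s_star) \<le> ereal A"
    and r_pos: "0 < r" and Ac_pos: "0 < Ac" and Ap_pos: "0 < Ap" and ln_n: "1 \<le> ln (real n)"
begin

abbreviation D :: nat where "D \<equiv> dim m"

sublocale Q: prob_space Q
  unfolding Q lawX_def by (rule prob_space_distr[OF fst_measurable])

lemma subspace_m: "subspace m" and m_L2: "m \<subseteq> L2 Q"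
  using is_model by (auto simp: is_model_def)

lemma m_measurable: "f \<in> m \<Longrightarrow> f \<in> borel_measurable Q"
  using m_L2 by (auto simp: L2_def)

lemma \<phi>_in: "k \<in> {1..D} \<Longrightarrow> \<phi> k \<in> m"
  and \<phi>_orthonormal: "k \<in> {1..D} \<Longrightarrow> l \<in> {1..D} \<Longrightarrow> (\<integral>x. \<phi> k x * \<phi> l x \<partial>Q) = (if k = l then 1 else 0)"
  and span_\<phi>: "span (\<phi> ` {1..D}) = m"
  using basis unfolding localized_basis_def orthonormal_basis_def L2_inner_def by auto

lemma blocks: "indexed_partition J {1..b} {1..D}"
  using basis by (simp add: localized_basis_def)

lemma \<phi>_bound:
  assumes "i \<in> {1..b}" "k \<in> J i" "x \<in> \<X>"
  shows "\<bar>\<phi> k x\<bar> \<le> r * sqrt (a i)"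
proof -
  have "sup_norm (space Q) (\<phi> k) \<le> ereal (r * sqrt (a i))"
    using basis assms(1,2) unfolding localized_basis_def by blast
  then have "ereal \<bar>\<phi> k x\<bar> \<le> ereal (r * sqrt (a i))"
    using assms(3) unfolding sup_norm_def space_Q by (simp add: SUP_le_iff)
  then show ?thesis by simp
qed

lemma \<phi>_bounded: "k \<in> {1..D} \<Longrightarrow> \<exists>c. \<forall>x\<in>\<X>. \<bar>\<phi> k x\<bar> \<le> c"
proof -
  assume "k \<in> {1..D}"
  then obtain i where "i \<in> {1..b}" "k \<in> J i" using blocks unfolding indexed_partition_def by blast
  then show ?thesis using \<phi>_bound by blast
qed

lemma m_combination: "f \<in> m \<Longrightarrow> \<exists>c. \<forall>x. f x = (\<Sum>k=1..D. c k * \<phi> k x)"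
  using span_image_combination[of "{1..D}" f \<phi>] unfolding span_\<phi> by simp

lemma m_bounded:
  assumes "f \<in> m"
  shows "\<exists>c. \<forall>x\<in>\<X>. \<bar>f x\<bar> \<le> c"
proof -
  obtain c where c: "\<And>x. f x = (\<Sum>k=1..D. c k * \<phi> k x)" using m_combination[OF assms] by blast
  have "\<exists>e. \<forall>k\<in>{1..D}. \<forall>x\<in>\<X>. \<bar>\<phi> k x\<bar> \<le> e k" using \<phi>_bounded by (intro bchoice) auto
  then obtain e where e: "\<And>k x. k \<in> {1..D} \<Longrightarrow> x \<in> \<X> \<Longrightarrow> \<bar>\<phi> k x\<bar> \<le> e k" by blast
  have "\<bar>f x\<bar> \<le> (\<Sum>k=1..D. \<bar>c k\<bar> * e k)" if "x \<in> \<X>" for x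
    unfolding c by (rule order_trans[OF sum_abs]) (auto simp: abs_mult intro!: sum_mono mult_left_mono e that)
  then show ?thesis by blast
qed

lemma integrable_m_mult:
  assumes f: "f \<in> m" and g: "g \<in> borel_measurable Q" "integrable Q (\<lambda>x. (g x)\<^sup>2)"
  shows "integrable Q (\<lambda>x. g x * f x)"
proof -
  obtain c where c: "\<And>x. x \<in> \<X> \<Longrightarrow> \<bar>f x\<bar> \<le> c" using m_bounded[OF f] by blast
  have [measurable]: "f \<in> borel_measurable Q" by (rule m_measurable[OF f])
  have gi: "integrable Q g" by (rule Q.square_integrable_imp_integrable[OF g])
  show ?thesis
  proof (rule Bochner_Integration.integrable_bound)
    show "integrable Q (\<lambda>x. c * g x)" using gi by simp
    show "AE x in Q. norm (g x * f x) \<le> norm (c * g x)"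
    proof (rule AE_I2)
      fix x assume "x \<in> space Q"
      then have "\<bar>f x\<bar> \<le> \<bar>c\<bar>" using c by (force simp: space_Q)
      then have "\<bar>g x\<bar> * \<bar>f x\<bar> \<le> \<bar>g x\<bar> * \<bar>c\<bar>" by (rule mult_left_mono) simp
      then show "norm (g x * f x) \<le> norm (c * g x)" by (simp add: abs_mult mult.commute)
    qed
    show "(\<lambda>x. g x * f x) \<in> borel_measurable Q" using g(1) by measurable
  qed
qed

lemma integrable_m_m: "f \<in> m \<Longrightarrow> g \<in> m \<Longrightarrow> integrable Q (\<lambda>x. g x * f x)"
  using m_L2 by (intro integrable_m_mult) (auto simp: L2_def)

definition sm :: "point \<Rightarrow> real" where
  "sm = orth_proj Q m s_star"

text \<open>Ensures that the description in \<open>orth_proj\<close> denotes. Existence comes from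
  the Fourier coefficients; two candidates differ by an element of \<open>m\<close> of norm zero,
  which is the zero function because distinct elements of a model are distinct almost
  everywhere.\<close>

lemma sm: "sm \<in> m" "f \<in> m \<Longrightarrow> (\<integral>x. (s_star x - sm x) * f x \<partial>Q) = 0"
proof -
  let ?orth = "\<lambda>p. p \<in> m \<and> (\<forall>f\<in>m. L2_inner Q (\<lambda>x. s_star x - p x) f = 0)"
  have split: "(\<integral>x. (s_star x - p x) * f x \<partial>Q) = (\<integral>x. s_star x * f x \<partial>Q) - (\<integral>x. p x * f x \<partial>Q)"
    if "p \<in> m" "f \<in> m" for p f
    using integrable_m_mult[OF that(2) s_star_L2] integrable_m_m[OF that(2,1)] by (simp add: left_diff_distrib)
  define c where "c = (\<lambda>k. \<integral>x. s_star x * \<phi> k x \<partial>Q)"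
  define p where "p = (\<Sum>k=1..D. c k *\<^sub>R \<phi> k)"
  have p: "p \<in> m" unfolding p_def by (intro subspace_sum subspace_m subspace_scale \<phi>_in)
  have px: "p x = (\<Sum>k=1..D. c k * \<phi> k x)" for x by (simp add: p_def sum_fun_apply scaleR_fun_def)
  have p\<phi>: "(\<integral>x. (s_star x - p x) * \<phi> l x \<partial>Q) = 0" if l: "l \<in> {1..D}" for l
  proof -
    have int: "integrable Q (\<lambda>x. c k * (\<phi> k x * \<phi> l x))" if "k \<in> {1..D}" for k
      using integrable_m_m[OF \<phi>_in[OF l] \<phi>_in[OF that]] by simp
    have "(\<integral>x. p x * \<phi> l x \<partial>Q) = (\<integral>x. (\<Sum>k=1..D. c k * (\<phi> k x * \<phi> l x)) \<partial>Q)"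
      by (simp add: px sum_distrib_right mult.assoc)
    also have "\<dots> = (\<Sum>k=1..D. \<integral>x. c k * (\<phi> k x * \<phi> l x) \<partial>Q)"
      by (rule Bochner_Integration.integral_sum[OF int])
    also have "\<dots> = (\<Sum>k=1..D. if k = l then c k else 0)"
    proof (intro sum.cong refl)
      fix k assume "k \<in> {1..D}"
      then show "(\<integral>x. c k * (\<phi> k x * \<phi> l x) \<partial>Q) = (if k = l then c k else 0)"
        using \<phi>_orthonormal[OF _ l] by simp
    qed
    also have "\<dots> = c l" using l by simp
    finally show ?thesis unfolding split[OF p \<phi>_in[OF l]] by (simp add: c_def)
  qed
  have exists: "?orth p"
  proof (intro conjI ballI p)
    fix f assume f: "f \<in> m"
    obtain e where e: "\<And>x. f x = (\<Sum>k=1..D. e k * \<phi> k x)" using m_combination[OF f] by blast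
    have int: "integrable Q (\<lambda>x. e k * ((s_star x - p x) * \<phi> k x))" if k: "k \<in> {1..D}" for k
      using integrable_m_mult[OF \<phi>_in[OF k] s_star_L2] integrable_m_m[OF \<phi>_in[OF k] p]
      by (simp add: left_diff_distrib)
    have "L2_inner Q (\<lambda>x. s_star x - p x) f = (\<integral>x. (\<Sum>k=1..D. e k * ((s_star x - p x) * \<phi> k x)) \<partial>Q)"
      unfolding L2_inner_def e by (simp add: sum_distrib_left mult_ac)
    also have "\<dots> = (\<Sum>k=1..D. \<integral>x. e k * ((s_star x - p x) * \<phi> k x) \<partial>Q)"
      by (rule Bochner_Integration.integral_sum[OF int])
    also have "\<dots> = 0" using p\<phi> by (intro sum.neutral) auto
    finally show "L2_inner Q (\<lambda>x. s_star x - p x) f = 0" .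
  qed
  have unique: "q = p" if q: "?orth q" for q
  proof -
    have qp: "q - p \<in> m" using q p subspace_m by (intro subspace_diff) auto
    then have "(\<integral>x. (s_star x - q x) * (q - p) x \<partial>Q) = 0" "(\<integral>x. (s_star x - p x) * (q - p) x \<partial>Q) = 0"
      using q exists unfolding L2_inner_def by blast+
    then have "(\<integral>x. q x * (q - p) x \<partial>Q) - (\<integral>x. p x * (q - p) x \<partial>Q) = 0"
      using split[OF _ qp] q p by simp
    moreover have "(\<integral>x. (q - p) x * (q - p) x \<partial>Q) = (\<integral>x. q x * (q - p) x \<partial>Q) - (\<integral>x. p x * (q - p) x \<partial>Q)"
      using integrable_m_m[OF qp] q p
      by (subst Bochner_Integration.integral_diff[symmetric]) (auto simp: left_diff_distrib)
    ultimately have "(\<integral>x. (q - p) x * (q - p) x \<partial>Q) = 0" by simp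
    then have "AE x in Q. (q - p) x * (q - p) x = 0"
      using integral_nonneg_eq_0_iff_AE[OF integrable_m_m[OF qp qp]] by auto
    then have "AE x in Q. (q - p) x = 0" by auto
    then have "q - p = 0" using is_model qp unfolding is_model_def by blast
    then show ?thesis by simp
  qed
  have "?orth (THE p. ?orth p)" by (rule theI[of ?orth, OF exists unique])
  then show "sm \<in> m" "f \<in> m \<Longrightarrow> (\<integral>x. (s_star x - sm x) * f x \<partial>Q) = 0"
    unfolding sm_def orth_proj_def L2_inner_def by blast+
qed

lemma sm_bound: "x \<in> \<X> \<Longrightarrow> \<bar>sm x\<bar> \<le> A"
proof -
  assume x: "x \<in> \<X>"
  then have "ereal \<bar>sm x\<bar> \<le> ereal A"
    using proj_bound unfolding sup_norm_def space_Q sm_def by (simp add: SUP_le_iff)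
  then show ?thesis by simp
qed

text \<open>The basis functions lifted to observations. Outside the index range they are set to 0,
  because \<open>localized_model\<close> requires measurability for every index.\<close>

definition \<psi> :: "nat \<Rightarrow> observation \<Rightarrow> real" where
  "\<psi> k z = (if k \<in> {1..D} then \<phi> k (fst z) else 0)"

definition noise :: "observation \<Rightarrow> real" where
  "noise z = snd z - sm (fst z)"

definition loss_gap :: "observation \<Rightarrow> real" where
  "loss_gap z = contrast sm z - contrast s_star z"

definition approx :: "point \<Rightarrow> real" where
  "approx x = s_star x - sm x"

lemma approx_measurable: "approx \<in> borel_measurable Q"
  unfolding approx_def[abs_def] using s_star_L2(1) m_measurable[OF sm(1)] by measurable

lemma noise_eq: "noise z = residual z + approx (fst z)"
  by (simp add: noise_def residual_def approx_def)

lemma loss_gap_eq: "loss_gap z = (approx (fst z))\<^sup>2 + 2 * (approx (fst z) * residual z)"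
  by (cases z) (simp add: loss_gap_def contrast_def approx_def residual_def power2_eq_square algebra_simps)

lemma approx_bound: "AE z in P. \<bar>approx (fst z)\<bar> \<le> 2 * A"
  using s_star_bound AE_space
proof eventually_elim
  case (elim z)
  then have "\<bar>sm (fst z)\<bar> \<le> A" by (intro sm_bound) (auto simp: space_P)
  then show ?case using elim unfolding approx_def by linarith
qed

lemma \<psi>_measurable: "\<psi> k \<in> borel_measurable P"
proof (cases "k \<in> {1..D}")
  case True
  then show ?thesis unfolding \<psi>_def[abs_def] using lift_measurable[OF m_measurable[OF \<phi>_in[OF True]]] by simp
next
  case False
  then have "\<psi> k = (\<lambda>_. 0)" by (auto simp: \<psi>_def fun_eq_iff)
  then show ?thesis by simp
qed

lemma \<phi>_AE_bounded: "k \<in> {1..D} \<Longrightarrow> \<exists>c. AE z in P. \<bar>\<phi> k (fst z)\<bar> \<le> c"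
proof -
  assume "k \<in> {1..D}"
  then obtain c where "\<And>x. x \<in> \<X> \<Longrightarrow> \<bar>\<phi> k x\<bar> \<le> c" using \<phi>_bounded by blast
  then have "AE z in P. \<bar>\<phi> k (fst z)\<bar> \<le> c" by (intro AE_I2) (auto simp: space_P)
  then show ?thesis by blast
qed

lemma bounded_integrable:
  assumes "g \<in> borel_measurable Q" "AE z in P. \<bar>g (fst z)\<bar> \<le> c"
  shows "integrable P (\<lambda>z. g (fst z) * residual z)" "integrable P (\<lambda>z. g (fst z) * (residual z)\<^sup>2)"
    "integrable P (\<lambda>z. g (fst z))"
  using integrable_bounded_mult[OF lift_measurable[OF assms(1)] assms(2) residual_integrable]
    integrable_bounded_mult[OF lift_measurable[OF assms(1)] assms(2) residual_square_integrable]
  by (simp_all add: integrable_const_bound[of _ c] assms(2) lift_measurable[OF assms(1)])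

lemma approx_square: "(\<lambda>x. (approx x)\<^sup>2) \<in> borel_measurable Q" "AE z in P. \<bar>(approx (fst z))\<^sup>2\<bar> \<le> (2 * A)\<^sup>2"
proof -
  show "(\<lambda>x. (approx x)\<^sup>2) \<in> borel_measurable Q" using approx_measurable by measurable
  show "AE z in P. \<bar>(approx (fst z))\<^sup>2\<bar> \<le> (2 * A)\<^sup>2"
    using AE_abs_square_le[OF approx_bound] by simp
qed

lemma loss_gap_le: "AE z in P. \<bar>loss_gap z\<bar> \<le> 4 * A * \<bar>approx (fst z)\<bar>"
  using s_star_bound response_bound AE_space
proof eventually_elim
  case (elim z)
  then have "\<bar>sm (fst z)\<bar> \<le> A" by (intro sm_bound) (auto simp: space_P)
  \<comment> \<open>The quantity inside is twice the response minus \<open>s_star\<close> and minus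
    \<open>sm\<close>, each bounded by \<open>A\<close>.\<close>
  then have "\<bar>approx (fst z) + 2 * residual z\<bar> \<le> 4 * A"
    using elim unfolding approx_def residual_def abs_le_iff by auto
  then have "\<bar>approx (fst z)\<bar> * \<bar>approx (fst z) + 2 * residual z\<bar> \<le> \<bar>approx (fst z)\<bar> * (4 * A)"
    by (rule mult_left_mono) simp
  moreover have "loss_gap z = approx (fst z) * (approx (fst z) + 2 * residual z)"
    unfolding loss_gap_eq by (simp add: power2_eq_square algebra_simps)
  ultimately show ?case by (simp add: abs_mult mult_ac)
qed

lemma loss_gap_mean: "(\<integral>z. loss_gap z \<partial>P) = (\<integral>z. (approx (fst z))\<^sup>2 \<partial>P)"
  unfolding loss_gap_eq
  using bounded_integrable(1)[OF approx_measurable approx_bound] bounded_integrable(3)[OF approx_square]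
    residual_centered[OF approx_measurable approx_bound]
  by simp

lemma loss_gap_measurable: "loss_gap \<in> borel_measurable P"
proof -
  have [measurable]: "(\<lambda>z. approx (fst z)) \<in> borel_measurable P" by (rule lift_measurable[OF approx_measurable])
  show ?thesis unfolding loss_gap_eq[abs_def] by measurable
qed

text \<open>Instantiates the abstract analysis. The noise is bounded by \<open>2 * A\<close> and the
  variances from below by \<open>\<sigma>m\<^sup>2\<close>. The value \<open>16 * A\<^sup>2\<close>
  comes from squaring the bound \<open>4 * A\<close> in \<open>loss_gap_le\<close>; it also bounds
  the loss gap itself.\<close>

sublocale LR: localized_regression P D b n J a \<psi> noise r Ac Ap "2 * A" "\<sigma>m\<^sup>2" loss_gap
  "excess_risk P s_star sm" "16 * A\<^sup>2"
proof
  have J_sub: "k \<in> {1..D}" if "i \<in> {1..b}" "k \<in> J i" for i k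
    using blocks that unfolding indexed_partition_def by blast
  show "0 < r" "0 < Ac" "0 < Ap" by (fact r_pos Ac_pos Ap_pos)+
  show "0 < 2 * A" "0 < \<sigma>m\<^sup>2" "0 < 16 * A\<^sup>2" using A_pos \<sigma>m_pos by auto
  show "indexed_partition J {1..b} {1..D}" by (rule blocks)
  show b: "b \<noteq> 0" using basis by (simp add: localized_basis_def)
  show "0 < a i" if "i \<in> {1..b}" for i using basis that by (simp add: localized_basis_def)
  show "a i \<le> a b" if "i \<in> {1..b}" for i
    using mono_onD[of "{1..b}" a i b] basis that b by (simp add: localized_basis_def)
  show "(\<Sum>i=1..b. sqrt (a i)) \<le> r * sqrt (real D)" using basis by (simp add: localized_basis_def)
  show "\<psi> k \<in> borel_measurable P" for k by (rule \<psi>_measurable)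
  show "\<bar>\<psi> k z\<bar> \<le> r * sqrt (a i)" if "i \<in> {1..b}" "k \<in> J i" "z \<in> space P" for i k z
    using \<phi>_bound[OF that(1,2), of "fst z"] that(3) J_sub[OF that(1,2)] by (auto simp: \<psi>_def space_P)
  show "real (card {l \<in> J j. \<exists>z\<in>space P. \<psi> k z \<noteq> 0 \<and> \<psi> l z \<noteq> 0}) \<le> Ac * max (a j / a i) 1"
    if i: "i \<in> {1..b}" and j: "j \<in> {1..b}" and k: "k \<in> J i" for i j k
  proof -
    let ?S = "\<lambda>f. {x \<in> space Q. f x \<noteq> 0}"
    have fin: "finite (J j)" using J_sub[OF j] by (metis finite_atLeastAtMost finite_subset subsetI)
    have "{l \<in> J j. \<exists>z\<in>space P. \<psi> k z \<noteq> 0 \<and> \<psi> l z \<noteq> 0} \<subseteq> {l \<in> J j. ?S (\<phi> k) \<inter> ?S (\<phi> l) \<noteq> {}}"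
    proof safe
      fix l y x and c :: real
      assume "(x, c) \<in> space P" "\<psi> k (x, c) \<noteq> 0" "\<psi> l (x, c) \<noteq> 0" "?S (\<phi> k) \<inter> ?S (\<phi> l) = {}"
      then show False by (auto simp: \<psi>_def space_P space_Q split: if_splits)
    qed
    then have "card {l \<in> J j. \<exists>z\<in>space P. \<psi> k z \<noteq> 0 \<and> \<psi> l z \<noteq> 0} \<le> card {l \<in> J j. ?S (\<phi> k) \<inter> ?S (\<phi> l) \<noteq> {}}"
      using fin by (intro card_mono) auto
    moreover have "real (card {l \<in> J j. ?S (\<phi> k) \<inter> ?S (\<phi> l) \<noteq> {}}) \<le> Ac * max (a j / a i) 1"
      using basis i j k unfolding localized_basis_def Let_def by blast
    ultimately show ?thesis by linarith
  qed
  show "(\<integral>z. \<psi> k z * \<psi> l z \<partial>P) = (if k = l then 1 else 0)" if "k \<in> {1..D}" "l \<in> {1..D}" for k l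
  proof -
    have "(\<lambda>x. \<phi> k x * \<phi> l x) \<in> borel_measurable Q"
      using m_measurable[OF \<phi>_in[OF that(1)]] m_measurable[OF \<phi>_in[OF that(2)]] by measurable
    from lift_integral[OF this] show ?thesis using \<phi>_orthonormal[OF that] that by (simp add: \<psi>_def)
  qed
  show "1 \<le> D" "real D \<le> Ap * real n / (ln (real n))\<^sup>2" "(real b)\<^sup>2 * a b \<le> Ap * real n / (ln (real n))\<^sup>2"
    using dims by (auto simp: P2_def)
  show "noise \<in> borel_measurable P"
    unfolding noise_def[abs_def] using lift_measurable[OF m_measurable[OF sm(1)]] by measurable
  show "AE z in P. \<bar>noise z\<bar> \<le> 2 * A"
    using response_bound AE_space
  proof eventually_elim
    case (elim z)
    then have "\<bar>sm (fst z)\<bar> \<le> A" by (intro sm_bound) (auto simp: space_P)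
    then show ?case using elim unfolding noise_def by linarith
  qed
  fix k assume k: "k \<in> {1..D}"
  note \<phi>m = m_measurable[OF \<phi>_in[OF k]]
  obtain c where c: "AE z in P. \<bar>\<phi> k (fst z)\<bar> \<le> c" using \<phi>_AE_bounded[OF k] by blast
  have ab: "(\<lambda>x. approx x * \<phi> k x) \<in> borel_measurable Q" using approx_measurable \<phi>m by measurable
  have abb: "AE z in P. \<bar>approx (fst z) * \<phi> k (fst z)\<bar> \<le> 2 * A * c"
    using approx_bound c
  proof eventually_elim
    case (elim z)
    then show ?case using A_pos unfolding abs_mult by (intro mult_mono) auto
  qed
  have "(\<integral>z. \<psi> k z * noise z \<partial>P) = (\<integral>z. \<phi> k (fst z) * residual z + approx (fst z) * \<phi> k (fst z) \<partial>P)"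
    using k by (simp add: \<psi>_def noise_eq distrib_left mult.commute)
  also have "\<dots> = (\<integral>z. \<phi> k (fst z) * residual z \<partial>P) + (\<integral>z. approx (fst z) * \<phi> k (fst z) \<partial>P)"
    by (rule Bochner_Integration.integral_add)
      (rule bounded_integrable(1)[OF \<phi>m c], rule bounded_integrable(3)[OF ab abb])
  also have "(\<integral>z. approx (fst z) * \<phi> k (fst z) \<partial>P) = 0"
    using lift_integral[OF ab] sm(2)[OF \<phi>_in[OF k]] by (simp add: approx_def)
  finally show "(\<integral>z. \<psi> k z * noise z \<partial>P) = 0" using residual_centered[OF \<phi>m c] by simp
  let ?g = "\<lambda>x. (\<phi> k x)\<^sup>2" and ?g' = "\<lambda>x. (\<phi> k x)\<^sup>2 * approx x" and ?g'' = "\<lambda>x. (\<phi> k x * approx x)\<^sup>2"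
  have gm: "?g \<in> borel_measurable Q" "?g' \<in> borel_measurable Q" "?g'' \<in> borel_measurable Q"
    using approx_measurable \<phi>m by measurable
  have gb: "AE z in P. \<bar>?g (fst z)\<bar> \<le> c\<^sup>2"
    using AE_abs_square_le[OF c] by simp
  have gb': "AE z in P. \<bar>?g' (fst z)\<bar> \<le> c\<^sup>2 * (2 * A)"
    using gb approx_bound
  proof eventually_elim
    case (elim z)
    then show ?case unfolding abs_mult by (intro mult_mono) auto
  qed
  have gb'': "AE z in P. \<bar>?g'' (fst z)\<bar> \<le> (2 * A * c)\<^sup>2"
    using AE_abs_square_le[OF abb] by (simp add: mult.commute)
  \<comment> \<open>The noise is the residual plus the approximation error, a function of the
    covariate. The cross term is centred and the square of the approximation error only adds, so the
    residual alone gives the lower bound.\<close>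
  have "(\<integral>z. (\<psi> k z * noise z)\<^sup>2 \<partial>P) = (\<integral>z. ?g (fst z) * (residual z)\<^sup>2 + 2 * (?g' (fst z) * residual z) + ?g'' (fst z) \<partial>P)"
    using k by (intro Bochner_Integration.integral_cong refl) (simp add: \<psi>_def noise_eq power2_eq_square algebra_simps)
  also have "\<dots> = (\<integral>z. ?g (fst z) * (residual z)\<^sup>2 \<partial>P) + 2 * (\<integral>z. ?g' (fst z) * residual z \<partial>P) + (\<integral>z. ?g'' (fst z) \<partial>P)"
    using bounded_integrable(2)[OF gm(1) gb] bounded_integrable(1)[OF gm(2) gb'] bounded_integrable(3)[OF gm(3) gb'']
    by simp
  also have "\<dots> \<ge> (\<integral>z. ?g (fst z) * (residual z)\<^sup>2 \<partial>P)"
    using residual_centered[OF gm(2) gb'] by simp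
  moreover have "\<sigma>m\<^sup>2 * (\<integral>z. ?g (fst z) \<partial>P) \<le> (\<integral>z. ?g (fst z) * (residual z)\<^sup>2 \<partial>P)"
    by (rule residual_variance_ge[OF gm(1) gb]) simp
  moreover have "(\<integral>z. ?g (fst z) \<partial>P) = 1"
    using lift_integral[OF gm(1)] \<phi>_orthonormal[OF k k] by (simp add: power2_eq_square)
  ultimately show "\<sigma>m\<^sup>2 \<le> (\<integral>z. (\<psi> k z * noise z)\<^sup>2 \<partial>P)" by simp
next
  show "1 \<le> ln (real n)" by (rule ln_n)
  then have "1 \<le> real n" by (cases "n = 0") auto
  then show "(ln (real n))\<^sup>2 \<le> real n" by (rule ln_square_le_self)
  show "loss_gap \<in> borel_measurable P" by (rule loss_gap_measurable)
  show mean: "(\<integral>z. loss_gap z \<partial>P) = excess_risk P s_star sm"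
    by (simp add: excess_risk_def loss_gap_def)
  \<comment> \<open>By \<open>loss_gap_mean\<close> this excess risk is the integral of a
    square.\<close>
  then show "0 \<le> excess_risk P s_star sm" unfolding loss_gap_mean by (simp flip: mean[unfolded loss_gap_mean])
  show "AE z in P. \<bar>loss_gap z\<bar> \<le> 16 * A\<^sup>2"
    using loss_gap_le approx_bound
  proof eventually_elim
    case (elim z)
    have "4 * A * \<bar>approx (fst z)\<bar> \<le> 4 * A * (2 * A)" using elim A_pos by (intro mult_left_mono) auto
    also have "\<dots> \<le> 16 * A\<^sup>2" using A_pos by (simp add: power2_eq_square)
    finally show ?case using elim by linarith
  qed
  have "(\<integral>z. (loss_gap z)\<^sup>2 \<partial>P) \<le> (\<integral>z. 16 * A\<^sup>2 * (approx (fst z))\<^sup>2 \<partial>P)"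
  proof (rule integral_mono_AE')
    show "integrable P (\<lambda>z. 16 * A\<^sup>2 * (approx (fst z))\<^sup>2)"
      using bounded_integrable(3)[OF approx_square] by simp
    show "AE z in P. (loss_gap z)\<^sup>2 \<le> 16 * A\<^sup>2 * (approx (fst z))\<^sup>2"
      using loss_gap_le
    proof eventually_elim
      case (elim z)
      from power_mono[OF elim, of 2] show ?case by (simp add: power_mult_distrib)
    qed
  qed auto
  then show "(\<integral>z. (loss_gap z)\<^sup>2 \<partial>P) \<le> 16 * A\<^sup>2 * excess_risk P s_star sm"
    using loss_gap_mean mean by simp
qed

end
text \<open>The outcome of the analysis of one model, with relative error \<open>q\<close> and
  absolute error \<open>e\<close>. The centre \<open>t\<close> is bound existentially because its
  value refers to the localized basis of the model; \<open>q\<close> and \<open>e\<close> are the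
  same for all models.\<close>

definition cv_bounds ::
  "real \<Rightarrow> real \<Rightarrow> observation measure \<Rightarrow> (point \<Rightarrow> real) \<Rightarrow> nat \<Rightarrow> nat \<Rightarrow> (nat \<Rightarrow> nat set) \<Rightarrow>
     (point \<Rightarrow> real) set \<Rightarrow> sample \<Rightarrow> bool" where
  "cv_bounds q e P s n V F m u \<longleftrightarrow> (\<exists>t\<ge>0.
    (\<forall>f. least_squares {1..n} u m f \<longrightarrow> excess_risk P s f \<le> t + (q * t + e)) \<and>
    (\<forall>j\<in>{1..V}. \<forall>f. least_squares ({1..n} - F j) u m f \<longrightarrow>
       0 \<le> excess_risk P s f \<and> t - (q * t + e) \<le> excess_risk P s f) \<and>
    (\<forall>f. (\<forall>j\<in>{1..V}. least_squares ({1..n} - F j) u m (f j)) \<longrightarrow>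
       \<bar>(\<Sum>j=1..V. empirical (F j) u (contrast (f j))) / real V - empirical {1..n} u (contrast s) - t\<bar> \<le> q * t + e))"

section \<open>Least-squares estimators on one model\<close>

context regression_with_model
begin

text \<open>Taking the projection as origin, the orthogonality relations of least squares become
  \<open>LR.normal_eqs\<close>, and the loss relative to \<open>s_star\<close> splits into the loss
  gap of the model and a quadratic expression in the coordinates.\<close>

lemma least_squares_decomposition:
  assumes I: "finite I" "I \<noteq> {}" and ls: "least_squares I u m f"
  obtains \<beta> where "LR.normal_eqs I u \<beta>"
    and "\<And>z. contrast f z - contrast s_star z = loss_gap z + ((\<Sum>k=1..D. \<beta> k * \<psi> k z)\<^sup>2 - 2 * (\<Sum>k=1..D. \<beta> k * \<psi> k z) * noise z)"
    and "excess_risk P s_star f = excess_risk P s_star sm + (\<Sum>k=1..D. (\<beta> k)\<^sup>2)"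
proof -
  have f: "f \<in> m" using ls unfolding least_squares_def is_arg_min_linorder by auto
  then have "f - sm \<in> m" using sm(1) subspace_m by (intro subspace_diff)
  then obtain \<beta> where "\<And>x. (f - sm) x = (\<Sum>k=1..D. \<beta> k * \<phi> k x)" using m_combination by blast
  then have "f (fst z) - sm (fst z) = (\<Sum>k=1..D. \<beta> k * \<psi> k z)" for z by (simp add: \<psi>_def)
  then have fz: "f (fst z) = sm (fst z) + (\<Sum>k=1..D. \<beta> k * \<psi> k z)" for z by (simp add: algebra_simps)
  have ne: "LR.normal_eqs I u \<beta>"
    unfolding LR.normal_eqs_def
  proof
    fix k assume k: "k \<in> {1..D}"
    have "(\<Sum>i\<in>I. \<phi> k (fst (u i)) * (snd (u i) - f (fst (u i)))) = 0"
      by (rule least_squares_normal_equation[OF I ls subspace_m \<phi>_in[OF k]])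
    then show "(\<Sum>i\<in>I. \<psi> k (u i) * (noise (u i) - (\<Sum>l=1..D. \<beta> l * \<psi> l (u i)))) = 0"
      using k unfolding fz by (simp add: \<psi>_def noise_def algebra_simps)
  qed
  have gap: "contrast f z - contrast s_star z = loss_gap z + ((\<Sum>k=1..D. \<beta> k * \<psi> k z)\<^sup>2 - 2 * (\<Sum>k=1..D. \<beta> k * \<psi> k z) * noise z)" for z
  proof -
    have "contrast f z = (snd z - f (fst z))\<^sup>2" "contrast sm z = (snd z - sm (fst z))\<^sup>2"
      by (simp_all add: contrast_def split: prod.split)
    then show ?thesis unfolding fz by (simp add: loss_gap_def noise_def power2_eq_square algebra_simps)
  qed
  show thesis
    by (rule that[OF ne gap]) (simp only: excess_risk_def[of P s_star f] gap LR.excess_integral)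
qed

lemma cv_comparison_least_squares:
  assumes K: "0 < K" and folds: "regular_folds n V F" "2 \<le> V" "real V \<le> R"
    and typical: "LR.typical K (cv_sets n V F) u"
    and small: "LR.gram_const K / sqrt (ln (real n)) \<le> 1 / 4"
  defines "c \<equiv> LR.cv_const K R"
  shows "cv_bounds (c / sqrt (ln (real n))) (c * ln (real n) ^ 3 / real n) P s_star n V F m u"
proof -
  define t where "t = excess_risk P s_star sm + LR.noise_energy / (real n - real n / real V)"
  note cmp = LR.cv_comparison[OF K folds typical small, folded t_def]
  let ?err = "c / sqrt (ln (real n)) * t + c * ln (real n) ^ 3 / real n"
  have err: "?err = LR.cv_const K R * LR.rel_error t" by (simp add: c_def LR.rel_error_def distrib_left)
  have n: "0 < n" using LR.n_pos by simp
  have cF: "real (card (F j)) = real n / real V" if "j \<in> {1..V}" for j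
    using folds(1) that by (simp add: regular_folds_def)
  \<comment> \<open>A fold is at most half of the sample, so each training set is nonempty, as
    division by its size requires.\<close>
  have ne_T: "{1..n} - F j \<noteq> {}" if j: "j \<in> {1..V}" for j
  proof
    assume "{1..n} - F j = {}"
    then have "F j = {1..n}" using regular_folds_subset[OF folds(1) j] by auto
    then have "real n = real n / real V" using cF[OF j] by simp
    then show False using n folds(2) half_fold_le[OF folds(2), of n] by simp
  qed
  have t0: "0 \<le> t"
  proof -
    have "0 \<le> real n - real n / real V" using half_fold_le[OF folds(2), of n] by linarith
    then show ?thesis unfolding t_def using LR.bias_nonneg LR.energy_nonneg by simp
  qed
  show ?thesis
    unfolding cv_bounds_def
  proof (intro exI[of _ t] conjI allI impI ballI t0)
    fix f assume ls: "least_squares {1..n} u m f"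
    obtain \<beta> where "LR.normal_eqs {1..n} u \<beta>" "excess_risk P s_star f = excess_risk P s_star sm + (\<Sum>k=1..D. (\<beta> k)\<^sup>2)"
      by (rule least_squares_decomposition[OF _ _ ls]) (use n in auto)
    then show "excess_risk P s_star f \<le> t + ?err" using cmp(1) by (simp only: err)
  next
    fix j f assume j: "j \<in> {1..V}" and ls: "least_squares ({1..n} - F j) u m f"
    obtain \<beta> where \<beta>: "LR.normal_eqs ({1..n} - F j) u \<beta>" "excess_risk P s_star f = excess_risk P s_star sm + (\<Sum>k=1..D. (\<beta> k)\<^sup>2)"
      by (rule least_squares_decomposition[OF _ ne_T[OF j] ls]) auto
    show "0 \<le> excess_risk P s_star f" unfolding \<beta>(2) using LR.bias_nonneg by (intro add_nonneg_nonneg sum_nonneg) auto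
    show "t - ?err \<le> excess_risk P s_star f" using cmp(2)[OF j \<beta>(1)] by (simp only: err \<beta>(2))
  next
    fix f assume ls: "\<forall>j\<in>{1..V}. least_squares ({1..n} - F j) u m (f j)"
    define Q where "Q = (\<lambda>\<beta> z. (\<Sum>k=1..D. \<beta> k * \<psi> k z)\<^sup>2 - 2 * (\<Sum>k=1..D. \<beta> k * \<psi> k z) * noise z)"
    have "\<exists>\<beta>. LR.normal_eqs ({1..n} - F j) u \<beta> \<and> (\<forall>z. contrast (f j) z - contrast s_star z = loss_gap z + Q \<beta> z)"
      if j: "j \<in> {1..V}" for j
    proof -
      have "least_squares ({1..n} - F j) u m (f j)" using ls j by blast
      then obtain \<beta> where "LR.normal_eqs ({1..n} - F j) u \<beta>" "\<And>z. contrast (f j) z - contrast s_star z = loss_gap z + Q \<beta> z"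
        unfolding Q_def by (rule least_squares_decomposition[OF _ ne_T[OF j], rotated]) auto
      then show ?thesis by blast
    qed
    then have "\<exists>\<gamma>. \<forall>j\<in>{1..V}. LR.normal_eqs ({1..n} - F j) u (\<gamma> j) \<and> (\<forall>z. contrast (f j) z - contrast s_star z = loss_gap z + Q (\<gamma> j) z)"
      by (intro bchoice) blast
    then obtain \<gamma> where \<gamma>: "\<And>j. j \<in> {1..V} \<Longrightarrow> LR.normal_eqs ({1..n} - F j) u (\<gamma> j)"
      and gap: "\<And>j z. j \<in> {1..V} \<Longrightarrow> contrast (f j) z - contrast s_star z = loss_gap z + Q (\<gamma> j) z"
      by blast
    \<comment> \<open>Equal fold sizes turn the average of the fold means into one mean over the
      sample.\<close>
    have "(\<Sum>j=1..V. empirical (F j) u (contrast (f j))) / real V = (\<Sum>j=1..V. \<Sum>i\<in>F j. contrast (f j) (u i)) / real n"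
    proof -
      have "empirical (F j) u (contrast (f j)) = (\<Sum>i\<in>F j. contrast (f j) (u i)) * (real V / real n)" if "j \<in> {1..V}" for j
        using cF[OF that] by (simp add: empirical_def)
      then have "(\<Sum>j=1..V. empirical (F j) u (contrast (f j))) = (\<Sum>j=1..V. \<Sum>i\<in>F j. contrast (f j) (u i)) * (real V / real n)"
        unfolding sum_distrib_right by (intro sum.cong) auto
      then show ?thesis using folds(2) by simp
    qed
    \<comment> \<open>The losses of \<open>s_star\<close> add up to its empirical risk on the whole
      sample, a quantity common to all models.\<close>
    also have "(\<Sum>j=1..V. \<Sum>i\<in>F j. contrast (f j) (u i)) = (\<Sum>j=1..V. \<Sum>i\<in>F j. contrast s_star (u i) + loss_gap (u i) + Q (\<gamma> j) (u i))"
      proof (intro sum.cong refl)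
      fix j i assume "j \<in> {1..V}"
      from gap[OF this, of "u i"]
      show "contrast (f j) (u i) = contrast s_star (u i) + loss_gap (u i) + Q (\<gamma> j) (u i)" by simp
    qed
    also have "\<dots> = (\<Sum>i=1..n. contrast s_star (u i)) + ((\<Sum>i=1..n. loss_gap (u i)) + (\<Sum>j=1..V. \<Sum>i\<in>F j. Q (\<gamma> j) (u i)))"
      unfolding sum_folds[OF folds(1)] by (simp add: sum.distrib)
    finally have "(\<Sum>j=1..V. empirical (F j) u (contrast (f j))) / real V - empirical {1..n} u (contrast s_star)
      = ((\<Sum>i=1..n. loss_gap (u i)) + (\<Sum>j=1..V. \<Sum>i\<in>F j. Q (\<gamma> j) (u i))) / real n"
      by (simp add: empirical_def add_divide_distrib)
    then show "\<bar>(\<Sum>j=1..V. empirical (F j) u (contrast (f j))) / real V - empirical {1..n} u (contrast s_star) - t\<bar> \<le> ?err"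
      using cmp(3)[of \<gamma>] \<gamma> unfolding Q_def err by simp
  qed
qed

text \<open>There are at most \<open>2 * R + 1\<close> index sets, each with a number of events of
  order n^2 because \<open>D\<close> is at most \<open>Ap * n\<close>. This is the factor in front
  of n^(-K).\<close>

lemma holds_except_cv_bounds:
  assumes K: "0 < K" and folds: "regular_folds n V F" "2 \<le> V" "real V \<le> R"
    and small: "LR.gram_const K / sqrt (ln (real n)) \<le> 1 / 4"
  defines "c \<equiv> LR.cv_const K R"
  shows "holds_except (sample_measure n P)
    (((2 * R + 1) * (Ap\<^sup>2 + 2 + Ap) + 1) * (real n)\<^sup>2 * (2 * exp (- (K * ln (real n)))))
    (cv_bounds (c / sqrt (ln (real n))) (c * ln (real n) ^ 3 / real n) P s_star n V F m)"
proof -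
  have "holds_except (sample_measure n P)
    ((real (card (cv_sets n V F)) * ((real D)\<^sup>2 + 2 + real n * real D) + 1) * (2 * exp (- (K * ln (real n)))))
    (LR.typical K (cv_sets n V F))"
    unfolding sample_measure_def
    by (rule LR.holds_except_typical[OF K finite_cv_sets cv_sets_subset[OF folds(1)]])
  then show ?thesis
  proof (rule holds_except_mono)
    have n: "1 \<le> real n" using LR.n_pos by simp
    then have n2: "1 \<le> (real n)\<^sup>2" by (simp add: one_le_power)
    have "real (card (cv_sets n V F)) \<le> real (2 * V + 1)" using card_cv_sets by (intro of_nat_mono)
    then have card: "real (card (cv_sets n V F)) \<le> 2 * R + 1" using folds(3) by simp
    have "(real D)\<^sup>2 \<le> (Ap * real n)\<^sup>2" using LR.dim_le_n by (intro power_mono) auto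
    moreover have "real n * real D \<le> real n * (Ap * real n)" using LR.dim_le_n by (intro mult_left_mono) auto
    ultimately have "(real D)\<^sup>2 + 2 + real n * real D \<le> (Ap\<^sup>2 + 2 + Ap) * (real n)\<^sup>2"
      using n2 by (simp add: power_mult_distrib power2_eq_square algebra_simps)
    with card have "real (card (cv_sets n V F)) * ((real D)\<^sup>2 + 2 + real n * real D) \<le> (2 * R + 1) * ((Ap\<^sup>2 + 2 + Ap) * (real n)\<^sup>2)"
      by (intro mult_mono) auto
    then have "real (card (cv_sets n V F)) * ((real D)\<^sup>2 + 2 + real n * real D) + 1 \<le> ((2 * R + 1) * (Ap\<^sup>2 + 2 + Ap) + 1) * (real n)\<^sup>2"
      using n2 by (simp add: algebra_simps)
    then show "(real (card (cv_sets n V F)) * ((real D)\<^sup>2 + 2 + real n * real D) + 1) * (2 * exp (- (K * ln (real n))))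
      \<le> ((2 * R + 1) * (Ap\<^sup>2 + 2 + Ap) + 1) * (real n)\<^sup>2 * (2 * exp (- (K * ln (real n))))"
      by (rule mult_right_mono) simp
  next
    fix u assume "LR.typical K (cv_sets n V F) u"
    then show "cv_bounds (c / sqrt (ln (real n))) (c * ln (real n) ^ 3 / real n) P s_star n V F m u"
      unfolding c_def by (rule cv_comparison_least_squares[OF K folds _ small])
  qed
qed

end

text \<open>Here \<open>t\<close> and \<open>t'\<close> are the centres of a competitor and of the
  selected model. The passage from \<open>t'\<close> to \<open>t\<close> through the criteria and
  the passage from \<open>t\<close> to the competitor's risk \<open>y\<close> each cost a factor
  \<open>p\<close>. The common offset \<open>c0\<close> cancels.\<close>

lemma selection_inequality:
  fixes q :: real
  assumes q: "0 \<le> q" "q \<le> 1/4" and e: "0 \<le> e" and t: "0 \<le> t" "0 \<le> t'"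
    and selected: "x \<le> t' + (q * t' + e)" "\<bar>c' - c0 - t'\<bar> \<le> q * t' + e"
    and other: "\<bar>c - c0 - t\<bar> \<le> q * t + e" "t - (q * t + e) \<le> y"
    and min: "c' \<le> c"
  shows "x \<le> (1 + 12 * q) * y + 9 * e"
proof -
  define p where "p = (1 + q) / (1 - q)"
  have p1: "1 \<le> p" using q by (simp add: p_def field_simps)
  have p2: "p \<le> 5/3" using q by (simp add: p_def field_simps)
  have p3: "p\<^sup>2 \<le> 1 + 12 * q"
  proof -
    \<comment> \<open>After clearing the denominator, the difference of the two sides of the claim
      is exactly this product.\<close>
    have "0 \<le> 4 * q * ((2 - 6 * q) + 3 * q\<^sup>2)" using q by (intro mult_nonneg_nonneg add_nonneg_nonneg) auto
    then have "(1 + q)\<^sup>2 \<le> (1 + 12 * q) * (1 - q)\<^sup>2"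
      by (simp add: power2_eq_square algebra_simps)
    then show ?thesis using q by (simp add: p_def power_divide divide_le_eq)
  qed
  have pq: "p * (1 - q) = 1 + q" using q by (simp add: p_def)
  have "(1 - q) * t' \<le> (1 + q) * t + 2 * e"
    using selected(2) other(1) min by (simp add: algebra_simps abs_le_iff)
  then have "p * ((1 - q) * t') \<le> p * ((1 + q) * t + 2 * e)" using p1 by (intro mult_left_mono) auto
  then have 1: "(1 + q) * t' \<le> p * ((1 + q) * t) + p * (2 * e)"
    unfolding mult.assoc[symmetric] pq distrib_left .
  have y: "(1 - q) * t \<le> y + e" using other(2) by (simp add: algebra_simps)
  have "p * ((1 - q) * t) \<le> p * (y + e)" using p1 by (intro mult_left_mono y) simp
  then have 2: "(1 + q) * t \<le> p * (y + e)" unfolding mult.assoc[symmetric] pq .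
  have "0 \<le> (1 - q) * t" using q t by simp
  with y have ye: "0 \<le> y + e" by (rule order_trans[rotated])
  have "p * ((1 + q) * t) \<le> p * (p * (y + e))" using p1 by (intro mult_left_mono 2) simp
  with 1 have "(1 + q) * t' \<le> p * (p * (y + e)) + p * (2 * e)" by (meson add_right_mono order_trans)
  also have "\<dots> = p\<^sup>2 * (y + e) + p * (2 * e)" by (simp add: power2_eq_square)
  also have "\<dots> \<le> (1 + 12 * q) * (y + e) + 5/3 * (2 * e)"
    using p2 p3 ye e by (intro add_mono mult_right_mono) auto
  finally have "(1 + q) * t' \<le> (1 + 12 * q) * (y + e) + 5/3 * (2 * e)" .
  \<comment> \<open>The absolute errors total at most 4 + 10/3 + 1 times \<open>e\<close>, which is
    below 9.\<close>
  moreover have "(1 + 12 * q) * e \<le> 4 * e" using q e by (intro mult_right_mono) auto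
  ultimately show ?thesis using selected(1) e by (simp add: algebra_simps)
qed

section \<open>Selection\<close>

lemma eventually_small_div_sqrt_ln:
  fixes c :: real
  shows "eventually (\<lambda>n. 1 \<le> ln (real n) \<and> c / sqrt (ln (real n)) \<le> 1 / 4) sequentially"
proof -
  have "filterlim (\<lambda>n. ln (real n)) at_top sequentially"
    by (rule filterlim_compose[OF ln_at_top filterlim_real_sequentially])
  then have "eventually (\<lambda>n. max 1 ((4 * c)\<^sup>2) \<le> ln (real n)) sequentially"
    unfolding filterlim_at_top by blast
  then show ?thesis
  proof eventually_elim
    case (elim n)
    then have "4 * c \<le> sqrt (ln (real n))" by (intro real_le_rsqrt) simp
    then show ?case using elim by (simp add: field_simps)
  qed
qed

lemma cv_bounds_selection:
  assumes b: "cv_bounds q e P s n V F m u" "cv_bounds q e P s n V F m' u"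
    and q: "0 \<le> q" "q \<le> 1 / 4" and e: "0 \<le> e" and V: "1 \<in> {1..V}"
    and full: "least_squares {1..n} u m' s_hat"
    and folds: "\<And>j. j \<in> {1..V} \<Longrightarrow> least_squares ({1..n} - F j) u m (t j m)"
      "\<And>j. j \<in> {1..V} \<Longrightarrow> least_squares ({1..n} - F j) u m' (t j m')"
    and min: "cv_criterion V F u t m' \<le> cv_criterion V F u t m"
  shows "0 \<le> excess_risk P s (t 1 m)"
    and "excess_risk P s s_hat \<le> (1 + 12 * q) * excess_risk P s (t 1 m) + 9 * e"
proof -
  obtain \<tau> where \<tau>: "0 \<le> \<tau>"
    "\<forall>j\<in>{1..V}. \<forall>f. least_squares ({1..n} - F j) u m f \<longrightarrow>
       0 \<le> excess_risk P s f \<and> \<tau> - (q * \<tau> + e) \<le> excess_risk P s f"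
    "\<forall>f. (\<forall>j\<in>{1..V}. least_squares ({1..n} - F j) u m (f j)) \<longrightarrow>
       \<bar>(\<Sum>j=1..V. empirical (F j) u (contrast (f j))) / real V - empirical {1..n} u (contrast s) - \<tau>\<bar> \<le> q * \<tau> + e"
    using b(1) unfolding cv_bounds_def by blast
  obtain \<tau>' where \<tau>': "0 \<le> \<tau>'"
    "\<forall>f. least_squares {1..n} u m' f \<longrightarrow> excess_risk P s f \<le> \<tau>' + (q * \<tau>' + e)"
    "\<forall>f. (\<forall>j\<in>{1..V}. least_squares ({1..n} - F j) u m' (f j)) \<longrightarrow>
       \<bar>(\<Sum>j=1..V. empirical (F j) u (contrast (f j))) / real V - empirical {1..n} u (contrast s) - \<tau>'\<bar> \<le> q * \<tau>' + e"
    using b(2) unfolding cv_bounds_def by blast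
  have risk: "0 \<le> excess_risk P s (t 1 m)" "\<tau> - (q * \<tau> + e) \<le> excess_risk P s (t 1 m)"
    using \<tau>(2) V folds(1)[OF V] by blast+
  have crit: "\<bar>cv_criterion V F u t m - empirical {1..n} u (contrast s) - \<tau>\<bar> \<le> q * \<tau> + e"
    unfolding cv_criterion_def using folds(1) by (intro \<tau>(3)[rule_format])
  have crit': "\<bar>cv_criterion V F u t m' - empirical {1..n} u (contrast s) - \<tau>'\<bar> \<le> q * \<tau>' + e"
    unfolding cv_criterion_def using folds(2) by (intro \<tau>'(3)[rule_format])
  show "0 \<le> excess_risk P s (t 1 m)" by (rule risk(1))
  show "excess_risk P s s_hat \<le> (1 + 12 * q) * excess_risk P s (t 1 m) + 9 * e"
    by (rule selection_inequality[OF q e \<tau>(1) \<tau>'(1) \<tau>'(2)[rule_format, OF full] crit' crit risk(2) min])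
qed

theorem theorem4p1:
  fixes c\<^sub>M \<alpha>\<^sub>M r\<^sub>M A\<^sub>c A\<^sub>p c\<^sub>r A\<^sub>r A \<sigma>\<^sub>m \<beta>\<^sub>p C\<^sub>p r :: real
  assumes "0 < c\<^sub>M" "0 < \<alpha>\<^sub>M" "0 < r\<^sub>M" "0 < A\<^sub>c" "0 < A\<^sub>p" "0 < c\<^sub>r" "0 < A\<^sub>r"
    and "0 < \<sigma>\<^sub>m" "0 < \<beta>\<^sub>p" "0 < C\<^sub>p"
    and "2 < r"
  shows "\<exists>L>0. \<exists>n\<^sub>0 :: nat. \<forall>n\<ge>n\<^sub>0. \<forall>d \<X> P s_star \<sigma> \<M> V B s_hat s_fold m_hat Q.
    Q = lawX d \<X> P \<longrightarrow>
    regression_model d \<X> P s_star \<sigma> \<longrightarrow>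
    finite \<M> \<longrightarrow> (\<forall>m\<in>\<M>. is_model Q m) \<longrightarrow>
    P1 c\<^sub>M \<alpha>\<^sub>M n \<M> \<longrightarrow> Auslb_P2 r\<^sub>M A\<^sub>c A\<^sub>p n Q \<M> \<longrightarrow> P3 c\<^sub>r A\<^sub>r n \<M> \<longrightarrow>
    Ab A P Q s_star \<M> \<longrightarrow> An \<sigma>\<^sub>m Q \<sigma> \<longrightarrow> Apu \<beta>\<^sub>p C\<^sub>p P Q s_star \<M> \<longrightarrow>
    V \<in> {2..n - 1} \<longrightarrow> real V \<le> r \<longrightarrow> regular_folds n V B \<longrightarrow>
    (\<forall>\<omega>\<in>space (sample_measure n P). \<forall>m\<in>\<M>. least_squares {1..n} \<omega> m (s_hat \<omega> m)) \<longrightarrow>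
    (\<forall>\<omega>\<in>space (sample_measure n P). \<forall>m\<in>\<M>. \<forall>j\<in>{1..V}.
       least_squares ({1..n} - B j) \<omega> m (s_fold \<omega> j m)) \<longrightarrow>
    (\<forall>\<omega>\<in>space (sample_measure n P).
       is_arg_min (cv_criterion V B \<omega> (s_fold \<omega>)) (\<lambda>m. m \<in> \<M>) (m_hat \<omega>)) \<longrightarrow>
    (\<exists>E\<in>sets (sample_measure n P).
       1 - L / (real n)\<^sup>2 \<le> measure (sample_measure n P) E \<and>
       (\<forall>\<omega>\<in>E. excess_risk P s_star (s_hat \<omega> (m_hat \<omega>))
          \<le> (1 + L / sqrt (ln (real n))) * (INF m\<in>\<M>. excess_risk P s_star (s_fold \<omega> 1 m))
             + L * (ln (real n)) ^ 3 / real n))"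
proof -
  \<comment> \<open>\<open>Ab\<close> is compatible with a bound \<open>A\<close> that is not
    positive; enlarging it keeps \<open>Ab\<close> valid and gives the positive constant required by
    the locales.\<close>
  define A' where "A' = max A 1"
  \<comment> \<open>The \<open>n^2\<close> events per model and the n^\<alpha> models leave n^(-2)
    out of n^(-K).\<close>
  define K where "K = \<alpha>\<^sub>M + 4"
  \<comment> \<open>The exported locale constants list the parameters on which they depend. These
    are among the constants of the assumptions, so the integer obtained from \<open>g\<close> and
    \<open>c\<close> does not depend on the law or on the models.\<close>
  define g where "g = localized_model.gram_const r\<^sub>M A\<^sub>c A\<^sub>p K"
  define c where "c = localized_regression.cv_const r\<^sub>M A\<^sub>c A\<^sub>p (2 * A') (\<sigma>\<^sub>m\<^sup>2) (16 * A'\<^sup>2) K r"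
  define p where "p = (2 * r + 1) * (A\<^sub>p\<^sup>2 + 2 + A\<^sub>p) + 1"
  \<comment> \<open>The first summand bounds the failure probability, and 21 = 12 + 9 covers the
    factors in the selection inequality. The absolute value makes \<open>L\<close> positive before
    \<open>0 \<le> c\<close> is available from the analysis of a model.\<close>
  define L where "L = 2 * c\<^sub>M * p + 21 * \<bar>c\<bar>"
  have A': "0 < A'" "A \<le> A'" by (auto simp: A'_def)
  have K: "0 < K" using assms by (simp add: K_def)
  have p: "0 < p" using assms by (simp add: p_def add_pos_pos)
  have L: "0 < L" using assms p by (simp add: L_def add_pos_nonneg)
  obtain n\<^sub>0 where n\<^sub>0: "\<And>n. n\<^sub>0 \<le> n \<Longrightarrow> 1 \<le> ln (real n) \<and> g / sqrt (ln (real n)) \<le> 1 / 4 \<and> c / sqrt (ln (real n)) \<le> 1 / 4"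
    using eventually_conj[OF eventually_small_div_sqrt_ln[of g] eventually_small_div_sqrt_ln[of c]]
    unfolding eventually_sequentially by blast
  show ?thesis
  proof (intro exI[of _ L] conjI L exI[of _ n\<^sub>0] allI impI)
    fix n :: nat and d \<X> P s_star \<sigma> \<M> V B s_hat s_fold m_hat and Q :: "point measure"
    assume n: "n\<^sub>0 \<le> n" and Q: "Q = lawX d \<X> P" and model: "regression_model d \<X> P s_star \<sigma>"
      and fin: "finite \<M>" and models: "\<forall>m\<in>\<M>. is_model Q m"
      and P1: "P1 c\<^sub>M \<alpha>\<^sub>M n \<M>" and basis: "Auslb_P2 r\<^sub>M A\<^sub>c A\<^sub>p n Q \<M>" and P3: "P3 c\<^sub>r A\<^sub>r n \<M>"
      and Ab: "Ab A P Q s_star \<M>" and An: "An \<sigma>\<^sub>m Q \<sigma>"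
      and V: "V \<in> {2..n - 1}" "real V \<le> r" and folds: "regular_folds n V B"
      and full: "\<forall>\<omega>\<in>space (sample_measure n P). \<forall>m\<in>\<M>. least_squares {1..n} \<omega> m (s_hat \<omega> m)"
      and train: "\<forall>\<omega>\<in>space (sample_measure n P). \<forall>m\<in>\<M>. \<forall>j\<in>{1..V}. least_squares ({1..n} - B j) \<omega> m (s_fold \<omega> j m)"
      and sel: "\<forall>\<omega>\<in>space (sample_measure n P). is_arg_min (cv_criterion V B \<omega> (s_fold \<omega>)) (\<lambda>m. m \<in> \<M>) (m_hat \<omega>)"
    define l where "l = ln (real n)"
    have l: "1 \<le> l" and small: "g / sqrt l \<le> 1 / 4" "c / sqrt l \<le> 1 / 4" using n\<^sub>0[OF n] by (auto simp: l_def)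
    have n_pos: "0 < real n" using l by (cases "n = 0") (auto simp: l_def)
    have V2: "2 \<le> V" using V by simp
    \<comment> \<open>\<open>P3\<close> provides a member of the collection, so the infimum below is
      over a nonempty set.\<close>
    obtain m\<^sub>0 where m\<^sub>0: "m\<^sub>0 \<in> \<M>" using P3 unfolding P3_def by blast
    define N where "N = sample_measure n P"
    interpret bounded_regression d \<X> P s_star \<sigma> A' \<sigma>\<^sub>m Q
    proof
      show "AE z in P. \<bar>snd z\<bar> \<le> A'" using Ab A'(2) unfolding Ab_def by (auto elim: eventually_mono)
    qed (use model Q An A' assms in auto)
    interpret N: prob_space N
      unfolding N_def sample_measure_def by (rule prob_space_PiM) (rule prob_space_axioms)
    define q where "q = c / sqrt l"
    define e where "e = c * l ^ 3 / real n"
    have each: "holds_except N (p * (real n)\<^sup>2 * (2 * exp (- (K * l)))) (cv_bounds q e P s_star n V B m) \<and> 0 \<le> c"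
      if m: "m \<in> \<M>" for m
    proof -
      obtain b J a \<phi> where b: "localized_basis r\<^sub>M A\<^sub>c Q m b J a \<phi>" "P2 A\<^sub>p n m b a"
        using basis m unfolding Auslb_P2_def by blast
      interpret R: regression_with_model d \<X> P s_star \<sigma> A' \<sigma>\<^sub>m Q m b n J a \<phi> r\<^sub>M A\<^sub>c A\<^sub>p
      proof
        have "sup_norm (space Q) (orth_proj Q m s_star) \<le> ereal A" using Ab m unfolding Ab_def by blast
        also have "\<dots> \<le> ereal A'" using A'(2) by simp
        finally show "sup_norm (space Q) (orth_proj Q m s_star) \<le> ereal A'" .
      qed (use models m b assms l in \<open>auto simp: l_def\<close>)
      show ?thesis
        using R.holds_except_cv_bounds[OF K folds V2 V(2)] small R.LR.cv_const_nonneg[OF K, of r] assms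
        by (simp add: g_def c_def q_def e_def p_def N_def l_def)
    qed
    have c0: "0 \<le> c" using each[OF m\<^sub>0] by blast
    have q: "0 \<le> q" "q \<le> 1 / 4" using c0 l small by (auto simp: q_def)
    have e: "0 \<le> e" using c0 l by (simp add: e_def)
    have "holds_except N (real (card \<M>) * (p * (real n)\<^sup>2 * (2 * exp (- (K * l))))) (\<lambda>u. \<forall>m\<in>\<M>. cv_bounds q e P s_star n V B m u)"
      by (rule N.holds_except_ball[OF fin]) (use each in blast)
    then obtain F where F: "F \<in> sets N" "measure N F \<le> real (card \<M>) * (p * (real n)\<^sup>2 * (2 * exp (- (K * l))))"
      and good: "\<And>u m. u \<in> space N - F \<Longrightarrow> m \<in> \<M> \<Longrightarrow> cv_bounds q e P s_star n V B m u"
      unfolding holds_except_def by blast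
    have "real (card \<M>) * (p * (real n)\<^sup>2 * (2 * exp (- (K * l)))) \<le> (c\<^sub>M * real n powr \<alpha>\<^sub>M) * (p * (real n)\<^sup>2 * (2 * exp (- (K * l))))"
      using P1 p unfolding P1_def by (intro mult_right_mono) auto
    also have "\<dots> = 2 * c\<^sub>M * p * (real n powr \<alpha>\<^sub>M * real n powr 2 * real n powr (- K))"
      using n_pos by (simp add: powr_def l_def power2_eq_square exp_add[symmetric] exp_double)
    also have "real n powr \<alpha>\<^sub>M * real n powr 2 * real n powr (- K) = real n powr (-2)"
      unfolding powr_add[symmetric] by (simp add: K_def)
    also have "\<dots> = 1 / (real n)\<^sup>2" using n_pos by (simp add: powr_minus_divide)
    also have "2 * c\<^sub>M * p * (1 / (real n)\<^sup>2) \<le> L * (1 / (real n)\<^sup>2)"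
      by (intro mult_right_mono) (auto simp: L_def)
    finally have prob: "measure N F \<le> L / (real n)\<^sup>2" using F(2) by simp
    show "\<exists>E\<in>sets (sample_measure n P).
       1 - L / (real n)\<^sup>2 \<le> measure (sample_measure n P) E \<and>
       (\<forall>\<omega>\<in>E. excess_risk P s_star (s_hat \<omega> (m_hat \<omega>))
          \<le> (1 + L / sqrt (ln (real n))) * (INF m\<in>\<M>. excess_risk P s_star (s_fold \<omega> 1 m))
             + L * (ln (real n)) ^ 3 / real n)"
    proof (intro bexI[of _ "space N - F"] conjI ballI)
      show "space N - F \<in> sets (sample_measure n P)" using F(1) by (auto simp: N_def)
      show "1 - L / (real n)\<^sup>2 \<le> measure (sample_measure n P) (space N - F)"
        using N.prob_compl[OF F(1)] prob by (simp add: N_def)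
      fix \<omega> assume \<omega>: "\<omega> \<in> space N - F"
      let ?y = "\<lambda>m. excess_risk P s_star (s_fold \<omega> 1 m)"
      \<comment> \<open>A finite nonempty set attains its infimum, so a comparison with one
        competitor suffices.\<close>
      have "(INF m\<in>\<M>. ?y m) \<in> ?y ` \<M>"
        using fin m\<^sub>0 by (subst cInf_eq_Min) (auto intro!: Min_in)
      then obtain m where m: "m \<in> \<M>" "(INF m\<in>\<M>. ?y m) = ?y m" by blast
      have space: "\<omega> \<in> space (sample_measure n P)" using \<omega> by (simp add: N_def)
      have m': "m_hat \<omega> \<in> \<M>" "cv_criterion V B \<omega> (s_fold \<omega>) (m_hat \<omega>) \<le> cv_criterion V B \<omega> (s_fold \<omega>) m"
        using sel space m(1) unfolding is_arg_min_linorder by blast+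
      have "0 \<le> ?y m" and bound: "excess_risk P s_star (s_hat \<omega> (m_hat \<omega>)) \<le> (1 + 12 * q) * ?y m + 9 * e"
        using cv_bounds_selection[OF good[OF \<omega> m(1)] good[OF \<omega> m'(1)] q e, of "s_hat \<omega> (m_hat \<omega>)" "s_fold \<omega>"]
          full train space m(1) m' V2 by auto
      have cL: "12 * c \<le> L" "9 * c \<le> L" using c0 p assms by (auto simp: L_def)
      have "(1 + 12 * q) * ?y m \<le> (1 + L / sqrt l) * ?y m"
        using cL(1) l \<open>0 \<le> ?y m\<close> by (intro mult_right_mono add_left_mono) (auto simp: q_def divide_right_mono)
      moreover have "9 * e \<le> L * l ^ 3 / real n"
        using mult_right_mono[OF cL(2), of "l ^ 3 / real n"] l by (simp add: e_def)
      ultimately show "excess_risk P s_star (s_hat \<omega> (m_hat \<omega>))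
          \<le> (1 + L / sqrt (ln (real n))) * (INF m\<in>\<M>. ?y m) + L * (ln (real n)) ^ 3 / real n"
        using bound unfolding m(2) l_def by linarith
    qed
  qed
qed

end
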